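(* Let $\mathcal{H}$ be a Hilbert space, let $\mathfrak{A}\subset\mathcal{B}(\mathcal{H})$ be a concrete C*-algebra with unit and let $\Phi:\mathfrak{A}\to\mathfrak{A}$ be a unital completely positive map. Put $\sigma_0=\mathrm{id}:\mathfrak{A}\to\mathcal{B}(\mathcal{H}_0)$ with $\mathcal{H}_0=\mathcal{H}$ and, recursively for $n\ge 0$, put $\Phi_n=\sigma_n\circ\Phi:\mathfrak{A}\to\mathcal{B}(\mathcal{H}_n)$ and let $(\mathbf{V}_n,\sigma_{n+1},\mathcal{H}_{n+1})$ be the Stinespring dilation of $\Phi_n$, where $\mathcal{H}_{n+1}=\mathfrak{A}\overline{\otimes}_{\Phi_n}\mathcal{H}_n$. Let $$\mathcal{H}_\infty=\bigoplus_{j=0}^\infty \mathcal{H}_j,$$ and let $\mathbf{V}_\infty:\mathcal{H}_\infty\to\mathcal{H}_\infty$ be $$\mathbf{V}_\infty(\Psi_0,\Psi_1,\Psi_2,\dots)=(0,\mathbf{V}_0\Psi_0,\mathbf{V}_1\Psi_1,\dots),\qquad (\Psi_0,\Psi_1,\Psi_2,\dots)\in\mathcal{H}_\infty .$$ Then $\mathbf{V}_\infty$ is an isometry and there exists a faithful representation $\pi_\infty:\mathfrak{A}\to\mathcal{B}(\mathcal{H}_\infty)$ such that $$\mathbf{V}_\infty^*\,\pi_\infty(a)\,\mathbf{V}_\infty=\pi_\infty(\Phi(a))\qquad\text{for all } a\in\mathfrak{A}.$$ Furthermore, $\Phi$ is a homomorphism if and only if $\mathbf{V}_\infty\mathbf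{V}_\infty^*\in\pi_\infty(\mathfrak{A})'$.
   Context: Stinespring dilation: for a unital completely positive map $\Psi:\mathfrak{A}\to\mathcal{B}(\mathcal{K})$, the space $\mathfrak{A}\overline{\otimes}_{\Psi}\mathcal{K}$ denotes the Hilbert space obtained from the algebraic tensor product $\mathfrak{A}\otimes\mathcal{K}$ with semi-inner product $\langle a_1\otimes\xi_1,a_2\otimes\xi_2\rangle_\Psi=\langle\xi_1,\Psi(a_1^*a_2)\xi_2\rangle$ by quotienting by the null vectors and completing; $a\overline{\otimes}_\Psi\xi$ is the image of $a\otimes\xi$. The Stinespring dilation of $\Psi$ is the triple $(\mathbf{V}_\Psi,\sigma_\Psi,\mathfrak{A}\overline{\otimes}_\Psi\mathcal{K})$ with $\sigma_\Psi(a)(x\overline{\otimes}_\Psi\xi)=ax\overline{\otimes}_\Psi\xi$ and $\mathbf{V}_\Psi\xi=\mathbf{1}\overline{\otimes}_\Psi\xi$; it satisfies $\Psi(a)=\mathbf{V}_\Psi^*\sigma_\Psi(a)\mathbf{V}_\Psi$, and $\mathbf{V}_\Psi$ is an isometry. $\pi_\infty(\mathfrak{A})'$ denotes the commutant in $\mathcal{B}(\mathcal{H}_\infty)$. "Homomorphism" means *-homomorphism. *)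

theory Defs
  imports Complex_Main "HOL-Library.Nonpos_Ints" "HOL-Algebra.Module"
begin

section \<open>Hilbert spaces\<close>

text \<open>
  The spaces of the dilation sequence are built by recursion on a natural number, so Hilbert spaces
  are carrier-based, as modules over the field of complex numbers. The fields \<open>mult\<close> and
  \<open>one\<close>, which module records inherit from ring records, are never used. Inner products are
  linear in the second argument.
\<close>

definition complex_field :: "complex ring" where
  "complex_field = \<lparr>carrier = UNIV, mult = (*), one = 1, zero = 0, add = (+)\<rparr>"

record 'v ip_space = "(complex, 'v) module" +
  ip :: "'v \<Rightarrow> 'v \<Rightarrow> complex"

definition vnorm :: "'v ip_space \<Rightarrow> 'v \<Rightarrow> real" where
  "vnorm H x = sqrt (Re (ip H x x))"

locale hilbert_space = module complex_field H for H :: "'v ip_space" (structure) +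
  assumes ip_add_right:
      "\<lbrakk>x \<in> carrier H; y \<in> carrier H; z \<in> carrier H\<rbrakk>
        \<Longrightarrow> ip H x (y \<oplus>\<^bsub>H\<^esub> z) = ip H x y + ip H x z"
    and ip_smult_right:
      "\<lbrakk>x \<in> carrier H; y \<in> carrier H\<rbrakk> \<Longrightarrow> ip H x (c \<odot>\<^bsub>H\<^esub> y) = c * ip H x y"
    and ip_cnj: "\<lbrakk>x \<in> carrier H; y \<in> carrier H\<rbrakk> \<Longrightarrow> ip H y x = cnj (ip H x y)"
    and ip_nonneg: "x \<in> carrier H \<Longrightarrow> ip H x x \<in> \<real>\<^sub>\<ge>\<^sub>0"
    and ip_definite: "\<lbrakk>x \<in> carrier H; ip H x x = 0\<rbrakk> \<Longrightarrow> x = \<zero>\<^bsub>H\<^esub>"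
    and complete:
      "\<lbrakk>\<And>n. X n \<in> carrier H;
        \<And>e. e > 0 \<Longrightarrow> \<exists>N::nat. \<forall>m\<ge>N. \<forall>n\<ge>N. vnorm H (X m \<ominus>\<^bsub>H\<^esub> X n) < e\<rbrakk>
        \<Longrightarrow> \<exists>x\<in>carrier H. (\<lambda>n. vnorm H (X n \<ominus>\<^bsub>H\<^esub> x)) \<longlonglongrightarrow> 0"

text \<open>The Hilbert space direct sum of a sequence of spaces.\<close>

definition direct_sum :: "(nat \<Rightarrow> 'v ip_space) \<Rightarrow> (nat \<Rightarrow> 'v) ip_space" where
  "direct_sum Hs = \<lparr>
     carrier = {x. (\<forall>n. x n \<in> carrier (Hs n)) \<and> summable (\<lambda>n. (vnorm (Hs n) (x n))\<^sup>2)},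
     mult = undefined, one = undefined,
     zero = (\<lambda>n. \<zero>\<^bsub>Hs n\<^esub>),
     add = (\<lambda>x y n. x n \<oplus>\<^bsub>Hs n\<^esub> y n),
     smult = (\<lambda>c x n. c \<odot>\<^bsub>Hs n\<^esub> x n),
     ip = (\<lambda>x y. \<Sum>n. ip (Hs n) (x n) (y n))\<rparr>"


section \<open>Bounded operators\<close>

text \<open>
  Operators are extensional functions (equal to \<open>undefined\<close> off the carrier), so that equality
  of functions is equality of operators.
\<close>

definition bounded_ops :: "'v ip_space \<Rightarrow> 'w ip_space \<Rightarrow> ('v \<Rightarrow> 'w) set" where
  "bounded_ops H K = {T \<in> carrier H \<rightarrow>\<^sub>E carrier K.
     (\<forall>x\<in>carrier H. \<forall>y\<in>carrier H. T (x \<oplus>\<^bsub>H\<^esub> y) = T x \<oplus>\<^bsub>K\<^esub> T y) \<and>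
     (\<forall>c. \<forall>x\<in>carrier H. T (c \<odot>\<^bsub>H\<^esub> x) = c \<odot>\<^bsub>K\<^esub> T x) \<and>
     (\<exists>C. \<forall>x\<in>carrier H. vnorm K (T x) \<le> C * vnorm H x)}"

definition op_add :: "'v ip_space \<Rightarrow> ('v \<Rightarrow> 'v) \<Rightarrow> ('v \<Rightarrow> 'v) \<Rightarrow> 'v \<Rightarrow> 'v" where
  "op_add H S T = (\<lambda>x\<in>carrier H. S x \<oplus>\<^bsub>H\<^esub> T x)"

definition op_smult :: "'v ip_space \<Rightarrow> complex \<Rightarrow> ('v \<Rightarrow> 'v) \<Rightarrow> 'v \<Rightarrow> 'v" where
  "op_smult H c T = (\<lambda>x\<in>carrier H. c \<odot>\<^bsub>H\<^esub> T x)"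

abbreviation op_mult :: "'v ip_space \<Rightarrow> ('v \<Rightarrow> 'v) \<Rightarrow> ('v \<Rightarrow> 'v) \<Rightarrow> 'v \<Rightarrow> 'v" where
  "op_mult H S T \<equiv> compose (carrier H) S T"

definition op_one :: "'v ip_space \<Rightarrow> 'v \<Rightarrow> 'v" where
  "op_one H = (\<lambda>x\<in>carrier H. x)"

definition adj :: "'v ip_space \<Rightarrow> ('v \<Rightarrow> 'v) \<Rightarrow> 'v \<Rightarrow> 'v" where
  "adj H T = (THE S. S \<in> bounded_ops H H \<and>
     (\<forall>x\<in>carrier H. \<forall>y\<in>carrier H. ip H (S x) y = ip H x (T y)))"

definition op_norm :: "'v ip_space \<Rightarrow> ('v \<Rightarrow> 'v) \<Rightarrow> real" where
  "op_norm H T = (SUP x\<in>{x \<in> carrier H. vnorm H x \<le> 1}. vnorm H (T x))"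

definition isometry :: "'v ip_space \<Rightarrow> 'w ip_space \<Rightarrow> ('v \<Rightarrow> 'w) \<Rightarrow> bool" where
  "isometry H K V \<longleftrightarrow> V \<in> bounded_ops H K \<and> (\<forall>x\<in>carrier H. vnorm K (V x) = vnorm H x)"

definition commutant :: "'v ip_space \<Rightarrow> ('v \<Rightarrow> 'v) set \<Rightarrow> ('v \<Rightarrow> 'v) set" where
  "commutant H M = {T \<in> bounded_ops H H. \<forall>S\<in>M. op_mult H T S = op_mult H S T}"


section \<open>Concrete C*-algebras and maps between them\<close>

text \<open>Norm-closed *-subalgebras of the bounded operators, containing the identity operator.\<close>

definition concrete_cstar_algebra :: "'h ip_space \<Rightarrow> ('h \<Rightarrow> 'h) set \<Rightarrow> bool" where
  "concrete_cstar_algebra H A \<longleftrightarrow>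
     A \<subseteq> bounded_ops H H \<and> op_one H \<in> A \<and>
     (\<forall>a\<in>A. \<forall>b\<in>A. op_add H a b \<in> A \<and> op_mult H a b \<in> A) \<and>
     (\<forall>c. \<forall>a\<in>A. op_smult H c a \<in> A) \<and>
     (\<forall>a\<in>A. adj H a \<in> A) \<and>
     (\<forall>X T. (\<forall>n::nat. X n \<in> A) \<and> T \<in> bounded_ops H H \<and>
        (\<lambda>n. op_norm H (op_add H (X n) (op_smult H (- 1) T))) \<longlonglongrightarrow> 0 \<longrightarrow> T \<in> A)"

definition linear_to_ops ::
    "'h ip_space \<Rightarrow> ('h \<Rightarrow> 'h) set \<Rightarrow> 'k ip_space \<Rightarrow> (('h \<Rightarrow> 'h) \<Rightarrow> 'k \<Rightarrow> 'k) \<Rightarrow> bool" where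
  "linear_to_ops H A K \<Psi> \<longleftrightarrow>
     \<Psi> \<in> A \<rightarrow> bounded_ops K K \<and>
     (\<forall>a\<in>A. \<forall>b\<in>A. \<Psi> (op_add H a b) = op_add K (\<Psi> a) (\<Psi> b)) \<and>
     (\<forall>c. \<forall>a\<in>A. \<Psi> (op_smult H c a) = op_smult K c (\<Psi> a))"

text \<open>
  The \<open>n\<close> by \<open>n\<close> operator matrix with entries \<open>T i j\<close>, for \<open>i, j < n\<close>, is a positive operator
  on the direct sum of \<open>n\<close> copies of the space.
\<close>

definition mat_positive :: "'v ip_space \<Rightarrow> nat \<Rightarrow> (nat \<Rightarrow> nat \<Rightarrow> 'v \<Rightarrow> 'v) \<Rightarrow> bool" where
  "mat_positive H n T \<longleftrightarrow>
     (\<forall>\<xi>. (\<forall>i<n. \<xi> i \<in> carrier H) \<longrightarrow> (\<Sum>i<n. \<Sum>j<n. ip H (\<xi> i) (T i j (\<xi> j))) \<in> \<real>\<^sub>\<ge>\<^sub>0)"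

definition completely_positive ::
    "'h ip_space \<Rightarrow> ('h \<Rightarrow> 'h) set \<Rightarrow> 'k ip_space \<Rightarrow> (('h \<Rightarrow> 'h) \<Rightarrow> 'k \<Rightarrow> 'k) \<Rightarrow> bool" where
  "completely_positive H A K \<Psi> \<longleftrightarrow>
     linear_to_ops H A K \<Psi> \<and>
     (\<forall>n T. (\<forall>i<n. \<forall>j<n. T i j \<in> A) \<and> mat_positive H n T \<longrightarrow>
        mat_positive K n (\<lambda>i j. \<Psi> (T i j)))"

definition star_hom ::
    "'h ip_space \<Rightarrow> ('h \<Rightarrow> 'h) set \<Rightarrow> 'k ip_space \<Rightarrow> (('h \<Rightarrow> 'h) \<Rightarrow> 'k \<Rightarrow> 'k) \<Rightarrow> bool" where
  "star_hom H A K \<pi> \<longleftrightarrow>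
     linear_to_ops H A K \<pi> \<and>
     (\<forall>a\<in>A. \<forall>b\<in>A. \<pi> (op_mult H a b) = op_mult K (\<pi> a) (\<pi> b)) \<and>
     (\<forall>a\<in>A. \<pi> (adj H a) = adj K (\<pi> a))"

text \<open>Representations of unital C*-algebras are unital.\<close>

definition faithful_representation ::
    "'h ip_space \<Rightarrow> ('h \<Rightarrow> 'h) set \<Rightarrow> 'k ip_space \<Rightarrow> (('h \<Rightarrow> 'h) \<Rightarrow> 'k \<Rightarrow> 'k) \<Rightarrow> bool" where
  "faithful_representation H A K \<pi> \<longleftrightarrow>
     star_hom H A K \<pi> \<and> \<pi> (op_one H) = op_one K \<and> inj_on \<pi> A"


section \<open>The Stinespring dilation\<close>

text \<open>
  A list \<open>[(a\<^sub>1, \<xi>\<^sub>1), \<dots>, (a\<^sub>k, \<xi>\<^sub>k)]\<close> stands for \<open>a\<^sub>1 \<otimes> \<xi>\<^sub>1 + \<dots> + a\<^sub>k \<otimes> \<xi>\<^sub>k\<close>. Lists that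
  represent the same element of the algebraic tensor product differ by a null vector of the
  semi-inner product, so the bilinear relations need not be divided out separately.
\<close>

type_synonym ('h, 'k) tensor = "(('h \<Rightarrow> 'h) \<times> 'k) list"

definition tensor_smult :: "'k ip_space \<Rightarrow> complex \<Rightarrow> ('h, 'k) tensor \<Rightarrow> ('h, 'k) tensor" where
  "tensor_smult K c u = map (\<lambda>(a, \<xi>). (a, c \<odot>\<^bsub>K\<^esub> \<xi>)) u"

definition tensor_ip :: "'h ip_space \<Rightarrow> 'k ip_space \<Rightarrow> (('h \<Rightarrow> 'h) \<Rightarrow> 'k \<Rightarrow> 'k) \<Rightarrow>
    ('h, 'k) tensor \<Rightarrow> ('h, 'k) tensor \<Rightarrow> complex" where
  "tensor_ip H K \<Psi> u v =
     (\<Sum>(a, \<xi>)\<leftarrow>u. \<Sum>(b, \<eta>)\<leftarrow>v. ip K \<xi> (\<Psi> (op_mult H (adj H a) b) \<eta>))"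

definition tensor_dist :: "'h ip_space \<Rightarrow> 'k ip_space \<Rightarrow> (('h \<Rightarrow> 'h) \<Rightarrow> 'k \<Rightarrow> 'k) \<Rightarrow>
    ('h, 'k) tensor \<Rightarrow> ('h, 'k) tensor \<Rightarrow> real" where
  "tensor_dist H K \<Psi> u v =
     (let w = u @ tensor_smult K (- 1) v in sqrt (Re (tensor_ip H K \<Psi> w w)))"

definition tensor_cauchy :: "'h ip_space \<Rightarrow> ('h \<Rightarrow> 'h) set \<Rightarrow> 'k ip_space \<Rightarrow>
    (('h \<Rightarrow> 'h) \<Rightarrow> 'k \<Rightarrow> 'k) \<Rightarrow> (nat \<Rightarrow> ('h, 'k) tensor) set" where
  "tensor_cauchy H A K \<Psi> = {s. (\<forall>n. s n \<in> lists (A \<times> carrier K)) \<and>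
     (\<forall>e>0. \<exists>N. \<forall>m\<ge>N. \<forall>n\<ge>N. tensor_dist H K \<Psi> (s m) (s n) < e)}"

definition tensor_rel :: "'h ip_space \<Rightarrow> ('h \<Rightarrow> 'h) set \<Rightarrow> 'k ip_space \<Rightarrow>
    (('h \<Rightarrow> 'h) \<Rightarrow> 'k \<Rightarrow> 'k) \<Rightarrow> ((nat \<Rightarrow> ('h, 'k) tensor) \<times> (nat \<Rightarrow> ('h, 'k) tensor)) set" where
  "tensor_rel H A K \<Psi> = {(s, t). s \<in> tensor_cauchy H A K \<Psi> \<and> t \<in> tensor_cauchy H A K \<Psi> \<and>
     (\<lambda>n. tensor_dist H K \<Psi> (s n) (t n)) \<longlonglongrightarrow> 0}"

text \<open>
  Quotient by the null vectors and completion in one step: Cauchy sequences for the seminorm,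
  modulo sequences at distance tending to zero.
\<close>

definition stinespring_space :: "'h ip_space \<Rightarrow> ('h \<Rightarrow> 'h) set \<Rightarrow> 'k ip_space \<Rightarrow>
    (('h \<Rightarrow> 'h) \<Rightarrow> 'k \<Rightarrow> 'k) \<Rightarrow> (nat \<Rightarrow> ('h, 'k) tensor) set ip_space" where
  "stinespring_space H A K \<Psi> = \<lparr>
     carrier = tensor_cauchy H A K \<Psi> // tensor_rel H A K \<Psi>,
     mult = undefined, one = undefined,
     zero = tensor_rel H A K \<Psi> `` {\<lambda>n. []},
     add = (\<lambda>X Y. \<Union>s\<in>X. \<Union>t\<in>Y. tensor_rel H A K \<Psi> `` {\<lambda>n. s n @ t n}),
     smult = (\<lambda>c X. \<Union>s\<in>X. tensor_rel H A K \<Psi> `` {\<lambda>n. tensor_smult K c (s n)}),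
     ip = (\<lambda>X Y. THE z. \<exists>s\<in>X. \<exists>t\<in>Y. (\<lambda>n. tensor_ip H K \<Psi> (s n) (t n)) \<longlonglongrightarrow> z)\<rparr>"

definition stinespring_tensor :: "'h ip_space \<Rightarrow> ('h \<Rightarrow> 'h) set \<Rightarrow> 'k ip_space \<Rightarrow>
    (('h \<Rightarrow> 'h) \<Rightarrow> 'k \<Rightarrow> 'k) \<Rightarrow> ('h \<Rightarrow> 'h) \<Rightarrow> 'k \<Rightarrow> (nat \<Rightarrow> ('h, 'k) tensor) set" where
  "stinespring_tensor H A K \<Psi> a \<xi> = tensor_rel H A K \<Psi> `` {\<lambda>n. [(a, \<xi>)]}"

definition stinespring_rep :: "'h ip_space \<Rightarrow> ('h \<Rightarrow> 'h) set \<Rightarrow> 'k ip_space \<Rightarrow>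
    (('h \<Rightarrow> 'h) \<Rightarrow> 'k \<Rightarrow> 'k) \<Rightarrow> ('h \<Rightarrow> 'h) \<Rightarrow>
    (nat \<Rightarrow> ('h, 'k) tensor) set \<Rightarrow> (nat \<Rightarrow> ('h, 'k) tensor) set" where
  "stinespring_rep H A K \<Psi> a = (THE T.
     T \<in> bounded_ops (stinespring_space H A K \<Psi>) (stinespring_space H A K \<Psi>) \<and>
     (\<forall>x\<in>A. \<forall>\<xi>\<in>carrier K. T (stinespring_tensor H A K \<Psi> x \<xi>) =
        stinespring_tensor H A K \<Psi> (op_mult H a x) \<xi>))"

definition stinespring_isometry :: "'h ip_space \<Rightarrow> ('h \<Rightarrow> 'h) set \<Rightarrow> 'k ip_space \<Rightarrow>
    (('h \<Rightarrow> 'h) \<Rightarrow> 'k \<Rightarrow> 'k) \<Rightarrow> 'k \<Rightarrow> (nat \<Rightarrow> ('h, 'k) tensor) set" where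
  "stinespring_isometry H A K \<Psi> = (\<lambda>\<xi>\<in>carrier K. stinespring_tensor H A K \<Psi> (op_one H) \<xi>)"


section \<open>The iterated dilation\<close>

text \<open>
  Each Stinespring dilation changes the type of the vectors. To iterate it, all spaces are moved
  into one recursive type along injections: \<open>Base\<close> on the initial space, and on a dilation the map
  sending a class of Cauchy sequences to one of its members.
\<close>

datatype 'h dilation_vec = Base 'h | Cauchy_rep "nat \<Rightarrow> (('h \<Rightarrow> 'h) \<times> 'h dilation_vec) list"

definition class_code :: "(nat \<Rightarrow> ('h, 'h dilation_vec) tensor) set \<Rightarrow> 'h dilation_vec" where
  "class_code X = Cauchy_rep (SOME s. s \<in> X)"

definition transport_space :: "('v \<Rightarrow> 'w) \<Rightarrow> 'v ip_space \<Rightarrow> 'w ip_space" where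
  "transport_space f H = (let g = inv_into (carrier H) f in \<lparr>
     carrier = f ` carrier H,
     mult = undefined, one = undefined,
     zero = f \<zero>\<^bsub>H\<^esub>,
     add = (\<lambda>x y. f (g x \<oplus>\<^bsub>H\<^esub> g y)),
     smult = (\<lambda>c x. f (c \<odot>\<^bsub>H\<^esub> g x)),
     ip = (\<lambda>x y. ip H (g x) (g y))\<rparr>)"

definition transport_op :: "('v \<Rightarrow> 'w) \<Rightarrow> 'v ip_space \<Rightarrow> ('v \<Rightarrow> 'v) \<Rightarrow> 'w \<Rightarrow> 'w" where
  "transport_op f H T = (\<lambda>x\<in>f ` carrier H. f (T (inv_into (carrier H) f x)))"

text \<open>The pairs of the space and the representation at stage \<open>n\<close>.\<close>

primrec dilation :: "'h ip_space \<Rightarrow> ('h \<Rightarrow> 'h) set \<Rightarrow> (('h \<Rightarrow> 'h) \<Rightarrow> 'h \<Rightarrow> 'h) \<Rightarrow> nat \<Rightarrow>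
    'h dilation_vec ip_space \<times> (('h \<Rightarrow> 'h) \<Rightarrow> 'h dilation_vec \<Rightarrow> 'h dilation_vec)" where
  "dilation H A \<Phi> 0 = (transport_space Base H, transport_op Base H)"
| "dilation H A \<Phi> (Suc n) =
     (let (K, \<sigma>) = dilation H A \<Phi> n; \<Psi> = \<sigma> \<circ> \<Phi>; S = stinespring_space H A K \<Psi> in
      (transport_space class_code S,
       \<lambda>a. transport_op class_code S (stinespring_rep H A K \<Psi> a)))"

definition dil_space :: "'h ip_space \<Rightarrow> ('h \<Rightarrow> 'h) set \<Rightarrow> (('h \<Rightarrow> 'h) \<Rightarrow> 'h \<Rightarrow> 'h) \<Rightarrow> nat \<Rightarrow>
    'h dilation_vec ip_space" where
  "dil_space H A \<Phi> n = fst (dilation H A \<Phi> n)"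

definition dil_rep :: "'h ip_space \<Rightarrow> ('h \<Rightarrow> 'h) set \<Rightarrow> (('h \<Rightarrow> 'h) \<Rightarrow> 'h \<Rightarrow> 'h) \<Rightarrow> nat \<Rightarrow>
    ('h \<Rightarrow> 'h) \<Rightarrow> 'h dilation_vec \<Rightarrow> 'h dilation_vec" where
  "dil_rep H A \<Phi> n = snd (dilation H A \<Phi> n)"

definition dil_isometry :: "'h ip_space \<Rightarrow> ('h \<Rightarrow> 'h) set \<Rightarrow> (('h \<Rightarrow> 'h) \<Rightarrow> 'h \<Rightarrow> 'h) \<Rightarrow> nat \<Rightarrow>
    'h dilation_vec \<Rightarrow> 'h dilation_vec" where
  "dil_isometry H A \<Phi> n = (\<lambda>\<xi>\<in>carrier (dil_space H A \<Phi> n).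
     class_code (stinespring_isometry H A (dil_space H A \<Phi> n) (dil_rep H A \<Phi> n \<circ> \<Phi>) \<xi>))"

definition dil_space_inf :: "'h ip_space \<Rightarrow> ('h \<Rightarrow> 'h) set \<Rightarrow> (('h \<Rightarrow> 'h) \<Rightarrow> 'h \<Rightarrow> 'h) \<Rightarrow>
    (nat \<Rightarrow> 'h dilation_vec) ip_space" where
  "dil_space_inf H A \<Phi> = direct_sum (dil_space H A \<Phi>)"

definition dil_isometry_inf :: "'h ip_space \<Rightarrow> ('h \<Rightarrow> 'h) set \<Rightarrow> (('h \<Rightarrow> 'h) \<Rightarrow> 'h \<Rightarrow> 'h) \<Rightarrow>
    (nat \<Rightarrow> 'h dilation_vec) \<Rightarrow> nat \<Rightarrow> 'h dilation_vec" where
  "dil_isometry_inf H A \<Phi> = (\<lambda>x\<in>carrier (dil_space_inf H A \<Phi>).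
     \<lambda>n. case n of 0 \<Rightarrow> \<zero>\<^bsub>dil_space H A \<Phi> 0\<^esub> | Suc m \<Rightarrow> dil_isometry H A \<Phi> m (x m))"

end

theory Submission
  imports Defs
begin

text \<open>
  The argument is an intertwining argument. Write \<open>\<sigma>\<^sub>n\<close> for the representation on the space \<open>H\<^sub>n\<close> of
  stage \<open>n\<close> and \<open>V\<^sub>n\<close> for the isometry from \<open>H\<^sub>n\<close> to \<open>H\<^sub>n\<^sub>+\<^sub>1\<close>. The dilation at stage \<open>n\<close> says that
  \<open>\<langle>V\<^sub>n \<xi>, \<sigma>\<^sub>n\<^sub>+\<^sub>1 a (V\<^sub>n \<eta>)\<rangle> = \<langle>\<xi>, \<sigma>\<^sub>n (\<Phi> a) \<eta>\<rangle>\<close>. With \<open>\<pi>\<close> the direct sum of all the \<open>\<sigma>\<^sub>n\<close> and \<open>V\<close> the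
  shift by the \<open>V\<^sub>n\<close>, adding these identities gives \<open>V\<^sup>* \<pi>(a) V = \<pi>(\<Phi> a)\<close>
  (\<open>dilation_inf\<close>), since the coordinate \<open>0\<close> of every vector in the range of \<open>V\<close> vanishes. The
  representation \<open>\<pi>\<close> is faithful because its summand \<open>\<sigma>\<^sub>0\<close> is the identity representation.

  If \<open>\<Phi>\<close> is multiplicative, then
  \<open>\<parallel>\<pi>(a) V x\<parallel>\<^sup>2 = \<langle>x, \<pi>(\<Phi>(a\<^sup>* a)) x\<rangle> = \<parallel>\<pi>(\<Phi> a) x\<parallel>\<^sup>2\<close>, which is also the inner product of
  \<open>\<pi>(a) V x\<close> and \<open>V \<pi>(\<Phi> a) x\<close>. Hence \<open>\<pi>(a) V = V \<pi>(\<Phi> a)\<close>, and together with the adjoint of this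
  identity for \<open>a\<^sup>*\<close> it follows that \<open>V V\<^sup>*\<close> commutes with \<open>\<pi>(a)\<close>. Conversely, if \<open>V V\<^sup>*\<close> commutes with
  \<open>\<pi>(a)\<close> and \<open>\<pi>(b)\<close>, then
  \<open>\<pi>(\<Phi>(a b)) = V\<^sup>* \<pi>(a) V V\<^sup>* \<pi>(b) V = \<pi>(\<Phi> a) \<pi>(\<Phi> b)\<close>. Adjoints are preserved by every completely
  positive map. This is \<open>dilation_multiplicative_iff\<close>.

  The work is in showing that the stages exist. A stage carries the invariant \<open>stage\<close>: its
  representation is a unital *-homomorphism, it is completely positive, and it does not increase
  bounds of operators. Complete positivity is what makes the next semi-inner product positive, and
  the bounds, uniform in \<open>n\<close>, let \<open>\<pi>(a)\<close> act on the direct sum. All the positivity that is needed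
  comes from one lemma, \<open>conjugated_positive\<close>: the matrix of the \<open>b\<^sub>k\<^sup>* T\<^sub>i\<^sub>j b\<^sub>l\<close>, with \<open>i\<close> depending on
  \<open>k\<close> and \<open>j\<close> on \<open>l\<close>, is positive when \<open>T\<close> is, and therefore so is its image under the completely
  positive map. With it the square roots of the usual proofs are avoided.

  The analytic part is the completion of a space with a semi-inner product
  (\<open>hilbert_space_completion\<close>), completeness of direct sums (\<open>hilbert_space_direct_sum\<close>), and the
  existence of adjoints (\<open>adjoint_exists\<close>), which rests on the Riesz representation theorem.
\<close>

section \<open>Semi-inner products\<close>

text \<open>
  The laws of a module are left out because formal sums of elementary tensors satisfy them only up to
  null vectors. The form cannot see the difference, so Hilbert spaces and formal sums share the
  Cauchy-Schwarz and triangle inequalities proved here.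
\<close>

locale semi_inner_product =
  fixes L :: "'v set"
    and zr :: 'v
    and add :: "'v \<Rightarrow> 'v \<Rightarrow> 'v" (infixl "\<boxplus>" 65)
    and scale :: "complex \<Rightarrow> 'v \<Rightarrow> 'v" (infixr "\<bullet>" 75)
    and B :: "'v \<Rightarrow> 'v \<Rightarrow> complex"
  assumes zr_closed [simp]: "zr \<in> L"
    and add_closed [simp]: "u \<in> L \<Longrightarrow> v \<in> L \<Longrightarrow> u \<boxplus> v \<in> L"
    and scale_closed [simp]: "u \<in> L \<Longrightarrow> c \<bullet> u \<in> L"
    and form_zr_right [simp]: "u \<in> L \<Longrightarrow> B u zr = 0"
    and form_add_right [simp]: "u \<in> L \<Longrightarrow> v \<in> L \<Longrightarrow> w \<in> L \<Longrightarrow> B u (v \<boxplus> w) = B u v + B u w"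
    and form_scale_right [simp]: "u \<in> L \<Longrightarrow> v \<in> L \<Longrightarrow> B u (c \<bullet> v) = c * B u v"
    and form_cnj: "u \<in> L \<Longrightarrow> v \<in> L \<Longrightarrow> B v u = cnj (B u v)"
    and form_nonneg: "u \<in> L \<Longrightarrow> B u u \<in> \<real>\<^sub>\<ge>\<^sub>0"
begin

definition nrm :: "'v \<Rightarrow> real" where
  "nrm u = sqrt (Re (B u u))"

definition dst :: "'v \<Rightarrow> 'v \<Rightarrow> real" where
  "dst u v = nrm (u \<boxplus> (- 1) \<bullet> v)"

lemma form_zr_left [simp]: "u \<in> L \<Longrightarrow> B zr u = 0"
  by (subst form_cnj) auto

lemma form_add_left [simp]: "u \<in> L \<Longrightarrow> v \<in> L \<Longrightarrow> w \<in> L \<Longrightarrow> B (v \<boxplus> w) u = B v u + B w u"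
  using form_cnj[of u "v \<boxplus> w"] form_cnj[of u v] form_cnj[of u w] by simp

lemma form_scale_left [simp]: "u \<in> L \<Longrightarrow> v \<in> L \<Longrightarrow> B (c \<bullet> v) u = cnj c * B v u"
  using form_cnj[of u "c \<bullet> v"] form_cnj[of u v] by simp

lemma form_self_Im [simp]: "u \<in> L \<Longrightarrow> Im (B u u) = 0"
  using form_nonneg[of u] by (simp add: complex_nonneg_Reals_iff)

lemma form_self_Re [simp]: "u \<in> L \<Longrightarrow> 0 \<le> Re (B u u)"
  using form_nonneg[of u] by (simp add: complex_nonneg_Reals_iff)

lemma Re_form_commute: "u \<in> L \<Longrightarrow> v \<in> L \<Longrightarrow> Re (B u v) = Re (B v u)"
  by (subst form_cnj) auto

lemma nrm_nonneg [simp]: "u \<in> L \<Longrightarrow> 0 \<le> nrm u"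
  by (simp add: nrm_def)

lemma nrm_sq: "u \<in> L \<Longrightarrow> (nrm u)\<^sup>2 = Re (B u u)"
  by (simp add: nrm_def)

lemma form_self: "u \<in> L \<Longrightarrow> B u u = complex_of_real ((nrm u)\<^sup>2)"
  by (simp add: nrm_sq complex_eq_iff)

lemma nrm_scale: "u \<in> L \<Longrightarrow> nrm (c \<bullet> u) = cmod c * nrm u"
proof -
  assume u: "u \<in> L"
  have "B (c \<bullet> u) (c \<bullet> u) = complex_of_real ((cmod c)\<^sup>2) * B u u"
    unfolding complex_norm_square using u by (simp add: algebra_simps)
  then have "Re (B (c \<bullet> u) (c \<bullet> u)) = (cmod c)\<^sup>2 * Re (B u u)"
    by simp
  then show ?thesis
    by (simp add: nrm_def real_sqrt_mult)
qed

text \<open>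
  In the degenerate case \<open>nrm v = 0\<close> the vector \<open>u - t \<langle>v, u\<rangle> v\<close> has nonnegative square norm for
  every real \<open>t\<close>, which is affine in \<open>t\<close>; otherwise \<open>t = 1 / (nrm v)\<^sup>2\<close> gives the inequality.
\<close>

lemma Cauchy_Schwarz:
  assumes u: "u \<in> L" and v: "v \<in> L"
  shows "cmod (B u v) \<le> nrm u * nrm v"
proof -
  have main: "0 \<le> (nrm u)\<^sup>2 - 2 * t * (cmod (B u v))\<^sup>2 + t\<^sup>2 * (cmod (B u v))\<^sup>2 * (nrm v)\<^sup>2"
    for t :: real
  proof -
    define c where "c = - of_real t * B v u"
    have vu: "B v u = cnj (B u v)" using form_cnj u v by blast
    have "0 \<le> Re (B (u \<boxplus> c \<bullet> v) (u \<boxplus> c \<bullet> v))"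
      using u v by (intro form_self_Re) auto
    also have "B (u \<boxplus> c \<bullet> v) (u \<boxplus> c \<bullet> v)
        = B u u + c * B u v + cnj c * B v u + cnj c * c * B v v"
      using u v by (simp add: algebra_simps)
    also have "c * B u v = of_real (- t * (cmod (B u v))\<^sup>2)"
      unfolding of_real_mult complex_norm_square c_def vu by simp
    also have "cnj c * B v u = of_real (- t * (cmod (B u v))\<^sup>2)"
      unfolding of_real_mult complex_norm_square c_def vu by simp
    also have "cnj c * c = of_real (t\<^sup>2 * (cmod (B u v))\<^sup>2)"
      unfolding of_real_mult complex_norm_square c_def vu by (simp add: power2_eq_square)
    also have "B u u + of_real (- t * (cmod (B u v))\<^sup>2) + of_real (- t * (cmod (B u v))\<^sup>2)
          + of_real (t\<^sup>2 * (cmod (B u v))\<^sup>2) * B v v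
        = of_real ((nrm u)\<^sup>2 - 2 * t * (cmod (B u v))\<^sup>2
          + t\<^sup>2 * (cmod (B u v))\<^sup>2 * (nrm v)\<^sup>2)"
      unfolding form_self[OF u] form_self[OF v] by simp
    finally show ?thesis by simp
  qed
  have "(cmod (B u v))\<^sup>2 \<le> (nrm u)\<^sup>2 * (nrm v)\<^sup>2"
  proof (cases "nrm v = 0")
    case True
    have "cmod (B u v) = 0"
    proof (rule ccontr)
      assume "cmod (B u v) \<noteq> 0"
      then have pos: "0 < (cmod (B u v))\<^sup>2" by simp
      have "0 \<le> (nrm u)\<^sup>2 - 2 * (((nrm u)\<^sup>2 + 1) / (cmod (B u v))\<^sup>2) * (cmod (B u v))\<^sup>2"
        using main[of "((nrm u)\<^sup>2 + 1) / (cmod (B u v))\<^sup>2"] True by simp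
      also have "\<dots> = - (nrm u)\<^sup>2 - 2" using pos by (simp add: field_simps)
      also have "\<dots> < 0" by (smt (verit) zero_le_power2)
      finally show False by simp
    qed
    then show ?thesis by simp
  next
    case False
    then have pos: "0 < (nrm v)\<^sup>2" using v by simp
    have "(1 / N)\<^sup>2 * a * N = a / N" if "N > 0" for a N :: real
      using that by (simp add: power2_eq_square)
    from this[OF pos, of "(cmod (B u v))\<^sup>2"] have "(cmod (B u v))\<^sup>2 / (nrm v)\<^sup>2 \<le> (nrm u)\<^sup>2"
      using main[of "1 / (nrm v)\<^sup>2"] by simp
    then show ?thesis using pos by (simp add: pos_divide_le_eq)
  qed
  then have "(cmod (B u v))\<^sup>2 \<le> (nrm u * nrm v)\<^sup>2" by (simp add: power_mult_distrib)
  then show ?thesis using u v by (meson mult_nonneg_nonneg nrm_nonneg power2_le_imp_le)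
qed

lemma nrm_triangle:
  assumes u: "u \<in> L" and v: "v \<in> L"
  shows "nrm (u \<boxplus> v) \<le> nrm u + nrm v"
proof (rule power2_le_imp_le)
  have "Re (B u v) \<le> nrm u * nrm v"
    using Cauchy_Schwarz[OF u v] complex_Re_le_cmod[of "B u v"] by linarith
  moreover have "(nrm (u \<boxplus> v))\<^sup>2 = (nrm u)\<^sup>2 + 2 * Re (B u v) + (nrm v)\<^sup>2"
    using u v by (simp add: nrm_sq Re_form_commute[of v u])
  ultimately show "(nrm (u \<boxplus> v))\<^sup>2 \<le> (nrm u + nrm v)\<^sup>2"
    by (simp add: power2_sum)
qed (use u v in simp)

lemma dst_nonneg [simp]: "u \<in> L \<Longrightarrow> v \<in> L \<Longrightarrow> 0 \<le> dst u v"
  by (simp add: dst_def)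

lemma dst_sq:
  "u \<in> L \<Longrightarrow> v \<in> L \<Longrightarrow> (dst u v)\<^sup>2 = Re (B u u) - 2 * Re (B u v) + Re (B v v)"
  by (simp add: dst_def nrm_sq Re_form_commute[of v u])

text \<open>
  Without module laws the two sides need not come from equal vectors; only their norms are compared.
\<close>

lemma dst_eq_nrmI:
  assumes "u \<in> L" "v \<in> L" "w \<in> L"
    and "Re (B w w) = Re (B u u) - 2 * Re (B u v) + Re (B v v)"
  shows "dst u v = nrm w"
proof (rule power2_eq_imp_eq)
  show "(dst u v)\<^sup>2 = (nrm w)\<^sup>2"
    unfolding dst_sq[OF assms(1,2)] nrm_sq[OF assms(3)] using assms(4) by simp
qed (use assms in auto)

lemma dst_eq_0I:
  assumes u: "u \<in> L" and v: "v \<in> L" and eq: "\<And>w. w \<in> L \<Longrightarrow> B w u = B w v"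
  shows "dst u v = 0"
proof -
  have "(dst u v)\<^sup>2 = 0"
    using dst_sq[OF u v] eq[OF u] eq[OF v] Re_form_commute[OF u v] by simp
  then show ?thesis by simp
qed

lemma dst_self [simp]: "u \<in> L \<Longrightarrow> dst u u = 0"
  by (simp add: dst_eq_0I)

lemma dst_zr: "u \<in> L \<Longrightarrow> dst u zr = nrm u"
  by (rule dst_eq_nrmI) auto

lemma dst_commute: "u \<in> L \<Longrightarrow> v \<in> L \<Longrightarrow> dst u v = dst v u"
  unfolding dst_def[of v u]
  by (rule dst_eq_nrmI) (simp_all add: Re_form_commute[of v u])

lemma dst_triangle:
  assumes "u \<in> L" "v \<in> L" "w \<in> L"
  shows "dst u w \<le> dst u v + dst v w"
proof -
  have "dst u w = nrm ((u \<boxplus> (- 1) \<bullet> v) \<boxplus> (v \<boxplus> (- 1) \<bullet> w))"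
    using assms by (intro dst_eq_nrmI) (simp_all add: Re_form_commute[of w u])
  also have "\<dots> \<le> dst u v + dst v w"
    unfolding dst_def using assms by (intro nrm_triangle) auto
  finally show ?thesis .
qed

lemma dst_add:
  assumes "u \<in> L" "v \<in> L" "u' \<in> L" "v' \<in> L"
  shows "dst (u \<boxplus> v) (u' \<boxplus> v') \<le> dst u u' + dst v v'"
proof -
  have "dst (u \<boxplus> v) (u' \<boxplus> v') = nrm ((u \<boxplus> (- 1) \<bullet> u') \<boxplus> (v \<boxplus> (- 1) \<bullet> v'))"
    using assms
    by (intro dst_eq_nrmI)
      (simp_all add: Re_form_commute[of u' u] Re_form_commute[of v' v] Re_form_commute[of v' u]
        Re_form_commute[of u' v] Re_form_commute[of v u] Re_form_commute[of v' u'])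
  also have "\<dots> \<le> dst u u' + dst v v'"
    unfolding dst_def using assms by (intro nrm_triangle) auto
  finally show ?thesis .
qed

lemma dst_scale:
  assumes "u \<in> L" "v \<in> L"
  shows "dst (c \<bullet> u) (c \<bullet> v) = cmod c * dst u v"
proof -
  have "dst (c \<bullet> u) (c \<bullet> v) = nrm (c \<bullet> (u \<boxplus> (- 1) \<bullet> v))"
    unfolding dst_def using assms by (simp add: nrm_def algebra_simps)
  then show ?thesis using assms by (simp add: nrm_scale dst_def)
qed

lemma nrm_diff_le:
  assumes "u \<in> L" "v \<in> L"
  shows "\<bar>nrm u - nrm v\<bar> \<le> dst u v"
  using dst_triangle[of u v zr] dst_triangle[of v u zr] assms dst_commute[of u v]
  by (simp add: dst_zr)

lemma form_diff_le:
  assumes "u \<in> L" "v \<in> L" "u' \<in> L" "v' \<in> L"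
  shows "cmod (B u v - B u' v') \<le> dst u u' * nrm v + nrm u' * dst v v'"
proof -
  have "B u v - B u' v' = B (u \<boxplus> (- 1) \<bullet> u') v + B u' (v \<boxplus> (- 1) \<bullet> v')"
    using assms by simp
  also have "cmod \<dots> \<le> cmod (B (u \<boxplus> (- 1) \<bullet> u') v) + cmod (B u' (v \<boxplus> (- 1) \<bullet> v'))"
    by (rule norm_triangle_ineq)
  also have "\<dots> \<le> dst u u' * nrm v + nrm u' * dst v v'"
    unfolding dst_def using assms by (intro add_mono Cauchy_Schwarz) auto
  finally show ?thesis .
qed

lemma form_tendsto:
  assumes X: "\<And>n. X n \<in> L" "x \<in> L" "(\<lambda>n. dst (X n) x) \<longlonglongrightarrow> 0"
    and Y: "\<And>n. Y n \<in> L" "y \<in> L" "(\<lambda>n. dst (Y n) y) \<longlonglongrightarrow> 0"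
  shows "(\<lambda>n. B (X n) (Y n)) \<longlonglongrightarrow> B x y"
proof -
  have "(\<lambda>n. dst (X n) x * (nrm y + dst (Y n) y) + nrm x * dst (Y n) y)
      \<longlonglongrightarrow> 0 * (nrm y + 0) + nrm x * 0"
    by (intro tendsto_intros X Y)
  then have lim: "(\<lambda>n. dst (X n) x * (nrm y + dst (Y n) y) + nrm x * dst (Y n) y) \<longlonglongrightarrow> 0"
    by simp
  have "norm (B (X n) (Y n) - B x y)
      \<le> dst (X n) x * (nrm y + dst (Y n) y) + nrm x * dst (Y n) y" for n
  proof -
    have "nrm (Y n) \<le> nrm y + dst (Y n) y" using nrm_diff_le[of "Y n" y] X Y by auto
    then have "dst (X n) x * nrm (Y n) \<le> dst (X n) x * (nrm y + dst (Y n) y)"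
      using X Y by (intro mult_left_mono) auto
    then show ?thesis using form_diff_le[of "X n" "Y n" x y] X Y by auto
  qed
  then show ?thesis
    by (intro metric_tendsto_imp_tendsto[OF lim] always_eventually allI)
      (simp add: dist_norm order_trans[OF _ abs_ge_self])
qed

end

section \<open>Hilbert spaces and adjoints\<close>

lemma complex_field_simps [simp]:
  "carrier complex_field = UNIV"
  "mult complex_field = (*)" "one complex_field = 1"
  "zero complex_field = 0" "ring.add complex_field = (+)"
  by (simp_all add: complex_field_def)

lemma cring_complex_field: "cring complex_field"
proof (rule cringI)
  show "abelian_group complex_field"
    by (rule abelian_groupI) (auto intro: exI[of _ "- x" for x])
  show "comm_monoid complex_field"
    by (rule comm_monoidI) auto
qed (simp add: distrib_right)

text \<open>
  All module laws are equations between vectors, and each of them holds after pairing with an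
  arbitrary vector. So a space whose form separates points needs no separate verification of them.
\<close>

lemma hilbert_spaceI:
  fixes H :: "'v ip_space"
  assumes "semi_inner_product (carrier H) \<zero>\<^bsub>H\<^esub> (ring.add H) (smult H) (ip H)"
    and sep: "\<And>x y. x \<in> carrier H \<Longrightarrow> y \<in> carrier H
        \<Longrightarrow> (\<And>w. w \<in> carrier H \<Longrightarrow> ip H w x = ip H w y) \<Longrightarrow> x = y"
    and compl: "\<And>X. (\<And>n. X n \<in> carrier H)
        \<Longrightarrow> (\<And>e. e > 0 \<Longrightarrow> \<exists>N::nat. \<forall>m\<ge>N. \<forall>n\<ge>N.
              semi_inner_product.dst (ring.add H) (smult H) (ip H) (X m) (X n) < e)
        \<Longrightarrow> \<exists>x\<in>carrier H.
              (\<lambda>n. semi_inner_product.dst (ring.add H) (smult H) (ip H) (X n) x) \<longlonglongrightarrow> 0"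
  shows "hilbert_space H"
proof -
  interpret semi_inner_product "carrier H" "\<zero>\<^bsub>H\<^esub>" "ring.add H" "smult H" "ip H"
    by fact
  have grp: "abelian_group H"
  proof (rule abelian_groupI)
    fix x assume x: "x \<in> carrier H"
    show "\<exists>y\<in>carrier H. y \<oplus>\<^bsub>H\<^esub> x = \<zero>\<^bsub>H\<^esub>"
    proof
      show "((- 1) \<odot>\<^bsub>H\<^esub> x) \<oplus>\<^bsub>H\<^esub> x = \<zero>\<^bsub>H\<^esub>" using x by (intro sep) auto
    qed (use x in simp)
  qed (auto intro!: sep)
  have "module complex_field H"
    by (rule moduleI[OF cring_complex_field grp]) (auto intro!: sep simp: algebra_simps)
  then interpret module complex_field H .
  have minus: "x \<ominus>\<^bsub>H\<^esub> y = x \<oplus>\<^bsub>H\<^esub> (- 1) \<odot>\<^bsub>H\<^esub> y" if "x \<in> carrier H" "y \<in> carrier H" for x y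
  proof -
    have "((- 1) \<odot>\<^bsub>H\<^esub> y) \<oplus>\<^bsub>H\<^esub> y = \<zero>\<^bsub>H\<^esub>" using that by (intro sep) auto
    then have "\<ominus>\<^bsub>H\<^esub> y = (- 1) \<odot>\<^bsub>H\<^esub> y"
      using that abelian_group.minus_equality[OF grp] by simp
    then show ?thesis by (simp add: a_minus_def)
  qed
  have vnorm_minus: "vnorm H (x \<ominus>\<^bsub>H\<^esub> y) = dst x y"
    if "x \<in> carrier H" "y \<in> carrier H" for x y
    using that by (simp add: minus dst_def nrm_def vnorm_def)
  show ?thesis
  proof
    fix x assume "x \<in> carrier H" "ip H x x = 0"
    then have "ip H w x = ip H w \<zero>\<^bsub>H\<^esub>" if "w \<in> carrier H" for w
      using Cauchy_Schwarz[OF that, of x] that by (simp add: nrm_def)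
    then show "x = \<zero>\<^bsub>H\<^esub>" using \<open>x \<in> carrier H\<close> by (intro sep) auto
  next
    fix X :: "nat \<Rightarrow> 'v"
    assume X: "\<And>n. X n \<in> carrier H"
      and "\<And>e. e > 0 \<Longrightarrow> \<exists>N::nat. \<forall>m\<ge>N. \<forall>n\<ge>N. vnorm H (X m \<ominus>\<^bsub>H\<^esub> X n) < e"
    then obtain x where x: "x \<in> carrier H" "(\<lambda>n. dst (X n) x) \<longlonglongrightarrow> 0"
      using compl[of X] by (auto simp: vnorm_minus)
    then show "\<exists>x\<in>carrier H. (\<lambda>n. vnorm H (X n \<ominus>\<^bsub>H\<^esub> x)) \<longlonglongrightarrow> 0"
      using X by (auto simp: vnorm_minus)
  qed (auto intro: form_nonneg form_cnj)
qed

context hilbert_space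
begin

lemma vec_zero_smult: "x \<in> carrier H \<Longrightarrow> \<zero>\<^bsub>H\<^esub> = 0 \<odot>\<^bsub>H\<^esub> x"
  using smult_l_null[of x] by simp

sublocale form: semi_inner_product "carrier H" "\<zero>\<^bsub>H\<^esub>" "ring.add H" "smult H" "ip H"
proof
  fix u v c assume "u \<in> carrier H" "v \<in> carrier H"
  show "ip H u \<zero>\<^bsub>H\<^esub> = 0" if "u \<in> carrier H" for u
    using that ip_smult_right[of u u 0] by (simp add: vec_zero_smult[of u])
qed (auto intro: ip_add_right ip_smult_right ip_cnj ip_nonneg)

lemma uminus_vec: "y \<in> carrier H \<Longrightarrow> \<ominus>\<^bsub>H\<^esub> y = (- 1) \<odot>\<^bsub>H\<^esub> y"
  using smult_l_distr[of "- 1" 1 y] smult_l_null[of y] smult_one[of y]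
  by (intro M.minus_equality) auto

lemma minus_vec: "y \<in> carrier H \<Longrightarrow> x \<ominus>\<^bsub>H\<^esub> y = x \<oplus>\<^bsub>H\<^esub> (- 1) \<odot>\<^bsub>H\<^esub> y"
  by (simp add: a_minus_def uminus_vec)

lemma vnorm_eq_nrm: "vnorm H x = form.nrm x"
  by (simp add: vnorm_def form.nrm_def)

lemma vnorm_minus: "y \<in> carrier H \<Longrightarrow> vnorm H (x \<ominus>\<^bsub>H\<^esub> y) = form.dst x y"
  by (simp add: minus_vec form.dst_def vnorm_eq_nrm)

lemma vec_eqI_dst:
  assumes x: "x \<in> carrier H" and y: "y \<in> carrier H" and "form.dst x y = 0"
  shows "x = y"
proof -
  have "ip H (x \<ominus>\<^bsub>H\<^esub> y) (x \<ominus>\<^bsub>H\<^esub> y) = 0"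
    using assms by (subst form.form_self) (simp_all add: form.dst_def minus_vec)
  then have "x \<ominus>\<^bsub>H\<^esub> y = \<zero>\<^bsub>H\<^esub>" using x y by (intro ip_definite) auto
  then show ?thesis
    using M.minus_equality[of x "\<ominus>\<^bsub>H\<^esub> y"] x y by (simp add: a_minus_def)
qed

lemma vec_eqI:
  "x \<in> carrier H \<Longrightarrow> y \<in> carrier H \<Longrightarrow> (\<And>w. w \<in> carrier H \<Longrightarrow> ip H w x = ip H w y) \<Longrightarrow> x = y"
  by (intro vec_eqI_dst form.dst_eq_0I)

lemma vec_eqI_left:
  "x \<in> carrier H \<Longrightarrow> y \<in> carrier H \<Longrightarrow> (\<And>w. w \<in> carrier H \<Longrightarrow> ip H x w = ip H y w) \<Longrightarrow> x = y"
  using ip_cnj by (intro vec_eqI) metis+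

lemma complete_dst:
  assumes X: "\<And>n. X n \<in> carrier H"
    and cau: "\<And>e. e > 0 \<Longrightarrow> \<exists>N::nat. \<forall>m\<ge>N. \<forall>n\<ge>N. form.dst (X m) (X n) < e"
  shows "\<exists>x\<in>carrier H. (\<lambda>n. form.dst (X n) x) \<longlonglongrightarrow> 0"
  using complete[of X] X cau by (auto simp: vnorm_minus)

text \<open>
  The Riesz representation theorem: the representing vector minimises
  \<open>\<parallel>x\<parallel>\<^sup>2 - 2 Re (\<phi> x)\<close>. Minimising sequences are Cauchy by the parallelogram identity, and the
  first variation at the minimum gives the representation.
\<close>

lemma Riesz_representation:
  assumes add: "\<And>x y. x \<in> carrier H \<Longrightarrow> y \<in> carrier H \<Longrightarrow> \<phi> (x \<oplus>\<^bsub>H\<^esub> y) = \<phi> x + \<phi> y"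
    and scale: "\<And>c x. x \<in> carrier H \<Longrightarrow> \<phi> (c \<odot>\<^bsub>H\<^esub> x) = c * \<phi> x"
    and bound: "\<And>x. x \<in> carrier H \<Longrightarrow> cmod (\<phi> x) \<le> C * form.nrm x"
  shows "\<exists>z\<in>carrier H. \<forall>y\<in>carrier H. \<phi> y = ip H z y"
proof -
  define F where "F x = (form.nrm x)\<^sup>2 - 2 * Re (\<phi> x)" for x
  define m where "m = (INF x\<in>carrier H. F x)"
  have "- C\<^sup>2 \<le> F x" if "x \<in> carrier H" for x
  proof -
    have "Re (\<phi> x) \<le> C * form.nrm x"
      using bound[OF that] complex_Re_le_cmod[of "\<phi> x"] by linarith
    moreover have "0 \<le> (form.nrm x - C)\<^sup>2" by simp
    ultimately show ?thesis by (simp add: F_def power2_diff mult.commute)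
  qed
  then have bdd: "bdd_below (F ` carrier H)" by (intro bdd_belowI2) auto
  have m_le: "m \<le> F x" if "x \<in> carrier H" for x
    unfolding m_def using bdd that by (rule cINF_lower)
  have "\<exists>x\<in>carrier H. F x < m + 1 / (real n + 1)" for n
    using cINF_less_iff[OF _ bdd, of "m + 1 / (real n + 1)"] unfolding m_def[symmetric] by force
  then obtain X where X: "\<And>n. X n \<in> carrier H" "\<And>n. F (X n) < m + 1 / (real n + 1)"
    by metis
  have par: "(form.dst x y)\<^sup>2 \<le> 2 * F x + 2 * F y - 4 * m"
    if x: "x \<in> carrier H" and y: "y \<in> carrier H" for x y
  proof -
    let ?w = "(1/2) \<odot>\<^bsub>H\<^esub> (x \<oplus>\<^bsub>H\<^esub> y)"
    have "form.nrm ?w = form.nrm (x \<oplus>\<^bsub>H\<^esub> y) / 2"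
      using x y form.nrm_scale[of "x \<oplus>\<^bsub>H\<^esub> y" "1/2"] by (simp add: norm_divide)
    then have "(form.nrm ?w)\<^sup>2 = (form.nrm (x \<oplus>\<^bsub>H\<^esub> y))\<^sup>2 / 4"
      by (simp only: power_divide) simp
    moreover have "(form.nrm (x \<oplus>\<^bsub>H\<^esub> y))\<^sup>2 = Re (ip H x x) + 2 * Re (ip H x y) + Re (ip H y y)"
      using x y by (simp add: form.nrm_sq form.Re_form_commute[of y x])
    moreover have "Re (\<phi> ?w) = (Re (\<phi> x) + Re (\<phi> y)) / 2"
      using x y by (simp add: add scale)
    ultimately have "4 * F ?w = 2 * F x + 2 * F y - (form.dst x y)\<^sup>2"
      using form.dst_sq[OF x y] form.nrm_sq[OF x] form.nrm_sq[OF y] by (simp add: F_def)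
    moreover have "m \<le> F ?w" using x y by (intro m_le) auto
    ultimately show ?thesis by simp
  qed
  have "\<exists>x\<in>carrier H. (\<lambda>n. form.dst (X n) x) \<longlonglongrightarrow> 0"
  proof (rule complete_dst[OF X(1)])
    fix e :: real assume e: "e > 0"
    obtain N :: nat where N: "4 / e\<^sup>2 < real N" using reals_Archimedean2 by blast
    have small: "1 / (real n + 1) < e\<^sup>2 / 4" if "n \<ge> N" for n
    proof -
      have "4 / e\<^sup>2 < real n + 1" using N that by linarith
      then show ?thesis using e by (simp add: field_simps)
    qed
    have "form.dst (X k) (X n) < e" if "k \<ge> N" "n \<ge> N" for k n
    proof (rule power2_less_imp_less)
      show "(form.dst (X k) (X n))\<^sup>2 < e\<^sup>2"
        using par[OF X(1) X(1), of k n] X(2)[of k] X(2)[of n]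
          small[OF that(1)] small[OF that(2)] by linarith
    qed (use e in simp)
    then show "\<exists>N. \<forall>m\<ge>N. \<forall>n\<ge>N. form.dst (X m) (X n) < e" by blast
  qed
  then obtain z where z: "z \<in> carrier H" "(\<lambda>n. form.dst (X n) z) \<longlonglongrightarrow> 0" by blast
  have "(\<lambda>n. \<phi> (X n)) \<longlonglongrightarrow> \<phi> z"
  proof (rule metric_tendsto_imp_tendsto)
    show "(\<lambda>n. C * form.dst (X n) z) \<longlonglongrightarrow> 0" using tendsto_mult_right_zero[OF z(2)] .
    have "cmod (\<phi> (X n) - \<phi> z) \<le> C * form.dst (X n) z" for n
      using bound[of "X n \<oplus>\<^bsub>H\<^esub> (- 1) \<odot>\<^bsub>H\<^esub> z"] X z by (simp add: add scale form.dst_def)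
    then show "\<forall>\<^sub>F n in sequentially. dist (\<phi> (X n)) (\<phi> z) \<le> dist (C * form.dst (X n) z) 0"
      by (intro always_eventually allI) (simp add: dist_norm order_trans[OF _ abs_ge_self])
  qed
  moreover have "(\<lambda>n. ip H (X n) (X n)) \<longlonglongrightarrow> ip H z z"
    using X z by (intro form.form_tendsto) auto
  ultimately have "(\<lambda>n. Re (ip H (X n) (X n)) - 2 * Re (\<phi> (X n))) \<longlonglongrightarrow> Re (ip H z z) - 2 * Re (\<phi> z)"
    by (intro tendsto_intros)
  then have "(\<lambda>n. F (X n)) \<longlonglongrightarrow> F z"
    using X z by (simp add: F_def form.nrm_sq)
  moreover have "(\<lambda>n. m + 1 / (real n + 1)) \<longlonglongrightarrow> m + 0"
    using LIMSEQ_inverse_real_of_nat by (intro tendsto_intros) (simp add: field_simps)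
  ultimately have "F z \<le> m + 0"
    using X(2) by (intro LIMSEQ_le) (auto intro: less_imp_le)
  then have z_min: "F z \<le> F x" if "x \<in> carrier H" for x
    using m_le[OF that] by simp
  have "\<phi> y = ip H z y" if y: "y \<in> carrier H" for y
  proof (rule ccontr)
    define w where "w = ip H z y - \<phi> y"
    assume "\<phi> y \<noteq> ip H z y"
    then have w: "cmod w > 0" by (simp add: w_def)
    define t where "t = 1 / ((form.nrm y)\<^sup>2 + 1)"
    have den: "(form.nrm y)\<^sup>2 + 1 > 0" by (smt (verit) zero_le_power2)
    then have t: "t > 0" "t * (form.nrm y)\<^sup>2 < 1" by (auto simp: t_def field_simps)
    \<comment> \<open>The direction in which the first variation decreases fastest, with a step so short that the
      quadratic term cannot compensate.\<close>
    define c where "c = - of_real t * cnj w"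
    have "F (z \<oplus>\<^bsub>H\<^esub> c \<odot>\<^bsub>H\<^esub> y) = F z + (form.nrm (c \<odot>\<^bsub>H\<^esub> y))\<^sup>2 + 2 * Re (c * w)"
      using y z form.Re_form_commute[of "c \<odot>\<^bsub>H\<^esub> y" z]
      by (simp add: F_def form.nrm_sq add scale w_def algebra_simps)
    then have "0 \<le> (form.nrm (c \<odot>\<^bsub>H\<^esub> y))\<^sup>2 + 2 * Re (c * w)"
      using z_min[of "z \<oplus>\<^bsub>H\<^esub> c \<odot>\<^bsub>H\<^esub> y"] y z by simp
    also have "form.nrm (c \<odot>\<^bsub>H\<^esub> y) = t * cmod w * form.nrm y"
      using y t by (simp add: form.nrm_scale c_def norm_mult)
    also have "c * w = of_real (- t * (cmod w)\<^sup>2)"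
      unfolding of_real_mult complex_norm_square by (simp add: c_def mult.commute)
    finally have "0 \<le> t * (cmod w)\<^sup>2 * (t * (form.nrm y)\<^sup>2 - 2)"
      by (simp add: power2_eq_square algebra_simps)
    moreover have "0 < t * (cmod w)\<^sup>2" using t w by simp
    ultimately show False
      using mult_pos_neg[of "t * (cmod w)\<^sup>2" "t * (form.nrm y)\<^sup>2 - 2"] t by linarith
  qed
  then show ?thesis using z by blast
qed

end

lemma bounded_ops_closed: "T \<in> bounded_ops H K \<Longrightarrow> x \<in> carrier H \<Longrightarrow> T x \<in> carrier K"
  by (auto simp: bounded_ops_def)

lemma bounded_ops_add:
  "T \<in> bounded_ops H K \<Longrightarrow> x \<in> carrier H \<Longrightarrow> y \<in> carrier H \<Longrightarrow> T (x \<oplus>\<^bsub>H\<^esub> y) = T x \<oplus>\<^bsub>K\<^esub> T y"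
  by (auto simp: bounded_ops_def)

lemma bounded_ops_smult:
  "T \<in> bounded_ops H K \<Longrightarrow> x \<in> carrier H \<Longrightarrow> T (c \<odot>\<^bsub>H\<^esub> x) = c \<odot>\<^bsub>K\<^esub> T x"
  by (auto simp: bounded_ops_def)

lemmas bounded_opsD = bounded_ops_closed bounded_ops_add bounded_ops_smult

lemma bounded_opsI:
  assumes "T \<in> extensional (carrier H)"
    and "\<And>x. x \<in> carrier H \<Longrightarrow> T x \<in> carrier K"
    and "\<And>x y. x \<in> carrier H \<Longrightarrow> y \<in> carrier H \<Longrightarrow> T (x \<oplus>\<^bsub>H\<^esub> y) = T x \<oplus>\<^bsub>K\<^esub> T y"
    and "\<And>c x. x \<in> carrier H \<Longrightarrow> T (c \<odot>\<^bsub>H\<^esub> x) = c \<odot>\<^bsub>K\<^esub> T x"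
    and "\<And>x. x \<in> carrier H \<Longrightarrow> vnorm K (T x) \<le> C * vnorm H x"
  shows "T \<in> bounded_ops H K"
proof -
  have "\<exists>C. \<forall>x\<in>carrier H. vnorm K (T x) \<le> C * vnorm H x" using assms(5) by blast
  then show ?thesis using assms(1-4) by (auto simp: bounded_ops_def PiE_def)
qed

lemma bounded_ops_eqI:
  "S \<in> bounded_ops H K \<Longrightarrow> T \<in> bounded_ops H K \<Longrightarrow> (\<And>x. x \<in> carrier H \<Longrightarrow> S x = T x) \<Longrightarrow> S = T"
  by (auto simp: bounded_ops_def intro: PiE_ext)

context hilbert_space
begin

lemma bounded_ops_bound:
  assumes "T \<in> bounded_ops H K"
  obtains C where "0 \<le> C" "\<And>x. x \<in> carrier H \<Longrightarrow> vnorm K (T x) \<le> C * vnorm H x"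
proof -
  obtain C where C: "\<forall>x\<in>carrier H. vnorm K (T x) \<le> C * vnorm H x"
    using assms by (auto simp: bounded_ops_def)
  have "C * vnorm H x \<le> \<bar>C\<bar> * vnorm H x" if "x \<in> carrier H" for x
    using that by (intro mult_right_mono) (auto simp: vnorm_eq_nrm)
  then show ?thesis using C that[of "\<bar>C\<bar>"] by fastforce
qed

lemma bounded_ops_Lipschitz:
  assumes T: "T \<in> bounded_ops H H"
  obtains C where "\<And>x y. x \<in> carrier H \<Longrightarrow> y \<in> carrier H \<Longrightarrow> form.dst (T x) (T y) \<le> C * form.dst x y"
proof -
  obtain C where C: "\<And>x. x \<in> carrier H \<Longrightarrow> form.nrm (T x) \<le> C * form.nrm x"
    using bounded_ops_bound[OF T] by (metis vnorm_eq_nrm)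
  have "form.dst (T x) (T y) \<le> C * form.dst x y" if "x \<in> carrier H" "y \<in> carrier H" for x y
    using C[of "x \<oplus>\<^bsub>H\<^esub> (- 1) \<odot>\<^bsub>H\<^esub> y"] that by (simp add: bounded_opsD[OF T] form.dst_def)
  then show ?thesis by (rule that)
qed

lemma op_one_apply [simp]: "x \<in> carrier H \<Longrightarrow> op_one H x = x"
  by (simp add: op_one_def)

lemma op_one_bounded: "op_one H \<in> bounded_ops H H"
  by (rule bounded_opsI[where C = 1]) (auto simp: op_one_def)

lemma op_add_bounded:
  assumes S: "S \<in> bounded_ops H H" and T: "T \<in> bounded_ops H H"
  shows "op_add H S T \<in> bounded_ops H H"
proof -
  obtain C D where C: "\<And>x. x \<in> carrier H \<Longrightarrow> vnorm H (S x) \<le> C * vnorm H x"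
    and D: "\<And>x. x \<in> carrier H \<Longrightarrow> vnorm H (T x) \<le> D * vnorm H x"
    using bounded_ops_bound S T by metis
  have "vnorm H (S x \<oplus>\<^bsub>H\<^esub> T x) \<le> (C + D) * vnorm H x" if "x \<in> carrier H" for x
    using form.nrm_triangle[of "S x" "T x"] C[OF that] D[OF that] that
    by (simp add: bounded_opsD[OF S] bounded_opsD[OF T] vnorm_eq_nrm distrib_right)
  then show ?thesis
    by (intro bounded_opsI[where C = "C + D"])
      (auto simp: bounded_opsD[OF S] bounded_opsD[OF T] op_add_def smult_r_distr M.a_ac)
qed

lemma op_smult_bounded:
  assumes T: "T \<in> bounded_ops H H"
  shows "op_smult H c T \<in> bounded_ops H H"
proof -
  obtain D where D: "\<And>x. x \<in> carrier H \<Longrightarrow> vnorm H (T x) \<le> D * vnorm H x"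
    using bounded_ops_bound T by metis
  have "vnorm H (c \<odot>\<^bsub>H\<^esub> T x) \<le> (cmod c * D) * vnorm H x" if "x \<in> carrier H" for x
    using mult_left_mono[OF D[OF that], of "cmod c"] that
    by (simp add: bounded_opsD[OF T] vnorm_eq_nrm form.nrm_scale mult.assoc)
  then show ?thesis
    by (intro bounded_opsI[where C = "cmod c * D"])
      (auto simp: bounded_opsD[OF T] op_smult_def smult_r_distr smult_assoc1[simplified, symmetric] mult.commute)
qed

lemma op_mult_bounded:
  assumes S: "S \<in> bounded_ops H H" and T: "T \<in> bounded_ops H H"
  shows "op_mult H S T \<in> bounded_ops H H"
proof -
  obtain C D where C: "\<And>x. x \<in> carrier H \<Longrightarrow> vnorm H (S x) \<le> C * vnorm H x" "0 \<le> C"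
    and D: "\<And>x. x \<in> carrier H \<Longrightarrow> vnorm H (T x) \<le> D * vnorm H x"
    using bounded_ops_bound S T by metis
  have "vnorm H (S (T x)) \<le> (C * D) * vnorm H x" if "x \<in> carrier H" for x
    using C(1)[of "T x"] mult_left_mono[OF D[OF that] C(2)] that
    by (simp add: bounded_opsD[OF T])
  then show ?thesis
    by (intro bounded_opsI[where C = "C * D"])
      (auto simp: compose_def bounded_opsD[OF S] bounded_opsD[OF T])
qed

text \<open>For fixed \<open>x\<close>, the vector \<open>S x\<close> represents the bounded functional that sends \<open>y\<close> to \<open>\<langle>x, T y\<rangle>\<close>.\<close>

lemma adjoint_exists:
  assumes T: "T \<in> bounded_ops H H"
  shows "\<exists>S\<in>bounded_ops H H. \<forall>x\<in>carrier H. \<forall>y\<in>carrier H. ip H (S x) y = ip H x (T y)"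
proof -
  obtain C where C: "0 \<le> C" "\<And>x. x \<in> carrier H \<Longrightarrow> form.nrm (T x) \<le> C * form.nrm x"
    using bounded_ops_bound[OF T] by (metis vnorm_eq_nrm)
  have CS: "cmod (ip H x (T y)) \<le> form.nrm x * C * form.nrm y"
    if "x \<in> carrier H" "y \<in> carrier H" for x y
    using form.Cauchy_Schwarz[of x "T y"] mult_left_mono[OF C(2)[of y], of "form.nrm x"] that
    by (simp add: bounded_opsD[OF T] mult.assoc)
  have "\<exists>z\<in>carrier H. \<forall>y\<in>carrier H. ip H x (T y) = ip H z y" if "x \<in> carrier H" for x
    using that CS by (intro Riesz_representation) (auto simp: bounded_opsD[OF T])
  then obtain S where S: "\<And>x. x \<in> carrier H \<Longrightarrow> S x \<in> carrier H"
    "\<And>x y. x \<in> carrier H \<Longrightarrow> y \<in> carrier H \<Longrightarrow> ip H (S x) y = ip H x (T y)"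
    by metis
  have S_bound: "form.nrm (S x) \<le> C * form.nrm x" if x: "x \<in> carrier H" for x
  proof (cases "form.nrm (S x) = 0")
    case False
    then have pos: "form.nrm (S x) > 0" using form.nrm_nonneg[OF S(1)[OF x]] by simp
    have "form.nrm (S x) * form.nrm (S x) = cmod (ip H x (T (S x)))"
      using S x S(2)[of x "S x"] by (metis abs_power2 form.form_self norm_of_real power2_eq_square)
    also have "\<dots> \<le> (C * form.nrm x) * form.nrm (S x)"
      using CS[of x "S x"] x S by (simp add: mult.commute)
    finally show ?thesis using pos by (rule mult_right_le_imp_le)
  qed (use C x in simp)
  have "(\<lambda>x\<in>carrier H. S x) \<in> bounded_ops H H"
    using S S_bound
    by (intro bounded_opsI[where C = C]) (auto simp: bounded_opsD[OF T] vnorm_eq_nrm intro!: vec_eqI_left)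
  then show ?thesis using S by (intro bexI[of _ "\<lambda>x\<in>carrier H. S x"]) auto
qed

lemma adj_eqI:
  assumes S: "S \<in> bounded_ops H H"
    and eq: "\<And>x y. x \<in> carrier H \<Longrightarrow> y \<in> carrier H \<Longrightarrow> ip H (S x) y = ip H x (T y)"
  shows "adj H T = S"
  unfolding adj_def
proof (rule the_equality)
  fix R
  assume R: "R \<in> bounded_ops H H \<and>
    (\<forall>x\<in>carrier H. \<forall>y\<in>carrier H. ip H (R x) y = ip H x (T y))"
  show "R = S"
  proof (rule bounded_ops_eqI[OF _ S])
    fix x assume x: "x \<in> carrier H"
    show "R x = S x"
      using R bounded_ops_closed[OF S x] bounded_ops_closed[of R H H x] x eq
      by (intro vec_eqI_left) auto
  qed (use R in blast)
qed (use S eq in blast)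

lemma adj_bounded: "T \<in> bounded_ops H H \<Longrightarrow> adj H T \<in> bounded_ops H H"
  using adjoint_exists[of T] adj_eqI[of _ T] by metis

lemma ip_adj_left:
  "T \<in> bounded_ops H H \<Longrightarrow> x \<in> carrier H \<Longrightarrow> y \<in> carrier H \<Longrightarrow> ip H (adj H T x) y = ip H x (T y)"
  using adjoint_exists[of T] adj_eqI[of _ T] by metis

lemma ip_adj_right:
  "T \<in> bounded_ops H H \<Longrightarrow> x \<in> carrier H \<Longrightarrow> y \<in> carrier H \<Longrightarrow> ip H x (adj H T y) = ip H (T x) y"
  using ip_adj_left[of T y x] ip_cnj[of "adj H T y" x] ip_cnj[of y "T x"]
  by (simp add: bounded_ops_closed[OF adj_bounded] bounded_ops_closed[of T])

end

section \<open>Completion of a semi-inner product\<close>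

context semi_inner_product
begin

definition cauchy :: "(nat \<Rightarrow> 'v) set" where
  "cauchy = {s. (\<forall>n. s n \<in> L) \<and> (\<forall>e>0. \<exists>N. \<forall>m\<ge>N. \<forall>n\<ge>N. dst (s m) (s n) < e)}"

definition null_rel :: "((nat \<Rightarrow> 'v) \<times> (nat \<Rightarrow> 'v)) set" where
  "null_rel = {(s, t). s \<in> cauchy \<and> t \<in> cauchy \<and> (\<lambda>n. dst (s n) (t n)) \<longlonglongrightarrow> 0}"

abbreviation cls :: "(nat \<Rightarrow> 'v) \<Rightarrow> (nat \<Rightarrow> 'v) set" where
  "cls s \<equiv> null_rel `` {s}"

text \<open>
  The operations take the union over all representatives. They respect null sequences, so the union
  is over a single class.
\<close>

definition completion :: "(nat \<Rightarrow> 'v) set ip_space" where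
  "completion = \<lparr>
     carrier = cauchy // null_rel,
     mult = undefined, one = undefined,
     zero = cls (\<lambda>n. zr),
     add = (\<lambda>X Y. \<Union>s\<in>X. \<Union>t\<in>Y. cls (\<lambda>n. s n \<boxplus> t n)),
     smult = (\<lambda>c X. \<Union>s\<in>X. cls (\<lambda>n. c \<bullet> s n)),
     ip = (\<lambda>X Y. THE z. \<exists>s\<in>X. \<exists>t\<in>Y. (\<lambda>n. B (s n) (t n)) \<longlonglongrightarrow> z)\<rparr>"

lemma cauchy_closed [simp]: "s \<in> cauchy \<Longrightarrow> s n \<in> L"
  by (simp add: cauchy_def)

lemma cauchyE:
  assumes "s \<in> cauchy" "e > 0"
  obtains N where "\<And>m n. m \<ge> N \<Longrightarrow> n \<ge> N \<Longrightarrow> dst (s m) (s n) < e"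
  using assms unfolding cauchy_def by blast

lemma cauchyI:
  assumes "\<And>n. s n \<in> L" "\<And>e. e > 0 \<Longrightarrow> \<exists>N. \<forall>m\<ge>N. \<forall>n\<ge>N. dst (s m) (s n) < e"
  shows "s \<in> cauchy"
  using assms unfolding cauchy_def by blast

lemma cauchy_const [simp]: "u \<in> L \<Longrightarrow> (\<lambda>n. u) \<in> cauchy"
  by (rule cauchyI) auto

lemma cauchy_bounded:
  assumes "s \<in> cauchy"
  obtains M N where "M > 0" "\<And>n. n \<ge> N \<Longrightarrow> nrm (s n) \<le> M"
proof -
  obtain N where N: "\<And>m n. m \<ge> N \<Longrightarrow> n \<ge> N \<Longrightarrow> dst (s m) (s n) < 1"
    using cauchyE[OF assms, of 1] by auto
  have "nrm (s n) \<le> nrm (s N) + 1" if "n \<ge> N" for n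
    using nrm_diff_le[of "s n" "s N"] N[OF that order_refl] assms by simp
  moreover have "nrm (s N) + 1 > 0" using nrm_nonneg[OF cauchy_closed[OF assms, of N]] by linarith
  ultimately show ?thesis by (rule that[rotated])
qed

lemma cauchy_map:
  assumes s: "s \<in> cauchy" and t: "\<And>n. t n \<in> L"
    and lip: "\<And>m n. dst (t m) (t n) \<le> C * dst (s m) (s n)"
  shows "t \<in> cauchy"
proof (rule cauchyI)
  fix e :: real assume e: "e > 0"
  obtain N where N: "\<And>m n. m \<ge> N \<Longrightarrow> n \<ge> N \<Longrightarrow> dst (s m) (s n) < e / (\<bar>C\<bar> + 1)"
    using cauchyE[OF s, of "e / (\<bar>C\<bar> + 1)"] e by auto
  have "dst (t m) (t n) < e" if "m \<ge> N" "n \<ge> N" for m n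
  proof -
    have "dst (t m) (t n) \<le> C * dst (s m) (s n)" by (rule lip)
    also have "\<dots> \<le> (\<bar>C\<bar> + 1) * dst (s m) (s n)"
      using s by (intro mult_right_mono) auto
    also have "\<dots> < e" using N[OF that] by (simp add: pos_less_divide_eq mult.commute)
    finally show ?thesis .
  qed
  then show "\<exists>N. \<forall>m\<ge>N. \<forall>n\<ge>N. dst (t m) (t n) < e" by blast
qed (rule t)

lemma cauchy_add [simp]:
  assumes s: "s \<in> cauchy" and t: "t \<in> cauchy"
  shows "(\<lambda>n. s n \<boxplus> t n) \<in> cauchy"
proof (rule cauchyI)
  fix e :: real assume e: "e > 0"
  obtain M N where M: "\<And>m n. m \<ge> M \<Longrightarrow> n \<ge> M \<Longrightarrow> dst (s m) (s n) < e / 2"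
    and N: "\<And>m n. m \<ge> N \<Longrightarrow> n \<ge> N \<Longrightarrow> dst (t m) (t n) < e / 2"
    using cauchyE[OF s, of "e / 2"] cauchyE[OF t, of "e / 2"] e by (metis half_gt_zero)
  have "dst (s m \<boxplus> t m) (s n \<boxplus> t n) < e" if "m \<ge> max M N" "n \<ge> max M N" for m n
    using dst_add[of "s m" "t m" "s n" "t n"] M[of m n] N[of m n] that s t by simp
  then show "\<exists>N. \<forall>m\<ge>N. \<forall>n\<ge>N. dst (s m \<boxplus> t m) (s n \<boxplus> t n) < e" by blast
qed (use s t in auto)

lemma cauchy_scale [simp]: "s \<in> cauchy \<Longrightarrow> (\<lambda>n. c \<bullet> s n) \<in> cauchy"
  by (rule cauchy_map[where C = "cmod c" and s = s]) (auto simp: dst_scale)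

lemma equiv_null_rel: "equiv cauchy null_rel"
proof (rule equivI)
  show "null_rel \<subseteq> cauchy \<times> cauchy" by (auto simp: null_rel_def)
  show "refl_on cauchy null_rel" by (auto simp: refl_on_def null_rel_def)
  show "sym null_rel"
  proof (rule symI)
    fix s t assume "(s, t) \<in> null_rel"
    moreover from this have "(\<lambda>n. dst (t n) (s n)) = (\<lambda>n. dst (s n) (t n))"
      by (auto simp: null_rel_def intro!: ext dst_commute)
    ultimately show "(t, s) \<in> null_rel" by (simp add: null_rel_def)
  qed
  show "trans null_rel"
  proof (rule transI)
    fix s t u assume st: "(s, t) \<in> null_rel" and tu: "(t, u) \<in> null_rel"
    have lim: "(\<lambda>n. dst (s n) (t n) + dst (t n) (u n)) \<longlonglongrightarrow> 0"
      using st tu tendsto_add_zero by (auto simp: null_rel_def)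
    have "(\<lambda>n. dst (s n) (u n)) \<longlonglongrightarrow> 0"
      by (rule tendsto_sandwich[OF _ _ tendsto_const lim])
        (use st tu in \<open>auto simp: null_rel_def intro!: always_eventually dst_triangle\<close>)
    then show "(s, u) \<in> null_rel" using st tu by (auto simp: null_rel_def)
  qed
qed

lemma cls_eq_iff:
  "s \<in> cauchy \<Longrightarrow> t \<in> cauchy \<Longrightarrow> cls s = cls t \<longleftrightarrow> (\<lambda>n. dst (s n) (t n)) \<longlonglongrightarrow> 0"
  using eq_equiv_class_iff[OF equiv_null_rel, of s t] by (auto simp: null_rel_def)

lemma cls_eqI: "s \<in> cauchy \<Longrightarrow> t \<in> cauchy \<Longrightarrow> (\<And>n. dst (s n) (t n) = 0) \<Longrightarrow> cls s = cls t"
  by (simp add: cls_eq_iff)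

lemma null_relD: "(s, t) \<in> null_rel \<Longrightarrow> s \<in> cauchy \<and> t \<in> cauchy \<and> cls s = cls t"
  using equiv_class_eq[OF equiv_null_rel] by (auto simp: null_rel_def)

lemma null_rel_map:
  assumes st: "(s, t) \<in> null_rel" and s': "s' \<in> cauchy" and t': "t' \<in> cauchy"
    and lip: "\<And>n. dst (s' n) (t' n) \<le> C * dst (s n) (t n)"
  shows "cls s' = cls t'"
proof -
  have lim: "(\<lambda>n. C * dst (s n) (t n)) \<longlonglongrightarrow> 0"
    using st by (intro tendsto_mult_right_zero) (simp add: null_rel_def)
  have "(\<lambda>n. dst (s' n) (t' n)) \<longlonglongrightarrow> 0"
    by (rule tendsto_sandwich[OF _ _ tendsto_const lim])
      (use s' t' lip in \<open>auto intro!: always_eventually\<close>)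
  then show ?thesis using s' t' by (simp add: cls_eq_iff)
qed

lemma completion_cases:
  assumes "X \<in> carrier completion"
  obtains s where "s \<in> cauchy" "X = cls s"
  using assms by (auto simp: completion_def elim!: quotientE)

lemma cls_closed [simp]: "s \<in> cauchy \<Longrightarrow> cls s \<in> carrier completion"
  by (auto simp: completion_def intro: quotientI)

lemma completion_zero: "\<zero>\<^bsub>completion\<^esub> = cls (\<lambda>n. zr)"
  by (simp add: completion_def)

lemma completion_add [simp]:
  assumes s: "s \<in> cauchy" and t: "t \<in> cauchy"
  shows "cls s \<oplus>\<^bsub>completion\<^esub> cls t = cls (\<lambda>n. s n \<boxplus> t n)"
proof -
  have "congruent2 null_rel null_rel (\<lambda>s t. cls (\<lambda>n. s n \<boxplus> t n))"
  proof (rule congruent2I')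
    fix s s' t t' assume *: "(s, s') \<in> null_rel" "(t, t') \<in> null_rel"
    have lim: "(\<lambda>n. dst (s n) (s' n) + dst (t n) (t' n)) \<longlonglongrightarrow> 0"
      using * tendsto_add_zero by (auto simp: null_rel_def)
    have "(\<lambda>n. dst (s n \<boxplus> t n) (s' n \<boxplus> t' n)) \<longlonglongrightarrow> 0"
      by (rule tendsto_sandwich[OF _ _ tendsto_const lim])
        (use * in \<open>auto simp: null_rel_def intro!: always_eventually dst_add\<close>)
    then show "cls (\<lambda>n. s n \<boxplus> t n) = cls (\<lambda>n. s' n \<boxplus> t' n)"
      using null_relD[OF *(1)] null_relD[OF *(2)] by (simp add: cls_eq_iff)
  qed
  from UN_equiv_class2[OF equiv_null_rel equiv_null_rel this s t]
  show ?thesis by (simp add: completion_def)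
qed

lemma completion_smult [simp]:
  assumes s: "s \<in> cauchy"
  shows "c \<odot>\<^bsub>completion\<^esub> cls s = cls (\<lambda>n. c \<bullet> s n)"
proof -
  have "(\<lambda>s. cls (\<lambda>n. c \<bullet> s n)) respects null_rel"
  proof (rule congruentI)
    fix s t assume *: "(s, t) \<in> null_rel"
    show "cls (\<lambda>n. c \<bullet> s n) = cls (\<lambda>n. c \<bullet> t n)"
      by (rule null_rel_map[OF *, where C = "cmod c"]) (use null_relD[OF *] in \<open>auto simp: dst_scale\<close>)
  qed
  from UN_equiv_class[OF equiv_null_rel this s] show ?thesis by (simp add: completion_def)
qed

lemma form_convergent:
  assumes s: "s \<in> cauchy" and t: "t \<in> cauchy"
  obtains z where "(\<lambda>n. B (s n) (t n)) \<longlonglongrightarrow> z"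
proof -
  obtain M N where M: "M > 0" "\<And>n. n \<ge> N \<Longrightarrow> nrm (s n) \<le> M" using cauchy_bounded[OF s] by metis
  obtain M' N' where M': "M' > 0" "\<And>n. n \<ge> N' \<Longrightarrow> nrm (t n) \<le> M'"
    using cauchy_bounded[OF t] by metis
  have "Cauchy (\<lambda>n. B (s n) (t n))"
  proof (rule CauchyI)
    fix e :: real assume e: "e > 0"
    obtain P where P: "\<And>m n. m \<ge> P \<Longrightarrow> n \<ge> P \<Longrightarrow> dst (s m) (s n) < e / (2 * M')"
      using cauchyE[OF s, of "e / (2 * M')"] e M' by auto
    obtain Q where Q: "\<And>m n. m \<ge> Q \<Longrightarrow> n \<ge> Q \<Longrightarrow> dst (t m) (t n) < e / (2 * M)"
      using cauchyE[OF t, of "e / (2 * M)"] e M by auto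
    define R where "R = Max {N, N', P, Q}"
    have R: "N \<le> R" "N' \<le> R" "P \<le> R" "Q \<le> R" by (auto simp: R_def)
    have "cmod (B (s m) (t m) - B (s n) (t n)) < e" if "m \<ge> R" "n \<ge> R" for m n
    proof -
      have "cmod (B (s m) (t m) - B (s n) (t n))
          \<le> dst (s m) (s n) * nrm (t m) + nrm (s n) * dst (t m) (t n)"
        using s t by (intro form_diff_le) auto
      also have "\<dots> \<le> dst (s m) (s n) * M' + M * dst (t m) (t n)"
        using s t M M' R that by (intro add_mono mult_left_mono mult_right_mono) auto
      also have "\<dots> < e / (2 * M') * M' + M * (e / (2 * M))"
        using P[of m n] Q[of m n] M(1) M'(1) R that
        by (intro add_strict_mono mult_strict_right_mono mult_strict_left_mono) auto
      also have "\<dots> = e" using M M' by simp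
      finally show ?thesis .
    qed
    then show "\<exists>R. \<forall>m\<ge>R. \<forall>n\<ge>R. norm (B (s m) (t m) - B (s n) (t n)) < e" by blast
  qed
  then show ?thesis using that Cauchy_convergent_iff convergent_def by metis
qed

lemma form_limit_cong:
  assumes ss: "(s, s') \<in> null_rel" and tt: "(t, t') \<in> null_rel"
    and lim: "(\<lambda>n. B (s n) (t n)) \<longlonglongrightarrow> z"
  shows "(\<lambda>n. B (s' n) (t' n)) \<longlonglongrightarrow> z"
proof -
  have c: "s \<in> cauchy" "s' \<in> cauchy" "t \<in> cauchy" "t' \<in> cauchy"
    using null_relD[OF ss] null_relD[OF tt] by auto
  obtain M N where M: "M > 0" "\<And>n. n \<ge> N \<Longrightarrow> nrm (s' n) \<le> M"
    using cauchy_bounded[OF c(2)] by metis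
  obtain M' N' where M': "M' > 0" "\<And>n. n \<ge> N' \<Longrightarrow> nrm (t n) \<le> M'"
    using cauchy_bounded[OF c(3)] by metis
  have "(\<lambda>n. dst (s n) (s' n) * M' + M * dst (t n) (t' n)) \<longlonglongrightarrow> 0 * M' + M * 0"
    using ss tt by (intro tendsto_intros) (auto simp: null_rel_def)
  then have "(\<lambda>n. dst (s n) (s' n) * M' + M * dst (t n) (t' n)) \<longlonglongrightarrow> 0" by simp
  then have "(\<lambda>n. B (s n) (t n) - B (s' n) (t' n)) \<longlonglongrightarrow> 0"
  proof (rule metric_tendsto_imp_tendsto)
    have "cmod (B (s n) (t n) - B (s' n) (t' n)) \<le> dst (s n) (s' n) * M' + M * dst (t n) (t' n)"
      if "n \<ge> max N N'" for n
    proof -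
      have "cmod (B (s n) (t n) - B (s' n) (t' n))
          \<le> dst (s n) (s' n) * nrm (t n) + nrm (s' n) * dst (t n) (t' n)"
        using c by (intro form_diff_le) auto
      also have "\<dots> \<le> dst (s n) (s' n) * M' + M * dst (t n) (t' n)"
        using c M M' that by (intro add_mono mult_left_mono mult_right_mono) auto
      finally show ?thesis .
    qed
    then show "\<forall>\<^sub>F n in sequentially. dist (B (s n) (t n) - B (s' n) (t' n)) 0
        \<le> dist (dst (s n) (s' n) * M' + M * dst (t n) (t' n)) 0"
      by (intro eventually_sequentiallyI[of "max N N'"])
        (simp add: dist_norm order_trans[OF _ abs_ge_self])
  qed
  from tendsto_diff[OF lim this] show ?thesis by simp
qed

text \<open>
  The limit exists by \<open>form_convergent\<close> and is the same for all representatives by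
  \<open>form_limit_cong\<close>, so the definite description in the definition of the inner product denotes it.
\<close>

lemma ip_completion_limit:
  assumes s: "s \<in> cauchy" and t: "t \<in> cauchy"
  shows "(\<lambda>n. B (s n) (t n)) \<longlonglongrightarrow> ip completion (cls s) (cls t)"
proof -
  obtain z where z: "(\<lambda>n. B (s n) (t n)) \<longlonglongrightarrow> z" using form_convergent[OF s t] .
  have self: "s \<in> cls s" "t \<in> cls t"
    using s t equiv_class_self[OF equiv_null_rel] by auto
  have "(THE z. \<exists>s'\<in>cls s. \<exists>t'\<in>cls t. (\<lambda>n. B (s' n) (t' n)) \<longlonglongrightarrow> z) = z"
  proof (rule the_equality)
    fix w assume "\<exists>s'\<in>cls s. \<exists>t'\<in>cls t. (\<lambda>n. B (s' n) (t' n)) \<longlonglongrightarrow> w"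
    then obtain s' t' where *: "(s, s') \<in> null_rel" "(t, t') \<in> null_rel"
      "(\<lambda>n. B (s' n) (t' n)) \<longlonglongrightarrow> w" by auto
    have "(\<lambda>n. B (s' n) (t' n)) \<longlonglongrightarrow> z" by (rule form_limit_cong[OF *(1,2) z])
    then show "w = z" using *(3) LIMSEQ_unique by blast
  qed (use self z in blast)
  then show ?thesis using z by (simp add: completion_def)
qed

lemma ip_completion_eqI:
  "s \<in> cauchy \<Longrightarrow> t \<in> cauchy \<Longrightarrow> (\<lambda>n. B (s n) (t n)) \<longlonglongrightarrow> z \<Longrightarrow> ip completion (cls s) (cls t) = z"
  using ip_completion_limit LIMSEQ_unique by blast

lemma ip_completion_const:
  "u \<in> L \<Longrightarrow> v \<in> L \<Longrightarrow> ip completion (cls (\<lambda>n. u)) (cls (\<lambda>n. v)) = B u v"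
  by (rule ip_completion_eqI) auto

lemma semi_inner_product_completion:
  "semi_inner_product (carrier completion) \<zero>\<^bsub>completion\<^esub> (ring.add completion)
     (smult completion) (ip completion)"
proof
  fix X Y Z c
  assume "X \<in> carrier completion" "Y \<in> carrier completion" "Z \<in> carrier completion"
  then obtain s t u where XYZ: "X = cls s" "Y = cls t" "Z = cls u"
    and c: "s \<in> cauchy" "t \<in> cauchy" "u \<in> cauchy"
    by (metis completion_cases)
  note lim = ip_completion_limit
  show "ip completion X (Y \<oplus>\<^bsub>completion\<^esub> Z) = ip completion X Y + ip completion X Z"
    using tendsto_add[OF lim[OF c(1,2)] lim[OF c(1,3)]] c
    by (simp add: XYZ ip_completion_eqI)
next
  fix X Y c assume "X \<in> carrier completion" "Y \<in> carrier completion"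
  then obtain s t where XY: "X = cls s" "Y = cls t" and c: "s \<in> cauchy" "t \<in> cauchy"
    by (metis completion_cases)
  note lim = ip_completion_limit
  show "X \<oplus>\<^bsub>completion\<^esub> Y \<in> carrier completion" using c by (simp add: XY)
  show "ip completion X (c \<odot>\<^bsub>completion\<^esub> Y) = c * ip completion X Y"
    using tendsto_mult_left[OF lim[OF c], of c] c by (simp add: XY ip_completion_eqI)
  show "ip completion Y X = cnj (ip completion X Y)"
    unfolding XY
  proof (rule ip_completion_eqI)
    have "(\<lambda>n. cnj (B (s n) (t n))) = (\<lambda>n. B (t n) (s n))"
      using form_cnj c by (intro ext) (metis cauchy_closed)
    then show "(\<lambda>n. B (t n) (s n)) \<longlonglongrightarrow> cnj (ip completion (cls s) (cls t))"
      using tendsto_cnj[OF lim[OF c]] by simp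
  qed (use c in auto)
next
  fix X c assume "X \<in> carrier completion"
  then obtain s where X: "X = cls s" and s: "s \<in> cauchy" by (metis completion_cases)
  show "c \<odot>\<^bsub>completion\<^esub> X \<in> carrier completion" using s by (simp add: X)
  show "ip completion X \<zero>\<^bsub>completion\<^esub> = 0"
    unfolding X completion_zero using s by (intro ip_completion_eqI) auto
  have "0 \<le> Re (ip completion X X)"
    unfolding X
    by (rule LIMSEQ_le_const[OF tendsto_Re[OF ip_completion_limit[OF s s]]]) (use s in auto)
  moreover have "Im (ip completion X X) = 0"
    using tendsto_Im[OF ip_completion_limit[OF s s]] s LIMSEQ_unique[OF _ tendsto_const]
    by (simp add: X)
  ultimately show "ip completion X X \<in> \<real>\<^sub>\<ge>\<^sub>0" by (simp add: complex_nonneg_Reals_iff)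
qed (simp add: completion_zero)

interpretation comp: semi_inner_product "carrier completion" "\<zero>\<^bsub>completion\<^esub>"
  "ring.add completion" "smult completion" "ip completion"
  by (rule semi_inner_product_completion)

lemma dst_completion_limit:
  assumes s: "s \<in> cauchy" and t: "t \<in> cauchy"
  shows "(\<lambda>n. dst (s n) (t n)) \<longlonglongrightarrow> comp.dst (cls s) (cls t)"
  using tendsto_real_sqrt[OF tendsto_Re[OF ip_completion_limit, of "\<lambda>n. s n \<boxplus> (- 1) \<bullet> t n"
    "\<lambda>n. s n \<boxplus> (- 1) \<bullet> t n"]] s t
  unfolding dst_def comp.dst_def comp.nrm_def nrm_def
  by (simp del: form_add_left form_add_right form_scale_left form_scale_right)

lemma const_approximates:
  assumes s: "s \<in> cauchy" and e: "e > 0"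
  obtains N where "\<And>k. k \<ge> N \<Longrightarrow> comp.dst (cls (\<lambda>n. s k)) (cls s) \<le> e"
proof -
  obtain N where N: "\<And>m n. m \<ge> N \<Longrightarrow> n \<ge> N \<Longrightarrow> dst (s m) (s n) < e"
    using cauchyE[OF s e] by blast
  have "comp.dst (cls (\<lambda>n. s k)) (cls s) \<le> e" if "k \<ge> N" for k
  proof (rule LIMSEQ_le_const2[OF dst_completion_limit])
    show "\<exists>M. \<forall>n\<ge>M. dst (s k) (s n) \<le> e" using N[OF that] less_imp_le by blast
  qed (use s in auto)
  then show ?thesis by (rule that)
qed

lemma const_tendsto:
  assumes s: "s \<in> cauchy"
  shows "(\<lambda>k. comp.dst (cls (\<lambda>n. s k)) (cls s)) \<longlonglongrightarrow> 0"
proof (rule LIMSEQ_I)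
  fix e :: real assume e: "e > 0"
  obtain N where "\<And>k. k \<ge> N \<Longrightarrow> comp.dst (cls (\<lambda>n. s k)) (cls s) \<le> e / 2"
    using const_approximates[OF s, of "e / 2"] e by auto
  moreover have "0 \<le> comp.dst (cls (\<lambda>n. s k)) (cls s)" for k
    using s by (intro comp.dst_nonneg) auto
  ultimately have "\<forall>k\<ge>N. norm (comp.dst (cls (\<lambda>n. s k)) (cls s) - 0) < e"
    using e by (smt (verit) field_sum_of_halves real_norm_def)
  then show "\<exists>N. \<forall>k\<ge>N. norm (comp.dst (cls (\<lambda>n. s k)) (cls s) - 0) < e" by blast
qed

theorem hilbert_space_completion: "hilbert_space completion"
proof (rule hilbert_spaceI[OF semi_inner_product_completion])
  fix X Y assume XY: "X \<in> carrier completion" "Y \<in> carrier completion"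
    and eq: "\<And>W. W \<in> carrier completion \<Longrightarrow> ip completion W X = ip completion W Y"
  obtain s t where st: "X = cls s" "Y = cls t" and c: "s \<in> cauchy" "t \<in> cauchy"
    using XY by (metis completion_cases)
  have "comp.dst X Y = 0" using XY eq by (rule comp.dst_eq_0I)
  then show "X = Y" using dst_completion_limit[OF c] c by (simp add: st cls_eq_iff)
next
  \<comment> \<open>The limit is the class of a sequence of vectors of the original space, the n-th of which is
    within \<open>1 / (n + 1)\<close> of the n-th term.\<close>
  fix X :: "nat \<Rightarrow> (nat \<Rightarrow> 'v) set"
  assume X: "\<And>n. X n \<in> carrier completion"
    and cau: "\<And>e. e > 0 \<Longrightarrow> \<exists>N::nat. \<forall>m\<ge>N. \<forall>n\<ge>N. comp.dst (X m) (X n) < e"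
  have "\<exists>u\<in>L. comp.dst (cls (\<lambda>n. u)) (X k) \<le> 1 / (real k + 1)" for k
  proof -
    obtain s where s: "X k = cls s" "s \<in> cauchy" using X by (metis completion_cases)
    have "(0::real) < 1 / (real k + 1)" by simp
    from const_approximates[OF s(2) this] obtain N
      where "comp.dst (cls (\<lambda>n. s N)) (cls s) \<le> 1 / (real k + 1)" by blast
    then show ?thesis using s by (intro bexI[of _ "s N"]) auto
  qed
  then obtain u where u: "\<And>k. u k \<in> L"
    "\<And>k. comp.dst (cls (\<lambda>n. u k)) (X k) \<le> 1 / (real k + 1)" by metis
  have const_dst: "comp.dst (cls (\<lambda>n. u k)) (cls (\<lambda>n. u l)) = dst (u k) (u l)" for k l
    using LIMSEQ_unique[OF dst_completion_limit tendsto_const] u by simp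
  have lim0: "(\<lambda>k. 1 / (real k + 1)) \<longlonglongrightarrow> 0"
    using LIMSEQ_inverse_real_of_nat by (simp add: field_simps)
  have "u \<in> cauchy"
  proof (rule cauchyI)
    fix e :: real assume e: "e > 0"
    obtain N where N: "\<forall>m\<ge>N. \<forall>n\<ge>N. comp.dst (X m) (X n) < e / 3"
      using cau[of "e / 3"] e by auto
    obtain M where M: "\<forall>k\<ge>M. 1 / (real k + 1) < e / 3"
      using LIMSEQ_D[OF lim0, of "e / 3"] e by auto
    have "dst (u k) (u l) < e" if "k \<ge> max M N" "l \<ge> max M N" for k l
    proof -
      have "dst (u k) (u l) \<le> comp.dst (cls (\<lambda>n. u k)) (X l) + comp.dst (X l) (cls (\<lambda>n. u l))"
        unfolding const_dst[symmetric] using X u by (intro comp.dst_triangle) auto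
      also have "comp.dst (cls (\<lambda>n. u k)) (X l)
          \<le> comp.dst (cls (\<lambda>n. u k)) (X k) + comp.dst (X k) (X l)"
        using X u by (intro comp.dst_triangle) auto
      also have "comp.dst (X l) (cls (\<lambda>n. u l)) = comp.dst (cls (\<lambda>n. u l)) (X l)"
        using X u by (intro comp.dst_commute) auto
      finally have "dst (u k) (u l) \<le> 1 / (real k + 1) + comp.dst (X k) (X l) + 1 / (real l + 1)"
        using u(2)[of k] u(2)[of l] by linarith
      moreover have "1 / (real k + 1) < e / 3" "1 / (real l + 1) < e / 3"
        "comp.dst (X k) (X l) < e / 3"
        using M N that by auto
      ultimately show ?thesis by linarith
    qed
    then show "\<exists>N. \<forall>m\<ge>N. \<forall>n\<ge>N. dst (u m) (u n) < e" by blast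
  qed (rule u)
  moreover have "(\<lambda>k. comp.dst (X k) (cls u)) \<longlonglongrightarrow> 0"
  proof (rule tendsto_sandwich[OF _ _ tendsto_const])
    show "(\<lambda>k. 1 / (real k + 1) + comp.dst (cls (\<lambda>n. u k)) (cls u)) \<longlonglongrightarrow> 0"
      using tendsto_add[OF lim0 const_tendsto[OF \<open>u \<in> cauchy\<close>]] by simp
    have "comp.dst (X k) (cls u) \<le> 1 / (real k + 1) + comp.dst (cls (\<lambda>n. u k)) (cls u)" for k
      using comp.dst_triangle[of "X k" "cls (\<lambda>n. u k)" "cls u"] u(2)[of k] X \<open>u \<in> cauchy\<close> u(1)
        comp.dst_commute[of "X k" "cls (\<lambda>n. u k)"] by simp
    then show "\<forall>\<^sub>F k in sequentially. comp.dst (X k) (cls u)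
        \<le> 1 / (real k + 1) + comp.dst (cls (\<lambda>n. u k)) (cls u)" by simp
  qed (use X \<open>u \<in> cauchy\<close> in simp)
  ultimately show "\<exists>x\<in>carrier completion. (\<lambda>n. comp.dst (X n) x) \<longlonglongrightarrow> 0" by auto
qed

text \<open>The classes of constant sequences are dense, by \<open>const_tendsto\<close>.\<close>

lemma completion_ops_eqI:
  assumes S: "S \<in> bounded_ops completion completion" and T: "T \<in> bounded_ops completion completion"
    and eq: "\<And>u. u \<in> L \<Longrightarrow> S (cls (\<lambda>n. u)) = T (cls (\<lambda>n. u))"
  shows "S = T"
proof (rule bounded_ops_eqI[OF S T])
  interpret C: hilbert_space completion by (rule hilbert_space_completion)
  fix X assume X: "X \<in> carrier completion"
  then obtain s where s: "X = cls s" "s \<in> cauchy" by (metis completion_cases)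
  obtain C where C: "\<And>x y. x \<in> carrier completion \<Longrightarrow> y \<in> carrier completion
      \<Longrightarrow> comp.dst (S x) (S y) \<le> C * comp.dst x y"
    using C.bounded_ops_Lipschitz[OF S] by blast
  obtain D where D: "\<And>x y. x \<in> carrier completion \<Longrightarrow> y \<in> carrier completion
      \<Longrightarrow> comp.dst (T x) (T y) \<le> D * comp.dst x y"
    using C.bounded_ops_Lipschitz[OF T] by blast
  have SX: "S X \<in> carrier completion" and TX: "T X \<in> carrier completion"
    using X bounded_ops_closed[OF S] bounded_ops_closed[OF T] by auto
  have "comp.dst (S X) (T X) \<le> (C + D) * comp.dst (cls (\<lambda>n. s k)) X" for k
  proof -
    let ?c = "cls (\<lambda>n. s k)"
    have c: "?c \<in> carrier completion" using s by simp
    have Sc: "S ?c \<in> carrier completion" using c bounded_ops_closed[OF S] by blast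
    have "comp.dst (S X) (T X) \<le> comp.dst (S ?c) (S X) + comp.dst (S ?c) (T X)"
      using comp.dst_triangle[OF SX Sc TX] comp.dst_commute[OF SX Sc] by simp
    also have "S ?c = T ?c" using s by (intro eq) simp
    also have "comp.dst (T ?c) (S X) = comp.dst (S ?c) (S X)" using s by (simp add: eq)
    finally show ?thesis using C[OF c X] D[OF c X] by (simp add: distrib_right)
  qed
  moreover have "(\<lambda>k. (C + D) * comp.dst (cls (\<lambda>n. s k)) X) \<longlonglongrightarrow> 0"
    using const_tendsto[OF s(2)] unfolding s(1) by (rule tendsto_mult_right_zero)
  ultimately have "comp.dst (S X) (T X) \<le> 0"
    by (intro LIMSEQ_le_const) auto
  then have "comp.dst (S X) (T X) = 0" using comp.dst_nonneg[OF SX TX] by simp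
  then show "S X = T X" using SX TX by (intro C.vec_eqI_dst)
qed

text \<open>The operator that a bounded linear map \<open>f\<close> of the original space induces on the completion.\<close>

definition lift :: "('v \<Rightarrow> 'v) \<Rightarrow> (nat \<Rightarrow> 'v) set \<Rightarrow> (nat \<Rightarrow> 'v) set" where
  "lift f = (\<lambda>X\<in>carrier completion. \<Union>s\<in>X. cls (\<lambda>n. f (s n)))"

context
  fixes f :: "'v \<Rightarrow> 'v" and C :: real
  assumes closed: "\<And>u. u \<in> L \<Longrightarrow> f u \<in> L"
    and add: "\<And>u v. u \<in> L \<Longrightarrow> v \<in> L \<Longrightarrow> f (u \<boxplus> v) = f u \<boxplus> f v"
    and scale: "\<And>c u. u \<in> L \<Longrightarrow> f (c \<bullet> u) = c \<bullet> f u"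
    and bound: "\<And>u. u \<in> L \<Longrightarrow> nrm (f u) \<le> C * nrm u"
begin

lemma lift_Lipschitz: "u \<in> L \<Longrightarrow> v \<in> L \<Longrightarrow> dst (f u) (f v) \<le> C * dst u v"
  using bound[of "u \<boxplus> (- 1) \<bullet> v"] by (simp add: dst_def add scale)

lemma lift_cauchy: "s \<in> cauchy \<Longrightarrow> (\<lambda>n. f (s n)) \<in> cauchy"
  by (rule cauchy_map[where C = C and s = s]) (auto intro: closed lift_Lipschitz)

lemma lift_cls: "s \<in> cauchy \<Longrightarrow> lift f (cls s) = cls (\<lambda>n. f (s n))"
proof -
  assume s: "s \<in> cauchy"
  have "(\<lambda>s. cls (\<lambda>n. f (s n))) respects null_rel"
  proof (rule congruentI)
    fix s t assume *: "(s, t) \<in> null_rel"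
    then have "s \<in> cauchy" "t \<in> cauchy" using null_relD by auto
    then show "cls (\<lambda>n. f (s n)) = cls (\<lambda>n. f (t n))"
      by (intro null_rel_map[OF *, where C = C] lift_cauchy lift_Lipschitz cauchy_closed)
  qed
  from UN_equiv_class[OF equiv_null_rel this s] s show ?thesis by (simp add: lift_def)
qed

lemma lift_bound: "X \<in> carrier completion \<Longrightarrow> vnorm completion (lift f X) \<le> C * vnorm completion X"
proof -
  assume "X \<in> carrier completion"
  then obtain s where s: "X = cls s" "s \<in> cauchy" by (metis completion_cases)
  have "(\<lambda>n. nrm (t n)) \<longlonglongrightarrow> vnorm completion (cls t)" if "t \<in> cauchy" for t
    unfolding nrm_def vnorm_def
    by (intro tendsto_real_sqrt tendsto_Re ip_completion_limit that)
  from LIMSEQ_le[OF this[OF lift_cauchy[OF s(2)]] tendsto_mult_left[OF this[OF s(2)]]]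
  show ?thesis using s bound by (simp add: lift_cls)
qed

lemma lift_bounded: "lift f \<in> bounded_ops completion completion"
proof (rule bounded_opsI[where C = C])
  show "lift f \<in> extensional (carrier completion)" by (simp add: lift_def)
  fix X Y assume "X \<in> carrier completion" "Y \<in> carrier completion"
  then obtain s t where "X = cls s" "Y = cls t" "s \<in> cauchy" "t \<in> cauchy"
    by (metis completion_cases)
  then show "lift f (X \<oplus>\<^bsub>completion\<^esub> Y) = lift f X \<oplus>\<^bsub>completion\<^esub> lift f Y"
    by (simp add: lift_cls lift_cauchy add)
next
  fix X c assume "X \<in> carrier completion"
  then obtain s where X: "X = cls s" "s \<in> cauchy" by (metis completion_cases)
  then show "lift f X \<in> carrier completion" by (simp add: lift_cls lift_cauchy)
  show "lift f (c \<odot>\<^bsub>completion\<^esub> X) = c \<odot>\<^bsub>completion\<^esub> lift f X"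
    using X by (simp add: lift_cls lift_cauchy scale)
qed (rule lift_bound)

end

end

section \<open>Direct sums and transport\<close>

lemma direct_sum_simps [simp]:
  "\<zero>\<^bsub>direct_sum Hs\<^esub> n = \<zero>\<^bsub>Hs n\<^esub>"
  "(x \<oplus>\<^bsub>direct_sum Hs\<^esub> y) n = x n \<oplus>\<^bsub>Hs n\<^esub> y n"
  "(c \<odot>\<^bsub>direct_sum Hs\<^esub> x) n = c \<odot>\<^bsub>Hs n\<^esub> x n"
  by (simp_all add: direct_sum_def)

lemma direct_sum_ip: "ip (direct_sum Hs) x y = (\<Sum>n. ip (Hs n) (x n) (y n))"
  by (simp add: direct_sum_def)

locale hilbert_sequence =
  fixes Hs :: "nat \<Rightarrow> 'v ip_space"
  assumes hilbert: "hilbert_space (Hs n)"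
begin

sublocale part: hilbert_space "Hs n" for n
  by (rule hilbert)

lemma direct_sum_carrier:
  "x \<in> carrier (direct_sum Hs)
    \<longleftrightarrow> (\<forall>n. x n \<in> carrier (Hs n)) \<and> summable (\<lambda>n. (part.form.nrm n (x n))\<^sup>2)"
  by (simp add: direct_sum_def part.vnorm_eq_nrm)

lemma direct_sum_memI:
  "(\<And>n. x n \<in> carrier (Hs n)) \<Longrightarrow> summable (\<lambda>n. (part.form.nrm n (x n))\<^sup>2)
    \<Longrightarrow> x \<in> carrier (direct_sum Hs)"
  by (simp add: direct_sum_carrier)

lemma direct_sum_summable: "x \<in> carrier (direct_sum Hs) \<Longrightarrow> summable (\<lambda>n. (part.form.nrm n (x n))\<^sup>2)"
  by (simp add: direct_sum_carrier)

lemma direct_sum_closed [simp]: "x \<in> carrier (direct_sum Hs) \<Longrightarrow> x n \<in> carrier (Hs n)"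
  by (simp add: direct_sum_carrier)

lemma nrm_add_sq_le:
  assumes "u \<in> carrier (Hs n)" "v \<in> carrier (Hs n)"
  shows "(part.form.nrm n (u \<oplus>\<^bsub>Hs n\<^esub> v))\<^sup>2
    \<le> 2 * (part.form.nrm n u)\<^sup>2 + 2 * (part.form.nrm n v)\<^sup>2"
proof -
  have "(part.form.nrm n (u \<oplus>\<^bsub>Hs n\<^esub> v))\<^sup>2 \<le> (part.form.nrm n u + part.form.nrm n v)\<^sup>2"
    using assms by (intro power_mono part.form.nrm_triangle) auto
  also have "\<dots> \<le> 2 * (part.form.nrm n u)\<^sup>2 + 2 * (part.form.nrm n v)\<^sup>2"
    using zero_le_power2[of "part.form.nrm n u - part.form.nrm n v"]
    by (simp add: power2_eq_square algebra_simps)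
  finally show ?thesis .
qed

lemma direct_sum_add_closed:
  assumes x: "x \<in> carrier (direct_sum Hs)" and y: "y \<in> carrier (direct_sum Hs)"
  shows "x \<oplus>\<^bsub>direct_sum Hs\<^esub> y \<in> carrier (direct_sum Hs)"
proof -
  have "summable (\<lambda>n. 2 * (part.form.nrm n (x n))\<^sup>2 + 2 * (part.form.nrm n (y n))\<^sup>2)"
    using x y by (intro summable_add summable_mult direct_sum_summable)
  then have "summable (\<lambda>n. (part.form.nrm n (x n \<oplus>\<^bsub>Hs n\<^esub> y n))\<^sup>2)"
    using x y nrm_add_sq_le by (elim summable_comparison_test'[where N = 0]) auto
  then show ?thesis using x y by (intro direct_sum_memI) auto
qed

lemma direct_sum_smult_closed:
  assumes x: "x \<in> carrier (direct_sum Hs)"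
  shows "c \<odot>\<^bsub>direct_sum Hs\<^esub> x \<in> carrier (direct_sum Hs)"
  using x summable_mult[OF direct_sum_summable[OF x], of "(cmod c)\<^sup>2"]
  by (intro direct_sum_memI) (auto simp: part.form.nrm_scale power_mult_distrib)

lemma direct_sum_ip_summable:
  assumes x: "x \<in> carrier (direct_sum Hs)" and y: "y \<in> carrier (direct_sum Hs)"
  shows "summable (\<lambda>n. ip (Hs n) (x n) (y n))"
proof (rule summable_comparison_test'[where N = 0])
  show "summable (\<lambda>n. (part.form.nrm n (x n))\<^sup>2 + (part.form.nrm n (y n))\<^sup>2)"
    using x y by (intro summable_add direct_sum_summable)
  fix n
  have "cmod (ip (Hs n) (x n) (y n)) \<le> part.form.nrm n (x n) * part.form.nrm n (y n)"
    using x y by (intro part.form.Cauchy_Schwarz) auto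
  also have "\<dots> \<le> (part.form.nrm n (x n))\<^sup>2 + (part.form.nrm n (y n))\<^sup>2"
  proof -
    have "a * b \<le> a\<^sup>2 + b\<^sup>2" if "0 \<le> a" "0 \<le> b" for a b :: real
      using sum_squares_bound[of a b] mult_nonneg_nonneg[OF that] by linarith
    then show ?thesis using x y by simp
  qed
  finally show "norm (ip (Hs n) (x n) (y n)) \<le> (part.form.nrm n (x n))\<^sup>2 + (part.form.nrm n (y n))\<^sup>2" .
qed

lemma semi_inner_product_direct_sum:
  "semi_inner_product (carrier (direct_sum Hs)) \<zero>\<^bsub>direct_sum Hs\<^esub> (ring.add (direct_sum Hs))
     (smult (direct_sum Hs)) (ip (direct_sum Hs))"
proof
  show "\<zero>\<^bsub>direct_sum Hs\<^esub> \<in> carrier (direct_sum Hs)"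
    by (intro direct_sum_memI) (auto simp: part.form.nrm_def)
next
  fix x y z c
  assume x: "x \<in> carrier (direct_sum Hs)" and y: "y \<in> carrier (direct_sum Hs)"
    and z: "z \<in> carrier (direct_sum Hs)"
  show "ip (direct_sum Hs) x (y \<oplus>\<^bsub>direct_sum Hs\<^esub> z) = ip (direct_sum Hs) x y + ip (direct_sum Hs) x z"
    using x y z by (simp add: direct_sum_ip suminf_add direct_sum_ip_summable)
next
  fix x y c assume x: "x \<in> carrier (direct_sum Hs)" and y: "y \<in> carrier (direct_sum Hs)"
  show "ip (direct_sum Hs) x (c \<odot>\<^bsub>direct_sum Hs\<^esub> y) = c * ip (direct_sum Hs) x y"
    using x y by (simp add: direct_sum_ip suminf_mult direct_sum_ip_summable)
  have "(\<lambda>n. ip (Hs n) (y n) (x n)) = (\<lambda>n. cnj (ip (Hs n) (x n) (y n)))"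
    using x y by (intro ext part.ip_cnj) auto
  moreover have "(\<lambda>n. cnj (ip (Hs n) (x n) (y n))) sums cnj (\<Sum>n. ip (Hs n) (x n) (y n))"
    using summable_sums[OF direct_sum_ip_summable[OF x y]] by (simp add: sums_cnj)
  ultimately show "ip (direct_sum Hs) y x = cnj (ip (direct_sum Hs) x y)"
    by (simp add: direct_sum_ip sums_iff)
next
  fix x assume x: "x \<in> carrier (direct_sum Hs)"
  show "ip (direct_sum Hs) x \<zero>\<^bsub>direct_sum Hs\<^esub> = 0" using x by (simp add: direct_sum_ip)
  have "ip (direct_sum Hs) x x = (\<Sum>n. complex_of_real ((part.form.nrm n (x n))\<^sup>2))"
    unfolding direct_sum_ip using x by (intro suminf_cong part.form.form_self) simp
  also have "\<dots> = of_real (\<Sum>n. (part.form.nrm n (x n))\<^sup>2)"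
    by (rule suminf_of_real[OF direct_sum_summable[OF x], symmetric])
  moreover have "0 \<le> (\<Sum>n. (part.form.nrm n (x n))\<^sup>2)"
    by (rule suminf_nonneg[OF direct_sum_summable[OF x]]) simp
  ultimately show "ip (direct_sum Hs) x x \<in> \<real>\<^sub>\<ge>\<^sub>0" by (simp add: complex_nonneg_Reals_iff)
qed (auto intro: direct_sum_add_closed direct_sum_smult_closed)

interpretation sum: semi_inner_product "carrier (direct_sum Hs)" "\<zero>\<^bsub>direct_sum Hs\<^esub>"
  "ring.add (direct_sum Hs)" "smult (direct_sum Hs)" "ip (direct_sum Hs)"
  by (rule semi_inner_product_direct_sum)

lemma direct_sum_nrm_sq:
  assumes x: "x \<in> carrier (direct_sum Hs)"
  shows "(sum.nrm x)\<^sup>2 = (\<Sum>n. (part.form.nrm n (x n))\<^sup>2)"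
proof -
  have "(sum.nrm x)\<^sup>2 = Re (\<Sum>n. complex_of_real ((part.form.nrm n (x n))\<^sup>2))"
    unfolding sum.nrm_sq[OF x] direct_sum_ip using x
    by (intro arg_cong[where f = Re] suminf_cong part.form.form_self) simp
  then show ?thesis by (simp only: suminf_of_real[OF direct_sum_summable[OF x], symmetric] Re_complex_of_real)
qed

lemma direct_sum_dst:
  assumes x: "x \<in> carrier (direct_sum Hs)" and y: "y \<in> carrier (direct_sum Hs)"
  shows "summable (\<lambda>n. (part.form.dst n (x n) (y n))\<^sup>2)"
    and "(sum.dst x y)\<^sup>2 = (\<Sum>n. (part.form.dst n (x n) (y n))\<^sup>2)"
proof -
  have d: "x \<oplus>\<^bsub>direct_sum Hs\<^esub> (- 1) \<odot>\<^bsub>direct_sum Hs\<^esub> y \<in> carrier (direct_sum Hs)"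
    using x y by simp
  show "summable (\<lambda>n. (part.form.dst n (x n) (y n))\<^sup>2)"
    using direct_sum_summable[OF d] by (simp add: part.form.dst_def)
  show "(sum.dst x y)\<^sup>2 = (\<Sum>n. (part.form.dst n (x n) (y n))\<^sup>2)"
    using direct_sum_nrm_sq[OF d] by (simp add: part.form.dst_def sum.dst_def)
qed

lemma direct_sum_partial_dst:
  assumes "x \<in> carrier (direct_sum Hs)" "y \<in> carrier (direct_sum Hs)"
  shows "(\<Sum>n<M. (part.form.dst n (x n) (y n))\<^sup>2) \<le> (sum.dst x y)\<^sup>2"
  unfolding direct_sum_dst(2)[OF assms] by (rule sum_le_suminf[OF direct_sum_dst(1)[OF assms]]) auto

lemma direct_sum_component_dst:
  assumes x: "x \<in> carrier (direct_sum Hs)" and y: "y \<in> carrier (direct_sum Hs)"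
  shows "part.form.dst n (x n) (y n) \<le> sum.dst x y"
proof (rule power2_le_imp_le)
  have "(part.form.dst n (x n) (y n))\<^sup>2 \<le> (\<Sum>k<Suc n. (part.form.dst k (x k) (y k))\<^sup>2)"
    by (simp add: sum_nonneg)
  then show "(part.form.dst n (x n) (y n))\<^sup>2 \<le> (sum.dst x y)\<^sup>2"
    using direct_sum_partial_dst[OF x y, of "Suc n"] by linarith
qed (use x y in simp)

text \<open>
  A Cauchy sequence converges in each coordinate. The Cauchy condition bounds the distance to the
  coordinatewise limit on finitely many coordinates, uniformly in their number; this gives both that
  the limit is square summable and that it is the limit in norm.
\<close>

lemma hilbert_space_direct_sum: "hilbert_space (direct_sum Hs)"
proof (rule hilbert_spaceI[OF semi_inner_product_direct_sum])
  fix x y assume x: "x \<in> carrier (direct_sum Hs)" and y: "y \<in> carrier (direct_sum Hs)"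
    and "\<And>w. w \<in> carrier (direct_sum Hs) \<Longrightarrow> ip (direct_sum Hs) w x = ip (direct_sum Hs) w y"
  then have "sum.dst x y = 0" by (rule sum.dst_eq_0I)
  then have "part.form.dst n (x n) (y n) = 0" for n
  proof -
    have "0 \<le> part.form.dst n (x n) (y n)" using x y by simp
    then show ?thesis
      using direct_sum_component_dst[OF x y, of n] \<open>sum.dst x y = 0\<close> by linarith
  qed
  then show "x = y" using x y by (intro ext part.vec_eqI_dst) auto
next
  fix X :: "nat \<Rightarrow> nat \<Rightarrow> 'v"
  assume X: "\<And>k. X k \<in> carrier (direct_sum Hs)"
    and cau: "\<And>e. e > 0 \<Longrightarrow> \<exists>N::nat. \<forall>k\<ge>N. \<forall>l\<ge>N. sum.dst (X k) (X l) < e"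
  have "\<exists>v\<in>carrier (Hs n). (\<lambda>k. part.form.dst n (X k n) v) \<longlonglongrightarrow> 0" for n
  proof (rule part.complete_dst)
    fix e :: real assume "e > 0"
    then obtain N where "\<forall>k\<ge>N. \<forall>l\<ge>N. sum.dst (X k) (X l) < e" using cau by blast
    then show "\<exists>N. \<forall>k\<ge>N. \<forall>l\<ge>N. part.form.dst n (X k n) (X l n) < e"
      using direct_sum_component_dst[OF X X] le_less_trans by blast
  qed (use X in simp)
  then obtain x where x: "\<And>n. x n \<in> carrier (Hs n)"
    "\<And>n. (\<lambda>k. part.form.dst n (X k n) (x n)) \<longlonglongrightarrow> 0" by metis
  \<comment> \<open>The bound on finitely many coordinates survives the limit in the second index.\<close>
  have part_bound: "(\<Sum>n<M. (part.form.dst n (X k n) (x n))\<^sup>2) \<le> e\<^sup>2"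
    if "e > 0" "\<forall>k\<ge>N. \<forall>l\<ge>N. sum.dst (X k) (X l) < e" "k \<ge> N" for e N k M
  proof (rule LIMSEQ_le_const2)
    have "(\<lambda>l. part.form.dst n (X k n) (X l n)) \<longlonglongrightarrow> part.form.dst n (X k n) (x n)" for n
    proof (rule metric_tendsto_imp_tendsto[OF x(2)])
      have "\<bar>part.form.dst n (X k n) (X l n) - part.form.dst n (X k n) (x n)\<bar>
          \<le> part.form.dst n (X l n) (x n)" for l
        using part.form.dst_triangle[of "X k n" n "X l n" "x n"]
          part.form.dst_triangle[of "X k n" n "x n" "X l n"]
          part.form.dst_commute[of "x n" n "X l n"] X x(1) by simp
      then show "\<forall>\<^sub>F l in sequentially.
          dist (part.form.dst n (X k n) (X l n)) (part.form.dst n (X k n) (x n))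
          \<le> dist (part.form.dst n (X l n) (x n)) 0"
        by (intro always_eventually allI) (simp add: dist_norm order_trans[OF _ abs_ge_self])
    qed
    then show "(\<lambda>l. \<Sum>n<M. (part.form.dst n (X k n) (X l n))\<^sup>2)
        \<longlonglongrightarrow> (\<Sum>n<M. (part.form.dst n (X k n) (x n))\<^sup>2)"
      by (intro tendsto_intros)
    have "(\<Sum>n<M. (part.form.dst n (X k n) (X l n))\<^sup>2) \<le> e\<^sup>2" if "l \<ge> N" for l
    proof -
      have "sum.dst (X k) (X l) \<le> e" using \<open>k \<ge> N\<close> that \<open>\<forall>k\<ge>N. \<forall>l\<ge>N. _\<close> less_imp_le by blast
      then have "(sum.dst (X k) (X l))\<^sup>2 \<le> e\<^sup>2" using X by (intro power_mono) auto
      then show ?thesis using direct_sum_partial_dst[OF X X] order_trans by blast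
    qed
    then show "\<exists>N. \<forall>l\<ge>N. (\<Sum>n<M. (part.form.dst n (X k n) (X l n))\<^sup>2) \<le> e\<^sup>2" by blast
  qed
  have dst_summable: "summable (\<lambda>n. (part.form.dst n (X k n) (x n))\<^sup>2)"
    and dst_bound: "(\<Sum>n. (part.form.dst n (X k n) (x n))\<^sup>2) \<le> e\<^sup>2"
    if "e > 0" "\<forall>k\<ge>N. \<forall>l\<ge>N. sum.dst (X k) (X l) < e" "k \<ge> N" for e N k
  proof -
    show s: "summable (\<lambda>n. (part.form.dst n (X k n) (x n))\<^sup>2)"
      by (rule summableI_nonneg_bounded[OF _ part_bound[OF that]]) simp
    show "(\<Sum>n. (part.form.dst n (X k n) (x n))\<^sup>2) \<le> e\<^sup>2"
      by (rule suminf_le_const[OF s part_bound[OF that]])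
  qed
  have x_mem: "x \<in> carrier (direct_sum Hs)"
  proof -
    obtain N where N: "\<forall>k\<ge>N. \<forall>l\<ge>N. sum.dst (X k) (X l) < 1" using cau[of 1] by auto
    have "summable (\<lambda>n. 2 * (part.form.dst n (X N n) (x n))\<^sup>2 + 2 * (part.form.nrm n (X N n))\<^sup>2)"
      using dst_summable[OF _ N order_refl] direct_sum_summable[OF X, of N]
      by (intro summable_add summable_mult) auto
    moreover have "(part.form.nrm n (x n))\<^sup>2
        \<le> 2 * (part.form.dst n (X N n) (x n))\<^sup>2 + 2 * (part.form.nrm n (X N n))\<^sup>2" for n
    proof -
      have "part.form.nrm n (x n) \<le> part.form.dst n (X N n) (x n) + part.form.nrm n (X N n)"
        using part.form.nrm_diff_le[of "X N n" n "x n"] x(1)[of n] X[of N] by simp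
      then have "(part.form.nrm n (x n))\<^sup>2
          \<le> (part.form.dst n (X N n) (x n) + part.form.nrm n (X N n))\<^sup>2"
        using x(1) by (intro power_mono) auto
      also have "\<dots> \<le> 2 * (part.form.dst n (X N n) (x n))\<^sup>2 + 2 * (part.form.nrm n (X N n))\<^sup>2"
        using zero_le_power2[of "part.form.dst n (X N n) (x n) - part.form.nrm n (X N n)"]
        by (simp add: power2_eq_square algebra_simps)
      finally show ?thesis .
    qed
    ultimately have "summable (\<lambda>n. (part.form.nrm n (x n))\<^sup>2)"
      by (elim summable_comparison_test'[where N = 0]) auto
    then show ?thesis using x(1) by (intro direct_sum_memI)
  qed
  have "(\<lambda>k. sum.dst (X k) x) \<longlonglongrightarrow> 0"
  proof (rule LIMSEQ_I)
    fix e :: real assume e: "e > 0"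
    obtain N where N: "\<forall>k\<ge>N. \<forall>l\<ge>N. sum.dst (X k) (X l) < e / 2" using cau[of "e / 2"] e by auto
    have "norm (sum.dst (X k) x - 0) < e" if "k \<ge> N" for k
    proof -
      have "(sum.dst (X k) x)\<^sup>2 \<le> (e / 2)\<^sup>2"
        unfolding direct_sum_dst(2)[OF X x_mem] by (rule dst_bound[OF _ N that]) (use e in simp)
      then have "sum.dst (X k) x \<le> e / 2" by (rule power2_le_imp_le) (use e in simp)
      moreover have "0 \<le> sum.dst (X k) x" using X x_mem by (rule sum.dst_nonneg)
      ultimately show ?thesis using e by simp
    qed
    then show "\<exists>N. \<forall>k\<ge>N. norm (sum.dst (X k) x - 0) < e" by blast
  qed
  then show "\<exists>x\<in>carrier (direct_sum Hs). (\<lambda>k. sum.dst (X k) x) \<longlonglongrightarrow> 0" using x_mem by blast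
qed

definition single :: "nat \<Rightarrow> 'v \<Rightarrow> nat \<Rightarrow> 'v" where
  "single n v = (\<lambda>k. if k = n then v else \<zero>\<^bsub>Hs k\<^esub>)"

lemma single_closed: "v \<in> carrier (Hs n) \<Longrightarrow> single n v \<in> carrier (direct_sum Hs)"
proof -
  assume v: "v \<in> carrier (Hs n)"
  have "summable (\<lambda>k. (part.form.nrm k (single n v k))\<^sup>2)"
    by (rule summable_finite[of "{n}"]) (auto simp: single_def part.form.nrm_def)
  then show ?thesis using v by (intro direct_sum_memI) (auto simp: single_def)
qed

end

lemma transport_space_simps:
  assumes inj: "inj_on f (carrier S)"
  shows "carrier (transport_space f S) = f ` carrier S"
    and "\<zero>\<^bsub>transport_space f S\<^esub> = f \<zero>\<^bsub>S\<^esub>"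
    and "x \<in> carrier S \<Longrightarrow> y \<in> carrier S \<Longrightarrow> f x \<oplus>\<^bsub>transport_space f S\<^esub> f y = f (x \<oplus>\<^bsub>S\<^esub> y)"
    and "x \<in> carrier S \<Longrightarrow> c \<odot>\<^bsub>transport_space f S\<^esub> f x = f (c \<odot>\<^bsub>S\<^esub> x)"
    and "x \<in> carrier S \<Longrightarrow> y \<in> carrier S \<Longrightarrow> ip (transport_space f S) (f x) (f y) = ip S x y"
    and "x \<in> carrier S \<Longrightarrow> vnorm (transport_space f S) (f x) = vnorm S x"
    and "x \<in> carrier S \<Longrightarrow> transport_op f S T (f x) = f (T x)"
  using inj by (simp_all add: transport_space_def vnorm_def transport_op_def Let_def)

lemma hilbert_space_transport:
  assumes "hilbert_space S" and inj: "inj_on f (carrier S)"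
  shows "hilbert_space (transport_space f S)"
proof -
  interpret S: hilbert_space S by fact
  note t = transport_space_simps[OF inj]
  have semi: "semi_inner_product (carrier (transport_space f S)) \<zero>\<^bsub>transport_space f S\<^esub>
      (ring.add (transport_space f S)) (smult (transport_space f S)) (ip (transport_space f S))"
    by standard
      (auto simp: t S.ip_add_right S.ip_smult_right S.form.form_nonneg simp flip: S.ip_cnj)
  interpret T: semi_inner_product "carrier (transport_space f S)" "\<zero>\<^bsub>transport_space f S\<^esub>"
    "ring.add (transport_space f S)" "smult (transport_space f S)" "ip (transport_space f S)"
    by (rule semi)
  have dst: "T.dst (f x) (f y) = S.form.dst x y" if "x \<in> carrier S" "y \<in> carrier S" for x y
    using that by (simp add: T.dst_def S.form.dst_def T.nrm_def S.form.nrm_def t)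
  show ?thesis
  proof (rule hilbert_spaceI[OF semi])
    fix x y
    assume "x \<in> carrier (transport_space f S)" "y \<in> carrier (transport_space f S)"
      and eq: "\<And>w. w \<in> carrier (transport_space f S)
        \<Longrightarrow> ip (transport_space f S) w x = ip (transport_space f S) w y"
    then obtain x' y' where xy: "x = f x'" "y = f y'" and c: "x' \<in> carrier S" "y' \<in> carrier S"
      by (auto simp: t)
    have "x' = y'"
    proof (rule S.vec_eqI[OF c])
      fix w assume w: "w \<in> carrier S"
      then have "ip (transport_space f S) (f w) (f x') = ip (transport_space f S) (f w) (f y')"
        using eq[of "f w"] by (simp add: t(1) xy)
      then show "ip S w x' = ip S w y'" using w c by (simp add: t(5))
    qed
    then show "x = y" by (simp add: xy)
  next
    fix X :: "nat \<Rightarrow> _"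
    assume X: "\<And>n. X n \<in> carrier (transport_space f S)"
      and cau: "\<And>e. e > 0 \<Longrightarrow> \<exists>N::nat. \<forall>m\<ge>N. \<forall>n\<ge>N. T.dst (X m) (X n) < e"
    have "\<forall>n. \<exists>y. y \<in> carrier S \<and> X n = f y" using X unfolding t(1) by blast
    then obtain Y where Y: "\<And>n. Y n \<in> carrier S" "\<And>n. X n = f (Y n)" by metis
    have "\<exists>y\<in>carrier S. (\<lambda>n. S.form.dst (Y n) y) \<longlonglongrightarrow> 0"
    proof (rule S.complete_dst[OF Y(1)])
      fix e :: real assume "e > 0"
      from cau[OF this] show "\<exists>N. \<forall>m\<ge>N. \<forall>n\<ge>N. S.form.dst (Y m) (Y n) < e"
        unfolding Y(2) dst[OF Y(1) Y(1)] .
    qed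
    then obtain y where y: "y \<in> carrier S" "(\<lambda>n. S.form.dst (Y n) y) \<longlonglongrightarrow> 0" by blast
    have "(\<lambda>n. T.dst (X n) (f y)) \<longlonglongrightarrow> 0"
      unfolding Y(2) dst[OF Y(1) y(1)] by (rule y(2))
    then show "\<exists>x\<in>carrier (transport_space f S). (\<lambda>n. T.dst (X n) x) \<longlonglongrightarrow> 0"
      using y(1) t(1) by blast
  qed
qed

section \<open>Completely positive maps\<close>

lemma sum_list_swap:
  fixes f :: "'a \<Rightarrow> 'b \<Rightarrow> 'c::comm_monoid_add"
  shows "(\<Sum>x\<leftarrow>xs. \<Sum>y\<leftarrow>ys. f x y) = (\<Sum>y\<leftarrow>ys. \<Sum>x\<leftarrow>xs. f x y)"
  by (induction xs) (simp_all add: sum_list_addf)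

lemma cnj_sum_list: "cnj (\<Sum>x\<leftarrow>xs. f x) = (\<Sum>x\<leftarrow>xs. cnj (f x))"
  by (induction xs) simp_all

lemma sum_list_nth: "(\<Sum>x\<leftarrow>xs. f x) = (\<Sum>k<length xs. f (xs ! k))"
  by (simp add: sum_list_sum_nth atLeast0LessThan)

lemma LIMSEQ_nonneg_Reals:
  assumes lim: "X \<longlonglongrightarrow> (z :: complex)" and nn: "\<And>n. X n \<in> \<real>\<^sub>\<ge>\<^sub>0"
  shows "z \<in> \<real>\<^sub>\<ge>\<^sub>0"
proof -
  have "0 \<le> Re (X n)" "Im (X n) = 0" for n using nn[of n] by (auto simp: complex_nonneg_Reals_iff)
  then have "0 \<le> Re z" "Im z = 0"
    using LIMSEQ_le_const[OF tendsto_Re[OF lim]] LIMSEQ_unique[OF tendsto_Im[OF lim]] by auto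
  then show ?thesis by (simp add: complex_nonneg_Reals_iff)
qed

text \<open>
  A finite sum of vectors is used only through inner products, with the sum itself on the left and
  with its images under operators on the right.
\<close>

lemma (in hilbert_space) finite_sum_vector:
  assumes "finite I" "\<And>i. i \<in> I \<Longrightarrow> x i \<in> carrier H"
  shows "\<exists>w\<in>carrier H.
      (\<forall>T\<in>bounded_ops H H. \<forall>y\<in>carrier H. ip H y (T w) = (\<Sum>i\<in>I. ip H y (T (x i))))
    \<and> (\<forall>y\<in>carrier H. ip H w y = (\<Sum>i\<in>I. ip H (x i) y))"
  using assms
proof (induction I)
  case empty
  have "ip H y (T \<zero>\<^bsub>H\<^esub>) = 0" if T: "T \<in> bounded_ops H H" and y: "y \<in> carrier H" for T y
  proof -
    have "T \<zero>\<^bsub>H\<^esub> = 0 \<odot>\<^bsub>H\<^esub> T \<zero>\<^bsub>H\<^esub>"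
      using bounded_ops_smult[OF T, of "\<zero>\<^bsub>H\<^esub>" 0] by (simp add: vec_zero_smult[symmetric])
    also have "ip H y \<dots> = 0"
      using y bounded_ops_closed[OF T] by (subst ip_smult_right) auto
    finally show ?thesis .
  qed
  then show ?case by (intro bexI[of _ "\<zero>\<^bsub>H\<^esub>"]) auto
next
  case (insert i I)
  then obtain w where w: "w \<in> carrier H"
    "\<And>T y. T \<in> bounded_ops H H \<Longrightarrow> y \<in> carrier H \<Longrightarrow> ip H y (T w) = (\<Sum>i\<in>I. ip H y (T (x i)))"
    "\<And>y. y \<in> carrier H \<Longrightarrow> ip H w y = (\<Sum>i\<in>I. ip H (x i) y)" by auto
  have xi: "x i \<in> carrier H" using insert by simp
  have "ip H y (T (x i \<oplus>\<^bsub>H\<^esub> w)) = ip H y (T (x i)) + ip H y (T w)"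
    if "T \<in> bounded_ops H H" "y \<in> carrier H" for T y
    using that xi w(1) bounded_opsD[OF that(1)] by (simp add: ip_add_right)
  then show ?case
    using insert.hyps xi w by (intro bexI[of _ "x i \<oplus>\<^bsub>H\<^esub> w"]) auto
qed

locale concrete_cstar = hilbert_space H for H :: "'h ip_space" (structure) +
  fixes A :: "('h \<Rightarrow> 'h) set"
  assumes cstar: "concrete_cstar_algebra H A"
begin

lemma A_bounded: "a \<in> A \<Longrightarrow> a \<in> bounded_ops H H"
  using cstar by (auto simp: concrete_cstar_algebra_def)

lemma A_apply [simp]: "a \<in> A \<Longrightarrow> x \<in> carrier H \<Longrightarrow> a x \<in> carrier H"
  using A_bounded bounded_ops_closed by metis

lemma A_ops [simp]:
  "op_one H \<in> A"
  "a \<in> A \<Longrightarrow> b \<in> A \<Longrightarrow> op_add H a b \<in> A"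
  "a \<in> A \<Longrightarrow> b \<in> A \<Longrightarrow> op_mult H a b \<in> A"
  "a \<in> A \<Longrightarrow> op_smult H c a \<in> A"
  "a \<in> A \<Longrightarrow> adj H a \<in> A"
  using cstar by (auto simp: concrete_cstar_algebra_def)

lemma op_apply [simp]:
  "x \<in> carrier H \<Longrightarrow> op_mult H a b x = a (b x)"
  "x \<in> carrier H \<Longrightarrow> op_add H a b x = a x \<oplus>\<^bsub>H\<^esub> b x"
  "x \<in> carrier H \<Longrightarrow> op_smult H c a x = c \<odot>\<^bsub>H\<^esub> a x"
  by (simp_all add: compose_def op_add_def op_smult_def)

lemma A_eqI: "a \<in> A \<Longrightarrow> b \<in> A \<Longrightarrow> (\<And>x. x \<in> carrier H \<Longrightarrow> a x = b x) \<Longrightarrow> a = b"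
  using A_bounded by (intro bounded_ops_eqI)

lemma A_adj:
  "a \<in> A \<Longrightarrow> x \<in> carrier H \<Longrightarrow> y \<in> carrier H \<Longrightarrow> ip H (adj H a x) y = ip H x (a y)"
  "a \<in> A \<Longrightarrow> x \<in> carrier H \<Longrightarrow> y \<in> carrier H \<Longrightarrow> ip H x (adj H a y) = ip H (a x) y"
  using A_bounded ip_adj_left ip_adj_right by auto

lemma A_assoc: "a \<in> A \<Longrightarrow> b \<in> A \<Longrightarrow> c \<in> A \<Longrightarrow> op_mult H (op_mult H a b) c = op_mult H a (op_mult H b c)"
  by (rule A_eqI) auto

lemma A_one [simp]: "a \<in> A \<Longrightarrow> op_mult H (op_one H) a = a" "a \<in> A \<Longrightarrow> op_mult H a (op_one H) = a"
  by (auto intro: A_eqI)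

lemma A_vec:
  "a \<in> A \<Longrightarrow> x \<in> carrier H \<Longrightarrow> y \<in> carrier H \<Longrightarrow> a (x \<oplus>\<^bsub>H\<^esub> y) = a x \<oplus>\<^bsub>H\<^esub> a y"
  "a \<in> A \<Longrightarrow> x \<in> carrier H \<Longrightarrow> a (c \<odot>\<^bsub>H\<^esub> x) = c \<odot>\<^bsub>H\<^esub> a x"
  using A_bounded bounded_ops_add bounded_ops_smult by metis+

lemma A_distrib:
  "a \<in> A \<Longrightarrow> b \<in> A \<Longrightarrow> c \<in> A \<Longrightarrow> op_mult H a (op_add H b c) = op_add H (op_mult H a b) (op_mult H a c)"
  "a \<in> A \<Longrightarrow> b \<in> A \<Longrightarrow> c \<in> A \<Longrightarrow> op_mult H (op_add H a b) c = op_add H (op_mult H a c) (op_mult H b c)"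
  "a \<in> A \<Longrightarrow> b \<in> A \<Longrightarrow> op_mult H a (op_smult H z b) = op_smult H z (op_mult H a b)"
  "a \<in> A \<Longrightarrow> b \<in> A \<Longrightarrow> op_mult H (op_smult H z a) b = op_smult H z (op_mult H a b)"
  by (rule A_eqI; simp add: A_vec)+

lemma adj_adj [simp]: "a \<in> A \<Longrightarrow> adj H (adj H a) = a"
  by (rule adj_eqI) (auto intro: A_bounded simp: A_adj)

lemma adj_one [simp]: "adj H (op_one H) = op_one H"
  by (rule adj_eqI) (auto intro: A_bounded)

lemma adj_mult [simp]: "a \<in> A \<Longrightarrow> b \<in> A \<Longrightarrow> adj H (op_mult H a b) = op_mult H (adj H b) (adj H a)"
  by (rule adj_eqI) (auto intro: A_bounded simp: A_adj)

end

locale unital_cp = H: concrete_cstar H A + K: hilbert_space K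
  for H :: "'h ip_space" and A :: "('h \<Rightarrow> 'h) set" and K :: "'k ip_space" +
  fixes \<Psi> :: "('h \<Rightarrow> 'h) \<Rightarrow> 'k \<Rightarrow> 'k"
  assumes cp: "completely_positive H A K \<Psi>"
    and unital: "\<Psi> (op_one H) = op_one K"
begin

lemma map_bounded: "a \<in> A \<Longrightarrow> \<Psi> a \<in> bounded_ops K K"
  using cp by (auto simp: completely_positive_def linear_to_ops_def)

lemma map_closed [simp]: "a \<in> A \<Longrightarrow> x \<in> carrier K \<Longrightarrow> \<Psi> a x \<in> carrier K"
  using map_bounded bounded_ops_closed by metis

lemma map_vec [simp]:
  "a \<in> A \<Longrightarrow> x \<in> carrier K \<Longrightarrow> y \<in> carrier K \<Longrightarrow> \<Psi> a (x \<oplus>\<^bsub>K\<^esub> y) = \<Psi> a x \<oplus>\<^bsub>K\<^esub> \<Psi> a y"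
  "a \<in> A \<Longrightarrow> x \<in> carrier K \<Longrightarrow> \<Psi> a (c \<odot>\<^bsub>K\<^esub> x) = c \<odot>\<^bsub>K\<^esub> \<Psi> a x"
  using map_bounded bounded_ops_add bounded_ops_smult by metis+

lemma map_op [simp]:
  "a \<in> A \<Longrightarrow> b \<in> A \<Longrightarrow> x \<in> carrier K \<Longrightarrow> \<Psi> (op_add H a b) x = \<Psi> a x \<oplus>\<^bsub>K\<^esub> \<Psi> b x"
  "a \<in> A \<Longrightarrow> x \<in> carrier K \<Longrightarrow> \<Psi> (op_smult H c a) x = c \<odot>\<^bsub>K\<^esub> \<Psi> a x"
  using cp by (simp_all add: completely_positive_def linear_to_ops_def op_add_def op_smult_def)

lemma map_one [simp]: "x \<in> carrier K \<Longrightarrow> \<Psi> (op_one H) x = x"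
  by (simp add: unital)

lemma map_positive:
  "(\<And>i j. i < n \<Longrightarrow> j < n \<Longrightarrow> T i j \<in> A) \<Longrightarrow> mat_positive H n T \<Longrightarrow> mat_positive K n (\<lambda>i j. \<Psi> (T i j))"
  using cp by (simp add: completely_positive_def)

text \<open>
  The matrix with rows \<open>(M, a)\<close> and \<open>(a\<^sup>*, M)\<close> is positive once \<open>M\<close> bounds \<open>a\<close>. That the quadratic
  form of its image is real, at \<open>(x, y)\<close> and at \<open>(x, \<i> y)\<close>, says that \<open>\<Psi>\<close> preserves adjoints.
\<close>

lemma map_adj:
  assumes a: "a \<in> A" and x: "x \<in> carrier K" and y: "y \<in> carrier K"
  shows "ip K y (\<Psi> (adj H a) x) = ip K (\<Psi> a y) x"
proof -
  obtain M where M: "0 \<le> M" "\<And>x. x \<in> carrier H \<Longrightarrow> H.form.nrm (a x) \<le> M * H.form.nrm x"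
    using H.bounded_ops_bound[OF H.A_bounded[OF a]] by (metis H.vnorm_eq_nrm)
  define T where "T i j = (if i = j then op_smult H (of_real M) (op_one H)
      else if i = (0::nat) then a else adj H a)" for i j :: nat
  have T: "T i j \<in> A" for i j using a by (simp add: T_def)
  have two: "{..<2::nat} = {0, Suc 0}" by auto
  have "mat_positive H 2 T"
    unfolding mat_positive_def
  proof (intro allI impI)
    fix \<xi> :: "nat \<Rightarrow> 'h" assume "\<forall>i<2. \<xi> i \<in> carrier H"
    then have c: "\<xi> 0 \<in> carrier H" "\<xi> (Suc 0) \<in> carrier H" by auto
    define z where "z = ip H (\<xi> 0) (a (\<xi> (Suc 0)))"
    define p q where "p = H.form.nrm (\<xi> 0)" and "q = H.form.nrm (\<xi> (Suc 0))"
    have "cmod z \<le> p * H.form.nrm (a (\<xi> (Suc 0)))"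
      unfolding z_def p_def using a c by (intro H.form.Cauchy_Schwarz) auto
    also have "\<dots> \<le> p * (M * q)"
      unfolding p_def q_def using M c by (intro mult_left_mono) auto
    finally have "- Re z \<le> M * (p * q)"
      using abs_Re_le_cmod[of z] by (simp add: mult.left_commute)
    moreover have "0 \<le> M * (p - q)\<^sup>2" using M by simp
    ultimately have "0 \<le> M * p\<^sup>2 + M * q\<^sup>2 + 2 * Re z"
      by (simp add: power2_diff algebra_simps)
    moreover have "ip H (\<xi> (Suc 0)) (adj H a (\<xi> 0)) = cnj z"
      using a c H.ip_cnj[of "\<xi> 0" "a (\<xi> (Suc 0))"] by (simp add: z_def H.A_adj)
    then have "(\<Sum>i<2. \<Sum>j<2. ip H (\<xi> i) (T i j (\<xi> j))) = of_real (M * p\<^sup>2 + M * q\<^sup>2 + 2 * Re z)"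
      using c H.form.form_self[OF c(1)] H.form.form_self[OF c(2)]
      by (simp add: two T_def z_def[symmetric] p_def q_def complex_eq_iff)
    ultimately show "(\<Sum>i<2. \<Sum>j<2. ip H (\<xi> i) (T i j (\<xi> j))) \<in> \<real>\<^sub>\<ge>\<^sub>0"
      by (simp add: complex_nonneg_Reals_iff)
  qed
  with T have pos: "mat_positive K 2 (\<lambda>i j. \<Psi> (T i j))" by (intro map_positive)
  have Im0: "Im (ip K u (\<Psi> a v)) + Im (ip K v (\<Psi> (adj H a) u)) = 0"
    if u: "u \<in> carrier K" and v: "v \<in> carrier K" for u v
  proof -
    have "(\<Sum>i<2. \<Sum>j<2. ip K (if i = 0 then u else v) (\<Psi> (T i j) (if j = 0 then u else v))) \<in> \<real>\<^sub>\<ge>\<^sub>0"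
      using pos[unfolded mat_positive_def, rule_format, of "\<lambda>i. if i = 0 then u else v"] u v by simp
    then have "Im (\<Sum>i<2. \<Sum>j<2. ip K (if i = 0 then u else v) (\<Psi> (T i j) (if j = 0 then u else v))) = 0"
      by (simp add: complex_nonneg_Reals_iff)
    then show ?thesis using u v a by (simp add: two T_def)
  qed
  have "Im (ip K x (\<Psi> a y)) + Im (ip K y (\<Psi> (adj H a) x)) = 0" by (rule Im0[OF x y])
  moreover have "Re (ip K x (\<Psi> a y)) - Re (ip K y (\<Psi> (adj H a) x)) = 0"
    using Im0[OF x, of "\<i> \<odot>\<^bsub>K\<^esub> y"] x y a by simp
  ultimately have "ip K y (\<Psi> (adj H a) x) = cnj (ip K x (\<Psi> a y))"
    by (simp add: complex_eq_iff)
  then show ?thesis using K.ip_cnj[of x "\<Psi> a y"] x y a by simp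
qed

text \<open>
  The quadratic form at \<open>\<xi>\<close> of the matrix of the \<open>b\<^sub>k\<^sup>* (T (i\<^sub>k) (i\<^sub>l)) b\<^sub>l\<close> is that of \<open>T\<close> at the vectors
  \<open>\<Sum> {b\<^sub>k \<xi>\<^sub>k | i\<^sub>k = i}\<close>. The instance \<open>T = 1\<close> makes the form on tensors positive, \<open>T = C\<^sup>2 - a\<^sup>* a\<close>
  bounds left multiplication by \<open>a\<close>, and a general \<open>T\<close> makes the dilated representation completely
  positive.
\<close>

lemma conjugated_positive:
  assumes T: "\<And>i j. i < m \<Longrightarrow> j < m \<Longrightarrow> T i j \<in> A" and pos: "mat_positive H m T"
    and w: "\<And>i b \<eta>. (i, b, \<eta>) \<in> set w \<Longrightarrow> i < m \<and> b \<in> A \<and> \<eta> \<in> carrier K"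
  shows "(\<Sum>(i, b, \<eta>)\<leftarrow>w. \<Sum>(j, c, \<zeta>)\<leftarrow>w. ip K \<eta> (\<Psi> (op_mult H (adj H b) (op_mult H (T i j) c)) \<zeta>)) \<in> \<real>\<^sub>\<ge>\<^sub>0"
proof -
  define n where "n = length w"
  define idx where "idx k = fst (w ! k)" for k
  define b where "b k = fst (snd (w ! k))" for k
  define \<eta> where "\<eta> k = snd (snd (w ! k))" for k
  have wk: "idx k < m" "b k \<in> A" "\<eta> k \<in> carrier K" if "k < n" for k
    using w[of "idx k" "b k" "\<eta> k"] that by (auto simp: n_def idx_def b_def \<eta>_def)
  define S where "S k l = op_mult H (adj H (b k)) (op_mult H (T (idx k) (idx l)) (b l))" for k l
  have S: "S k l \<in> A" if "k < n" "l < n" for k l using that wk T by (simp add: S_def)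
  have "mat_positive H n S"
    unfolding mat_positive_def
  proof (intro allI impI)
    fix \<xi> :: "nat \<Rightarrow> 'h" assume \<xi>: "\<forall>k<n. \<xi> k \<in> carrier H"
    define v where "v k = b k (\<xi> k)" for k
    have v: "v k \<in> carrier H" if "k < n" for k using that \<xi> wk by (simp add: v_def)
    define G where "G k l = ip H (v k) (T (idx k) (idx l) (v l))" for k l
    define I where "I i = {k \<in> {..<n}. idx k = i}" for i
    have "\<forall>i. \<exists>u\<in>carrier H.
        (\<forall>R\<in>bounded_ops H H. \<forall>y\<in>carrier H. ip H y (R u) = (\<Sum>k\<in>I i. ip H y (R (v k))))
      \<and> (\<forall>y\<in>carrier H. ip H u y = (\<Sum>k\<in>I i. ip H (v k) y))"
      by (intro allI H.finite_sum_vector) (auto simp: I_def v)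
    then obtain u where u: "\<And>i. u i \<in> carrier H"
      "\<And>i R y. R \<in> bounded_ops H H \<Longrightarrow> y \<in> carrier H \<Longrightarrow> ip H y (R (u i)) = (\<Sum>k\<in>I i. ip H y (R (v k)))"
      "\<And>i y. y \<in> carrier H \<Longrightarrow> ip H (u i) y = (\<Sum>k\<in>I i. ip H (v k) y)"
      by metis
    have group: "(\<Sum>i<m. sum h (I i)) = (\<Sum>k<n. h k)" for h :: "nat \<Rightarrow> complex"
      unfolding I_def by (rule sum.group) (auto simp: wk)
    have "(\<Sum>i<m. \<Sum>j<m. ip H (u i) (T i j (u j))) = (\<Sum>i<m. \<Sum>j<m. \<Sum>l\<in>I j. \<Sum>k\<in>I i. G k l)"
    proof (intro sum.cong refl)
      fix i j assume ij: "i \<in> {..<m}" "j \<in> {..<m}"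
      then have Tij: "T i j \<in> A" by (simp add: T)
      have "ip H (u i) (T i j (u j)) = (\<Sum>l\<in>I j. ip H (u i) (T i j (v l)))"
        using u H.A_bounded[OF Tij] by simp
      also have "\<dots> = (\<Sum>l\<in>I j. \<Sum>k\<in>I i. G k l)"
        using Tij v by (intro sum.cong refl) (auto simp: u(3) I_def G_def)
      finally show "ip H (u i) (T i j (u j)) = (\<Sum>l\<in>I j. \<Sum>k\<in>I i. G k l)" .
    qed
    also have "\<dots> = (\<Sum>i<m. \<Sum>l<n. \<Sum>k\<in>I i. G k l)"
      by (simp only: group)
    also have "\<dots> = (\<Sum>l<n. \<Sum>i<m. \<Sum>k\<in>I i. G k l)"
      by (rule sum.swap)
    also have "\<dots> = (\<Sum>l<n. \<Sum>k<n. G k l)"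
      by (simp only: group)
    also have "\<dots> = (\<Sum>k<n. \<Sum>l<n. G k l)"
      by (rule sum.swap)
    also have "\<dots> = (\<Sum>k<n. \<Sum>l<n. ip H (\<xi> k) (S k l (\<xi> l)))"
      using \<xi> wk T by (intro sum.cong refl) (simp add: G_def S_def v_def H.A_adj)
    finally have "(\<Sum>k<n. \<Sum>l<n. ip H (\<xi> k) (S k l (\<xi> l)))
        = (\<Sum>i<m. \<Sum>j<m. ip H (u i) (T i j (u j)))" by (rule sym)
    also have "\<dots> \<in> \<real>\<^sub>\<ge>\<^sub>0"
      using pos[unfolded mat_positive_def, rule_format, of u] u(1) by blast
    finally show "(\<Sum>k<n. \<Sum>l<n. ip H (\<xi> k) (S k l (\<xi> l))) \<in> \<real>\<^sub>\<ge>\<^sub>0" .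
  qed
  with S have "mat_positive K n (\<lambda>k l. \<Psi> (S k l))" by (intro map_positive)
  then have "(\<Sum>k<n. \<Sum>l<n. ip K (\<eta> k) (\<Psi> (S k l) (\<eta> l))) \<in> \<real>\<^sub>\<ge>\<^sub>0"
    using wk(3) by (simp add: mat_positive_def)
  then show ?thesis
    by (simp add: sum_list_nth case_prod_unfold n_def S_def idx_def b_def \<eta>_def)
qed

end

section \<open>The Stinespring dilation\<close>

context unital_cp
begin

abbreviation tensors :: "('h, 'k) tensor set" where
  "tensors \<equiv> lists (A \<times> carrier K)"

text \<open>The inner product of two elementary tensors.\<close>

definition kernel :: "('h \<Rightarrow> 'h) \<times> 'k \<Rightarrow> ('h \<Rightarrow> 'h) \<times> 'k \<Rightarrow> complex" where
  "kernel p q = ip K (snd p) (\<Psi> (op_mult H (adj H (fst p)) (fst q)) (snd q))"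

lemma tensor_ip_kernel: "tensor_ip H K \<Psi> u v = (\<Sum>p\<leftarrow>u. \<Sum>q\<leftarrow>v. kernel p q)"
  by (simp add: tensor_ip_def kernel_def case_prod_unfold)

lemma kernel_cnj:
  assumes p: "p \<in> A \<times> carrier K" and q: "q \<in> A \<times> carrier K"
  shows "kernel q p = cnj (kernel p q)"
proof -
  obtain a x b y where pq: "p = (a, x)" "q = (b, y)" "a \<in> A" "b \<in> A" "x \<in> carrier K" "y \<in> carrier K"
    using p q by auto
  have "kernel q p = ip K y (\<Psi> (adj H (op_mult H (adj H a) b)) x)"
    using pq by (simp add: kernel_def)
  also have "\<dots> = ip K (\<Psi> (op_mult H (adj H a) b) y) x" using pq by (intro map_adj) auto
  also have "\<dots> = cnj (kernel p q)"
    using pq K.ip_cnj[of x "\<Psi> (op_mult H (adj H a) b) y"] by (simp add: kernel_def)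
  finally show ?thesis .
qed

lemma kernel_smult:
  "p \<in> A \<times> carrier K \<Longrightarrow> b \<in> A \<Longrightarrow> y \<in> carrier K \<Longrightarrow> kernel p (b, c \<odot>\<^bsub>K\<^esub> y) = c * kernel p (b, y)"
  by (cases p) (simp add: kernel_def)

lemma tensor_ip_cnj:
  assumes "u \<in> tensors" "v \<in> tensors"
  shows "tensor_ip H K \<Psi> v u = cnj (tensor_ip H K \<Psi> u v)"
proof -
  have "cnj (tensor_ip H K \<Psi> u v) = (\<Sum>p\<leftarrow>u. \<Sum>q\<leftarrow>v. kernel q p)"
    unfolding tensor_ip_kernel cnj_sum_list
    using assms
    by (intro arg_cong[where f = sum_list] map_cong refl kernel_cnj[symmetric])
      (auto simp: in_lists_conv_set)
  then show ?thesis by (simp add: tensor_ip_kernel sum_list_swap[of _ v])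
qed

lemma tensor_ip_smult:
  assumes "u \<in> tensors" "v \<in> tensors"
  shows "tensor_ip H K \<Psi> u (tensor_smult K c v) = c * tensor_ip H K \<Psi> u v"
proof -
  have "(\<Sum>q\<leftarrow>tensor_smult K c v. kernel p q) = c * (\<Sum>q\<leftarrow>v. kernel p q)" if "p \<in> set u" for p
  proof -
    have "p \<in> A \<times> carrier K" using that assms by (auto simp: in_lists_conv_set)
    then have "(\<Sum>q\<leftarrow>tensor_smult K c v. kernel p q) = (\<Sum>q\<leftarrow>v. c * kernel p q)"
      unfolding tensor_smult_def map_map using assms
      by (intro arg_cong[where f = sum_list] map_cong refl)
        (auto simp: kernel_smult in_lists_conv_set)
    then show ?thesis by (simp add: sum_list_const_mult)
  qed
  then have "tensor_ip H K \<Psi> u (tensor_smult K c v) = (\<Sum>p\<leftarrow>u. c * (\<Sum>q\<leftarrow>v. kernel p q))"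
    unfolding tensor_ip_kernel by (intro arg_cong[where f = sum_list] map_cong refl)
  then show ?thesis by (simp add: sum_list_const_mult tensor_ip_kernel)
qed

lemma mat_positive_one: "mat_positive H 1 (\<lambda>i j. op_one H)"
  by (auto simp: mat_positive_def intro: H.ip_nonneg)

lemma tensor_ip_nonneg:
  assumes "u \<in> tensors"
  shows "tensor_ip H K \<Psi> u u \<in> \<real>\<^sub>\<ge>\<^sub>0"
proof -
  let ?w = "map (\<lambda>(b, \<eta>). (0::nat, b, \<eta>)) u"
  have "(\<Sum>(i, b, \<eta>)\<leftarrow>?w. \<Sum>(j, c, \<zeta>)\<leftarrow>?w.
      ip K \<eta> (\<Psi> (op_mult H (adj H b) (op_mult H (op_one H) c)) \<zeta>)) \<in> \<real>\<^sub>\<ge>\<^sub>0"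
    using assms
    by (intro conjugated_positive[where m = 1 and T = "\<lambda>i j. op_one H"] mat_positive_one)
      (auto simp: in_lists_conv_set)
  also have "(\<Sum>(i, b, \<eta>)\<leftarrow>?w. \<Sum>(j, c, \<zeta>)\<leftarrow>?w.
      ip K \<eta> (\<Psi> (op_mult H (adj H b) (op_mult H (op_one H) c)) \<zeta>)) = tensor_ip H K \<Psi> u u"
    unfolding tensor_ip_kernel map_map using assms
    by (intro arg_cong[where f = sum_list] map_cong refl)
      (auto simp: kernel_def in_lists_conv_set intro!: arg_cong[where f = sum_list] map_cong)
  finally show ?thesis .
qed

sublocale T: semi_inner_product tensors "[]" "(@)" "tensor_smult K" "tensor_ip H K \<Psi>"
proof
  fix u v c assume "u \<in> tensors" "v \<in> tensors"
  then show "tensor_ip H K \<Psi> v u = cnj (tensor_ip H K \<Psi> u v)" by (rule tensor_ip_cnj)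
next
  fix u v c assume "u \<in> tensors" "v \<in> tensors"
  then show "tensor_ip H K \<Psi> u (tensor_smult K c v) = c * tensor_ip H K \<Psi> u v"
    by (rule tensor_ip_smult)
next
  fix u v w assume "u \<in> tensors"
  show "tensor_ip H K \<Psi> u (v @ w) = tensor_ip H K \<Psi> u v + tensor_ip H K \<Psi> u w"
    by (simp add: tensor_ip_kernel sum_list_addf)
next
  fix u c assume "u \<in> tensors"
  then show "tensor_smult K c u \<in> tensors"
    by (auto simp: tensor_smult_def in_lists_conv_set)
next
  fix u assume "u \<in> tensors"
  then show "tensor_ip H K \<Psi> u u \<in> \<real>\<^sub>\<ge>\<^sub>0" by (rule tensor_ip_nonneg)
qed (auto simp: tensor_ip_kernel)

lemma tensor_dist_eq: "tensor_dist H K \<Psi> = T.dst"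
  by (intro ext) (simp add: tensor_dist_def T.dst_def T.nrm_def Let_def)

lemma tensor_cauchy_eq: "tensor_cauchy H A K \<Psi> = T.cauchy"
  by (simp only: tensor_cauchy_def T.cauchy_def tensor_dist_eq)

lemma tensor_rel_eq: "tensor_rel H A K \<Psi> = T.null_rel"
  by (simp only: tensor_rel_def T.null_rel_def tensor_dist_eq tensor_cauchy_eq)

lemma stinespring_space_eq: "stinespring_space H A K \<Psi> = T.completion"
  by (simp only: stinespring_space_def T.completion_def tensor_cauchy_eq tensor_rel_eq)

definition lmul :: "('h \<Rightarrow> 'h) \<Rightarrow> ('h, 'k) tensor \<Rightarrow> ('h, 'k) tensor" where
  "lmul a u = map (\<lambda>(b, \<eta>). (op_mult H a b, \<eta>)) u"

lemma double_sum_cong: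
  assumes "u \<in> lists M" "v \<in> lists N" "\<And>p q. p \<in> M \<Longrightarrow> q \<in> N \<Longrightarrow> f p q = g p q"
  shows "(\<Sum>p\<leftarrow>u. \<Sum>q\<leftarrow>v. f p q) = (\<Sum>p\<leftarrow>u. \<Sum>q\<leftarrow>v. g p q)"
  using assms by (intro arg_cong[where f = sum_list] map_cong refl) (auto simp: in_lists_conv_set)

lemma lmul_closed [simp]: "a \<in> A \<Longrightarrow> u \<in> tensors \<Longrightarrow> lmul a u \<in> tensors"
  by (auto simp: lmul_def in_lists_conv_set)

lemma lmul_append: "lmul a (u @ v) = lmul a u @ lmul a v"
  by (simp add: lmul_def)

lemma lmul_smult: "lmul a (tensor_smult K c u) = tensor_smult K c (lmul a u)"
  by (simp add: lmul_def tensor_smult_def case_prod_unfold)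

lemma lmul_mult:
  "a \<in> A \<Longrightarrow> b \<in> A \<Longrightarrow> u \<in> tensors \<Longrightarrow> lmul (op_mult H a b) u = lmul a (lmul b u)"
  by (auto simp: lmul_def in_lists_conv_set H.A_assoc)

lemma lmul_one: "u \<in> tensors \<Longrightarrow> lmul (op_one H) u = u"
  unfolding lmul_def by (rule map_idI) (auto simp: in_lists_conv_set)

lemma tensor_ip_lmul:
  assumes a: "a \<in> A" and u: "u \<in> tensors" and v: "v \<in> tensors"
  shows "tensor_ip H K \<Psi> (lmul a u) v = tensor_ip H K \<Psi> u (lmul (adj H a) v)"
  unfolding tensor_ip_kernel lmul_def map_map comp_def
  by (rule double_sum_cong[OF u v]) (use a in \<open>auto simp: kernel_def H.A_assoc\<close>)

lemma tensor_ip_lmul_add: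
  assumes a: "a \<in> A" and b: "b \<in> A" and u: "u \<in> tensors" and v: "v \<in> tensors"
  shows "tensor_ip H K \<Psi> u (lmul (op_add H a b) v)
    = tensor_ip H K \<Psi> u (lmul a v) + tensor_ip H K \<Psi> u (lmul b v)"
  unfolding tensor_ip_kernel lmul_def map_map comp_def sum_list_addf[symmetric]
  by (rule double_sum_cong[OF u v]) (use a b in \<open>auto simp: kernel_def H.A_distrib K.ip_add_right\<close>)

lemma tensor_ip_lmul_smult:
  assumes a: "a \<in> A" and u: "u \<in> tensors" and v: "v \<in> tensors"
  shows "tensor_ip H K \<Psi> u (lmul (op_smult H c a) v) = c * tensor_ip H K \<Psi> u (lmul a v)"
  unfolding tensor_ip_kernel lmul_def map_map comp_def sum_list_const_mult[symmetric]
  by (rule double_sum_cong[OF u v]) (use a in \<open>auto simp: kernel_def H.A_distrib K.ip_smult_right\<close>)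

text \<open>
  If \<open>C\<close> bounds \<open>a\<close>, then \<open>C\<^sup>2 - a\<^sup>* a\<close> is positive, and conjugating it by the first factors of the
  tensor shows that left multiplication by \<open>a\<close> is bounded by the same \<open>C\<close>.
\<close>

lemma lmul_bound:
  assumes a: "a \<in> A" and C: "0 \<le> C" "\<And>x. x \<in> carrier H \<Longrightarrow> vnorm H (a x) \<le> C * vnorm H x"
    and u: "u \<in> tensors"
  shows "T.nrm (lmul a u) \<le> C * T.nrm u"
proof -
  define P where "P = op_add H (op_smult H (of_real (C\<^sup>2)) (op_one H))
    (op_smult H (- 1) (op_mult H (adj H a) a))"
  have P: "P \<in> A" using a by (simp add: P_def)
  have "mat_positive H 1 (\<lambda>i j. P)"
    unfolding mat_positive_def
  proof (intro allI impI)
    fix \<xi> :: "nat \<Rightarrow> 'h" assume "\<forall>i<1. \<xi> i \<in> carrier H"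
    then have x: "\<xi> 0 \<in> carrier H" by simp
    have "H.form.nrm (a (\<xi> 0)) \<le> C * H.form.nrm (\<xi> 0)"
      using C(2)[OF x] by (simp add: H.vnorm_eq_nrm)
    then have "(H.form.nrm (a (\<xi> 0)))\<^sup>2 \<le> (C * H.form.nrm (\<xi> 0))\<^sup>2"
      using a x by (intro power_mono) auto
    moreover have "ip H (\<xi> 0) (P (\<xi> 0))
        = of_real (C\<^sup>2) * ip H (\<xi> 0) (\<xi> 0) - ip H (a (\<xi> 0)) (a (\<xi> 0))"
      using a x by (simp add: P_def H.A_adj)
    then have "ip H (\<xi> 0) (P (\<xi> 0))
        = of_real ((C * H.form.nrm (\<xi> 0))\<^sup>2 - (H.form.nrm (a (\<xi> 0)))\<^sup>2)"
      using a x H.form.form_self[of "\<xi> 0"] H.form.form_self[of "a (\<xi> 0)"]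
      by (simp add: power_mult_distrib)
    ultimately have "ip H (\<xi> 0) (P (\<xi> 0)) \<in> \<real>\<^sub>\<ge>\<^sub>0" by (simp add: complex_nonneg_Reals_iff)
    then show "(\<Sum>i<1. \<Sum>j<1. ip H (\<xi> i) (P (\<xi> j))) \<in> \<real>\<^sub>\<ge>\<^sub>0" by simp
  qed
  let ?w = "map (\<lambda>(b, \<eta>). (0::nat, b, \<eta>)) u"
  have "(\<Sum>(i, b, \<eta>)\<leftarrow>?w. \<Sum>(j, c, \<zeta>)\<leftarrow>?w. ip K \<eta> (\<Psi> (op_mult H (adj H b) (op_mult H P c)) \<zeta>)) \<in> \<real>\<^sub>\<ge>\<^sub>0"
    using u P \<open>mat_positive H 1 (\<lambda>i j. P)\<close>
    by (intro conjugated_positive[where m = 1 and T = "\<lambda>i j. P"]) (auto simp: in_lists_conv_set)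
  also have "(\<Sum>(i, b, \<eta>)\<leftarrow>?w. \<Sum>(j, c, \<zeta>)\<leftarrow>?w. ip K \<eta> (\<Psi> (op_mult H (adj H b) (op_mult H P c)) \<zeta>))
      = tensor_ip H K \<Psi> u (lmul P u)"
    by (simp add: tensor_ip_kernel lmul_def kernel_def comp_def case_prod_unfold)
  also have "\<dots> = of_real (C\<^sup>2) * tensor_ip H K \<Psi> u u
      - tensor_ip H K \<Psi> u (lmul (op_mult H (adj H a) a) u)"
    using a u by (simp add: P_def tensor_ip_lmul_add tensor_ip_lmul_smult lmul_one)
  also have "tensor_ip H K \<Psi> u (lmul (op_mult H (adj H a) a) u)
      = tensor_ip H K \<Psi> (lmul a u) (lmul a u)"
    using a u by (simp add: tensor_ip_lmul lmul_mult)
  finally have "Re (tensor_ip H K \<Psi> (lmul a u) (lmul a u)) \<le> C\<^sup>2 * Re (tensor_ip H K \<Psi> u u)"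
    by (simp add: complex_nonneg_Reals_iff)
  then have "(T.nrm (lmul a u))\<^sup>2 \<le> (C * T.nrm u)\<^sup>2"
    using a u by (simp add: T.nrm_sq power_mult_distrib)
  then show ?thesis by (rule power2_le_imp_le) (use C u in simp)
qed

sublocale S: hilbert_space T.completion
  by (rule T.hilbert_space_completion)

definition rep :: "('h \<Rightarrow> 'h) \<Rightarrow> (nat \<Rightarrow> ('h, 'k) tensor) set \<Rightarrow> (nat \<Rightarrow> ('h, 'k) tensor) set" where
  "rep a = T.lift (lmul a)"

lemma rep_cls:
  assumes a: "a \<in> A" and s: "s \<in> T.cauchy"
  shows "(\<lambda>n. lmul a (s n)) \<in> T.cauchy" "rep a (T.cls s) = T.cls (\<lambda>n. lmul a (s n))"
proof -
  obtain C where C: "0 \<le> C" "\<And>x. x \<in> carrier H \<Longrightarrow> vnorm H (a x) \<le> C * vnorm H x"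
    using H.bounded_ops_bound[OF H.A_bounded[OF a]] by metis
  note lift = lmul_closed[OF a] lmul_append lmul_smult lmul_bound[OF a C]
  show "(\<lambda>n. lmul a (s n)) \<in> T.cauchy" by (rule T.lift_cauchy[OF lift s])
  show "rep a (T.cls s) = T.cls (\<lambda>n. lmul a (s n))"
    unfolding rep_def by (rule T.lift_cls[OF lift s])
qed

lemma rep_bounded: "a \<in> A \<Longrightarrow> rep a \<in> bounded_ops T.completion T.completion"
proof -
  assume a: "a \<in> A"
  obtain C where C: "0 \<le> C" "\<And>x. x \<in> carrier H \<Longrightarrow> vnorm H (a x) \<le> C * vnorm H x"
    using H.bounded_ops_bound[OF H.A_bounded[OF a]] by metis
  show ?thesis
    unfolding rep_def
    by (rule T.lift_bounded[OF lmul_closed[OF a] lmul_append lmul_smult lmul_bound[OF a C]])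
qed

lemma rep_norm:
  assumes a: "a \<in> A" and C: "0 \<le> C" "\<And>x. x \<in> carrier H \<Longrightarrow> vnorm H (a x) \<le> C * vnorm H x"
    and X: "X \<in> carrier T.completion"
  shows "vnorm T.completion (rep a X) \<le> C * vnorm T.completion X"
  unfolding rep_def
  by (rule T.lift_bound[OF lmul_closed[OF a] lmul_append lmul_smult lmul_bound[OF a C] X])

definition elem :: "('h \<Rightarrow> 'h) \<Rightarrow> 'k \<Rightarrow> (nat \<Rightarrow> ('h, 'k) tensor) set" where
  "elem a \<xi> = T.cls (\<lambda>n. [(a, \<xi>)])"

lemma stinespring_tensor_eq: "stinespring_tensor H A K \<Psi> = elem"
  by (intro ext) (simp only: stinespring_tensor_def elem_def tensor_rel_eq)

lemma elem_closed [simp]: "a \<in> A \<Longrightarrow> \<xi> \<in> carrier K \<Longrightarrow> elem a \<xi> \<in> carrier T.completion"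
  unfolding elem_def by (rule T.cls_closed) simp

lemma rep_elem: "a \<in> A \<Longrightarrow> b \<in> A \<Longrightarrow> \<xi> \<in> carrier K \<Longrightarrow> rep a (elem b \<xi>) = elem (op_mult H a b) \<xi>"
  unfolding elem_def by (subst rep_cls(2)) (simp_all add: lmul_def)

lemma ip_elem:
  "a \<in> A \<Longrightarrow> b \<in> A \<Longrightarrow> \<xi> \<in> carrier K \<Longrightarrow> \<eta> \<in> carrier K
    \<Longrightarrow> ip T.completion (elem a \<xi>) (elem b \<eta>) = ip K \<xi> (\<Psi> (op_mult H (adj H a) b) \<eta>)"
  unfolding elem_def by (subst T.ip_completion_const) (simp_all add: tensor_ip_kernel kernel_def)

text \<open>The elementary tensors span the dense subspace of classes of constant sequences.\<close>

lemma elem_ops_eqI: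
  assumes R: "R \<in> bounded_ops T.completion T.completion" and S: "S \<in> bounded_ops T.completion T.completion"
    and eq: "\<And>b \<xi>. b \<in> A \<Longrightarrow> \<xi> \<in> carrier K \<Longrightarrow> R (elem b \<xi>) = S (elem b \<xi>)"
  shows "R = S"
proof (rule T.completion_ops_eqI[OF R S])
  fix u assume "u \<in> tensors"
  then show "R (T.cls (\<lambda>n. u)) = S (T.cls (\<lambda>n. u))"
  proof (induction u)
    case Nil
    have Q: "Q (T.cls (\<lambda>n. [])) = \<zero>\<^bsub>T.completion\<^esub>"
      if "Q \<in> bounded_ops T.completion T.completion" for Q
    proof -
      define z where "z = T.cls (\<lambda>n. [])"
      have z: "z \<in> carrier T.completion" unfolding z_def by (intro T.cls_closed) simp
      have zz: "0 \<odot>\<^bsub>T.completion\<^esub> z = z"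
        unfolding z_def by (subst T.completion_smult) (simp_all add: tensor_smult_def)
      have "Q z = 0 \<odot>\<^bsub>T.completion\<^esub> Q z"
        using bounded_ops_smult[OF that z, of 0] by (simp only: zz)
      also have "\<dots> = \<zero>\<^bsub>T.completion\<^esub>"
        by (rule S.vec_zero_smult[OF bounded_ops_closed[OF that z], symmetric])
      finally show ?thesis by (simp only: z_def)
    qed
    show ?case by (simp only: Q[OF R] Q[OF S])
  next
    case (Cons p u)
    obtain b \<xi> where p: "p = (b, \<xi>)" "b \<in> A" "\<xi> \<in> carrier K" using Cons by auto
    have u: "T.cls (\<lambda>n. u) \<in> carrier T.completion" using Cons by (intro T.cls_closed) simp
    have split: "T.cls (\<lambda>n. p # u) = elem b \<xi> \<oplus>\<^bsub>T.completion\<^esub> T.cls (\<lambda>n. u)"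
      unfolding elem_def using p Cons by (subst T.completion_add) simp_all
    show ?case
      unfolding split bounded_ops_add[OF R elem_closed[OF p(2,3)] u]
        bounded_ops_add[OF S elem_closed[OF p(2,3)] u]
      using Cons.IH eq[OF p(2,3)] by simp
  qed
qed

lemma stinespring_rep_eq: "a \<in> A \<Longrightarrow> stinespring_rep H A K \<Psi> a = rep a"
  unfolding stinespring_rep_def stinespring_space_eq stinespring_tensor_eq
  by (rule the_equality) (auto intro!: elem_ops_eqI simp: rep_bounded rep_elem)

text \<open>Moving \<open>a\<close> across the form on tensors turns it into \<open>a\<^sup>*\<close>; the identity passes to the limit.\<close>

lemma rep_adj: "a \<in> A \<Longrightarrow> adj T.completion (rep a) = rep (adj H a)"
proof (rule S.adj_eqI)
  assume a: "a \<in> A"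
  show "rep (adj H a) \<in> bounded_ops T.completion T.completion" using a by (intro rep_bounded) simp
  fix X Y assume "X \<in> carrier T.completion" "Y \<in> carrier T.completion"
  then obtain s t where XY: "X = T.cls s" "Y = T.cls t" and c: "s \<in> T.cauchy" "t \<in> T.cauchy"
    by (metis T.completion_cases)
  have a': "adj H a \<in> A" using a by simp
  have "tensor_ip H K \<Psi> (lmul (adj H a) (s n)) (t n) = tensor_ip H K \<Psi> (s n) (lmul a (t n))" for n
    using tensor_ip_lmul[OF a' T.cauchy_closed[OF c(1)] T.cauchy_closed[OF c(2)]] a by simp
  then have "(\<lambda>n. tensor_ip H K \<Psi> (lmul (adj H a) (s n)) (t n))
      \<longlonglongrightarrow> ip T.completion (T.cls s) (T.cls (\<lambda>n. lmul a (t n)))"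
    using T.ip_completion_limit[OF c(1) rep_cls(1)[OF a c(2)]] by simp
  then show "ip T.completion (rep (adj H a) X) Y = ip T.completion X (rep a Y)"
    unfolding XY rep_cls(2)[OF a c(2)] rep_cls(2)[OF a' c(1)]
    by (rule T.ip_completion_eqI[OF rep_cls(1)[OF a' c(1)] c(2)])
qed

lemma elem_add_left:
  assumes "a \<in> A" "b \<in> A" "\<xi> \<in> carrier K"
  shows "elem (op_add H a b) \<xi> = elem a \<xi> \<oplus>\<^bsub>T.completion\<^esub> elem b \<xi>"
proof -
  have "elem a \<xi> \<oplus>\<^bsub>T.completion\<^esub> elem b \<xi> = T.cls (\<lambda>n. [(a, \<xi>)] @ [(b, \<xi>)])"
    unfolding elem_def using assms by (intro T.completion_add) simp_all
  moreover have "elem (op_add H a b) \<xi> = T.cls (\<lambda>n. [(a, \<xi>)] @ [(b, \<xi>)])"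
    unfolding elem_def
  proof (intro T.cls_eqI T.dst_eq_0I)
    fix u assume u: "u \<in> tensors"
    show "tensor_ip H K \<Psi> u [(op_add H a b, \<xi>)] = tensor_ip H K \<Psi> u ([(a, \<xi>)] @ [(b, \<xi>)])"
      using tensor_ip_lmul_add[OF assms(1,2) u, of "[(op_one H, \<xi>)]"] assms
        T.form_add_right[OF u, of "[(a, \<xi>)]" "[(b, \<xi>)]"] by (simp add: lmul_def)
  qed (use assms in auto)
  ultimately show ?thesis by simp
qed

lemma elem_smult_left:
  assumes "a \<in> A" "\<xi> \<in> carrier K"
  shows "elem (op_smult H c a) \<xi> = c \<odot>\<^bsub>T.completion\<^esub> elem a \<xi>"
proof -
  have "c \<odot>\<^bsub>T.completion\<^esub> elem a \<xi> = T.cls (\<lambda>n. tensor_smult K c [(a, \<xi>)])"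
    unfolding elem_def using assms by (intro T.completion_smult) simp_all
  moreover have "elem (op_smult H c a) \<xi> = T.cls (\<lambda>n. tensor_smult K c [(a, \<xi>)])"
    unfolding elem_def
  proof (intro T.cls_eqI T.dst_eq_0I)
    fix u assume u: "u \<in> tensors"
    show "tensor_ip H K \<Psi> u [(op_smult H c a, \<xi>)] = tensor_ip H K \<Psi> u (tensor_smult K c [(a, \<xi>)])"
      using tensor_ip_lmul_smult[OF assms(1) u, of "[(op_one H, \<xi>)]" c] assms
        T.form_scale_right[OF u, of "[(a, \<xi>)]" c] by (simp add: lmul_def)
  qed (use assms in \<open>auto simp: tensor_smult_def\<close>)
  ultimately show ?thesis by simp
qed

lemma elem_add_right:
  assumes "a \<in> A" "\<xi> \<in> carrier K" "\<eta> \<in> carrier K"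
  shows "elem a (\<xi> \<oplus>\<^bsub>K\<^esub> \<eta>) = elem a \<xi> \<oplus>\<^bsub>T.completion\<^esub> elem a \<eta>"
proof -
  have "elem a \<xi> \<oplus>\<^bsub>T.completion\<^esub> elem a \<eta> = T.cls (\<lambda>n. [(a, \<xi>)] @ [(a, \<eta>)])"
    unfolding elem_def using assms by (intro T.completion_add) simp_all
  moreover have "elem a (\<xi> \<oplus>\<^bsub>K\<^esub> \<eta>) = T.cls (\<lambda>n. [(a, \<xi>)] @ [(a, \<eta>)])"
    unfolding elem_def
  proof (intro T.cls_eqI T.dst_eq_0I)
    fix u assume u: "u \<in> tensors"
    have "kernel p (a, \<xi> \<oplus>\<^bsub>K\<^esub> \<eta>) = kernel p (a, \<xi>) + kernel p (a, \<eta>)" if "p \<in> set u" for p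
    proof -
      have "fst p \<in> A" "snd p \<in> carrier K" using that u by (auto simp: in_lists_conv_set)
      then show ?thesis using assms by (simp add: kernel_def K.ip_add_right)
    qed
    then have "(\<Sum>p\<leftarrow>u. kernel p (a, \<xi> \<oplus>\<^bsub>K\<^esub> \<eta>)) = (\<Sum>p\<leftarrow>u. kernel p (a, \<xi>) + kernel p (a, \<eta>))"
      by (intro arg_cong[where f = sum_list] map_cong refl)
    then show "tensor_ip H K \<Psi> u [(a, \<xi> \<oplus>\<^bsub>K\<^esub> \<eta>)] = tensor_ip H K \<Psi> u ([(a, \<xi>)] @ [(a, \<eta>)])"
      by (simp add: tensor_ip_kernel)
  qed (use assms in auto)
  ultimately show ?thesis by simp
qed

lemma elem_smult_right:
  assumes "a \<in> A" "\<xi> \<in> carrier K"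
  shows "elem a (c \<odot>\<^bsub>K\<^esub> \<xi>) = c \<odot>\<^bsub>T.completion\<^esub> elem a \<xi>"
  unfolding elem_def using assms
  by (subst T.completion_smult) (simp_all add: tensor_smult_def)

lemma rep_linear: "linear_to_ops H A T.completion rep"
  unfolding linear_to_ops_def
proof (intro conjI ballI allI)
  show "rep \<in> A \<rightarrow> bounded_ops T.completion T.completion" by (simp add: rep_bounded)
  fix a assume a: "a \<in> A"
  show "rep (op_add H a b) = op_add T.completion (rep a) (rep b)" if b: "b \<in> A" for b
    using a b
    by (intro elem_ops_eqI rep_bounded S.op_add_bounded)
      (simp_all add: rep_elem op_add_def[of T.completion] H.A_distrib elem_add_left)
  show "rep (op_smult H c a) = op_smult T.completion c (rep a)" for c
    using a
    by (intro elem_ops_eqI rep_bounded S.op_smult_bounded)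
      (simp_all add: rep_elem op_smult_def[of T.completion] H.A_distrib elem_smult_left)
qed

lemma rep_star_hom: "star_hom H A T.completion rep"
  unfolding star_hom_def
proof (intro conjI ballI rep_linear)
  fix a b assume ab: "a \<in> A" "b \<in> A"
  then show "rep (op_mult H a b) = op_mult T.completion (rep a) (rep b)"
    by (intro elem_ops_eqI rep_bounded S.op_mult_bounded)
      (simp_all add: rep_elem compose_eq[of _ "carrier T.completion"] H.A_assoc)
qed (simp add: rep_adj)

lemma rep_unital: "rep (op_one H) = op_one T.completion"
  by (intro elem_ops_eqI rep_bounded S.op_one_bounded) (simp_all add: rep_elem)

text \<open>
  For vectors \<open>\<Sum>\<^sub>k b\<^sub>i\<^sub>k \<otimes> \<eta>\<^sub>i\<^sub>k\<close> the quadratic form of \<open>(rep (T i j))\<close> is that of the image under \<open>\<Psi>\<close>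
  of the matrix of the \<open>b\<^sub>i\<^sub>k\<^sup>* (T i j) b\<^sub>j\<^sub>l\<close>. So positivity passes through the dilation without
  taking square roots in the matrix algebras.
\<close>

lemma rep_positive:
  assumes T: "\<And>i j. i < m \<Longrightarrow> j < m \<Longrightarrow> R i j \<in> A" and pos: "mat_positive H m R"
  shows "mat_positive T.completion m (\<lambda>i j. rep (R i j))"
  unfolding mat_positive_def
proof (intro allI impI)
  fix X :: "nat \<Rightarrow> (nat \<Rightarrow> ('h, 'k) tensor) set"
  assume "\<forall>i<m. X i \<in> carrier T.completion"
  then have "\<forall>i. \<exists>s. i < m \<longrightarrow> s \<in> T.cauchy \<and> X i = T.cls s" by (metis T.completion_cases)
  then obtain s where s: "\<And>i. i < m \<Longrightarrow> s i \<in> T.cauchy" "\<And>i. i < m \<Longrightarrow> X i = T.cls (s i)"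
    by metis
  have lists: "(\<Sum>i<m. \<Sum>j<m. tensor_ip H K \<Psi> (u i) (lmul (R i j) (u j))) \<in> \<real>\<^sub>\<ge>\<^sub>0"
    if u: "\<And>i. i < m \<Longrightarrow> u i \<in> tensors" for u :: "nat \<Rightarrow> ('h, 'k) tensor"
  proof -
    let ?w = "concat (map (\<lambda>i. map (\<lambda>(b, \<eta>). (i, b, \<eta>)) (u i)) [0..<m])"
    have u': "b \<in> A \<and> \<eta> \<in> carrier K" if "i < m" "(b, \<eta>) \<in> set (u i)" for i b \<eta>
      using u[OF that(1)] that(2) by (auto simp: in_lists_conv_set)
    have sum_w: "(\<Sum>p\<leftarrow>concat (map (\<lambda>i. map (\<lambda>(b, \<eta>). (i, b, \<eta>)) (u i)) [0..<k]). f p)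
        = (\<Sum>i<k. \<Sum>q\<leftarrow>u i. f (i, q))" for f :: "nat \<times> ('h \<Rightarrow> 'h) \<times> 'k \<Rightarrow> complex" and k
      by (induction k) (simp_all add: comp_def case_prod_unfold)
    have "(\<Sum>(i, b, \<eta>)\<leftarrow>?w. \<Sum>(j, c, \<zeta>)\<leftarrow>?w. ip K \<eta> (\<Psi> (op_mult H (adj H b) (op_mult H (R i j) c)) \<zeta>)) \<in> \<real>\<^sub>\<ge>\<^sub>0"
      by (rule conjugated_positive[OF T pos]) (use u' in auto)
    also have "(\<Sum>(i, b, \<eta>)\<leftarrow>?w. \<Sum>(j, c, \<zeta>)\<leftarrow>?w. ip K \<eta> (\<Psi> (op_mult H (adj H b) (op_mult H (R i j) c)) \<zeta>))
        = (\<Sum>i<m. \<Sum>p\<leftarrow>u i. \<Sum>j<m. \<Sum>q\<leftarrow>lmul (R i j) (u j). kernel p q)"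
      unfolding sum_w by (simp add: lmul_def kernel_def comp_def case_prod_unfold)
    also have "\<dots> = (\<Sum>i<m. \<Sum>j<m. tensor_ip H K \<Psi> (u i) (lmul (R i j) (u j)))"
      unfolding tensor_ip_kernel sum_list_nth by (intro sum.cong refl sum.swap)
    finally show ?thesis .
  qed
  have "(\<lambda>n. \<Sum>i<m. \<Sum>j<m. tensor_ip H K \<Psi> (s i n) (lmul (R i j) (s j n)))
      \<longlonglongrightarrow> (\<Sum>i<m. \<Sum>j<m. ip T.completion (X i) (rep (R i j) (X j)))"
  proof (intro tendsto_sum)
    fix i j assume ij: "i \<in> {..<m}" "j \<in> {..<m}"
    then have R: "R i j \<in> A" and c: "s i \<in> T.cauchy" "s j \<in> T.cauchy" using T s by auto
    have X: "X i = T.cls (s i)" "X j = T.cls (s j)" using ij s by auto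
    show "(\<lambda>n. tensor_ip H K \<Psi> (s i n) (lmul (R i j) (s j n)))
        \<longlonglongrightarrow> ip T.completion (X i) (rep (R i j) (X j))"
      unfolding X rep_cls(2)[OF R c(2)]
      by (rule T.ip_completion_limit[OF c(1) rep_cls(1)[OF R c(2)]])
  qed
  then show "(\<Sum>i<m. \<Sum>j<m. ip T.completion (X i) (rep (R i j) (X j))) \<in> \<real>\<^sub>\<ge>\<^sub>0"
    by (rule LIMSEQ_nonneg_Reals) (rule lists[OF T.cauchy_closed[OF s(1)]])
qed

lemma rep_completely_positive: "completely_positive H A T.completion rep"
  using rep_linear rep_positive by (auto simp: completely_positive_def)

end

section \<open>The stages of the iteration\<close>

context concrete_cstar
begin

text \<open>
  What is known about every stage: the representation is completely positive again, so that the
  next dilation exists, and bounds of an element of the algebra are inherited by its image, so that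
  the images at all stages together act on the direct sum.
\<close>

definition stage :: "'k ip_space \<Rightarrow> (('h \<Rightarrow> 'h) \<Rightarrow> 'k \<Rightarrow> 'k) \<Rightarrow> bool" where
  "stage K \<sigma> \<longleftrightarrow> hilbert_space K \<and> star_hom H A K \<sigma> \<and> \<sigma> (op_one H) = op_one K
     \<and> completely_positive H A K \<sigma>
     \<and> (\<forall>a\<in>A. \<forall>C\<ge>0. (\<forall>x\<in>carrier H. vnorm H (a x) \<le> C * vnorm H x)
          \<longrightarrow> (\<forall>x\<in>carrier K. vnorm K (\<sigma> a x) \<le> C * vnorm K x))"

lemma stage_cong:
  assumes "stage K \<sigma>" and eq: "\<And>a. a \<in> A \<Longrightarrow> \<sigma> a = \<tau> a"
  shows "stage K \<tau>"
proof -
  have "completely_positive H A K \<tau>"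
    using assms(1) unfolding stage_def completely_positive_def linear_to_ops_def mat_positive_def
    by (simp add: eq Pi_iff)
  then show ?thesis
    using assms(1) by (simp add: stage_def star_hom_def linear_to_ops_def eq Pi_iff)
qed

lemma stage_id: "stage H (\<lambda>a. a)"
  using hilbert_space_axioms A_bounded
  by (auto simp: stage_def star_hom_def completely_positive_def linear_to_ops_def)

text \<open>
  Transport along an injection is a unitary equivalence onto the new space. Operators are compared
  on the image of the carrier only, because all of them are extensional there.
\<close>

lemma stage_transport:
  fixes f :: "'v \<Rightarrow> 'w"
  assumes "stage S \<sigma>" and inj: "inj_on f (carrier S)"
  shows "stage (transport_space f S) (\<lambda>a. transport_op f S (\<sigma> a))"
proof -
  let ?K = "transport_space f S" and ?top = "transport_op f S"
  note t = transport_space_simps[OF inj]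
  interpret S: hilbert_space S using assms by (simp add: stage_def)
  interpret K: hilbert_space ?K using S.hilbert_space_axioms inj by (rule hilbert_space_transport)
  have hom: "star_hom H A S \<sigma>" and cp: "completely_positive H A S \<sigma>"
    and bnd: "\<And>a C x. a \<in> A \<Longrightarrow> 0 \<le> C \<Longrightarrow> (\<And>x. x \<in> carrier H \<Longrightarrow> vnorm H (a x) \<le> C * vnorm H x)
      \<Longrightarrow> x \<in> carrier S \<Longrightarrow> vnorm S (\<sigma> a x) \<le> C * vnorm S x"
    using assms(1) by (auto simp: stage_def)
  have \<sigma>: "\<And>a. a \<in> A \<Longrightarrow> \<sigma> a \<in> bounded_ops S S"
    using hom by (auto simp: star_hom_def linear_to_ops_def)
  have ext: "?top T \<in> extensional (carrier ?K)" for T by (simp add: transport_op_def t(1))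
  have top_bounded: "?top T \<in> bounded_ops ?K ?K" if T: "T \<in> bounded_ops S S" for T
  proof -
    obtain C where C: "\<And>x. x \<in> carrier S \<Longrightarrow> vnorm S (T x) \<le> C * vnorm S x"
      using S.bounded_ops_bound[OF T] by metis
    show ?thesis
    proof (rule bounded_opsI[OF ext, where C = C])
      fix x y assume "x \<in> carrier ?K" "y \<in> carrier ?K"
      then obtain x' y' where "x = f x'" "y = f y'" "x' \<in> carrier S" "y' \<in> carrier S"
        unfolding t(1) by blast
      then show "?top T (x \<oplus>\<^bsub>?K\<^esub> y) = ?top T x \<oplus>\<^bsub>?K\<^esub> ?top T y"
        by (simp add: t bounded_opsD[OF T])
    next
      fix x c assume "x \<in> carrier ?K"
      then obtain x' where x: "x = f x'" "x' \<in> carrier S" unfolding t(1) by blast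
      show "?top T x \<in> carrier ?K" using x by (simp add: t bounded_opsD[OF T])
      show "?top T (c \<odot>\<^bsub>?K\<^esub> x) = c \<odot>\<^bsub>?K\<^esub> ?top T x"
        using x by (simp add: t bounded_opsD[OF T])
      show "vnorm ?K (?top T x) \<le> C * vnorm ?K x"
        using x C by (simp add: t bounded_opsD[OF T])
    qed
  qed
  have op_eqI: "P = Q" if "P \<in> extensional (carrier ?K)" "Q \<in> extensional (carrier ?K)"
    "\<And>x. x \<in> carrier S \<Longrightarrow> P (f x) = Q (f x)" for P Q :: "'w \<Rightarrow> 'w"
    using that unfolding t(1) by (intro extensionalityI) auto
  have add: "?top (op_add S P Q) = op_add ?K (?top P) (?top Q)"
    if "P \<in> bounded_ops S S" "Q \<in> bounded_ops S S" for P Q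
    using bounded_opsD[OF that(1)] bounded_opsD[OF that(2)]
    by (intro op_eqI ext) (simp_all add: op_add_def t)
  have smult: "?top (op_smult S c P) = op_smult ?K c (?top P)" if "P \<in> bounded_ops S S" for P c
    using bounded_opsD[OF that] by (intro op_eqI ext) (simp_all add: op_smult_def t)
  have mult: "?top (op_mult S P Q) = op_mult ?K (?top P) (?top Q)"
    if "Q \<in> bounded_ops S S" for P Q
    using bounded_opsD[OF that] by (intro op_eqI ext) (simp_all add: compose_def t)
  have one: "?top (op_one S) = op_one ?K"
    by (intro op_eqI ext) (simp_all add: op_one_def t)
  have adj: "adj ?K (?top P) = ?top (adj S P)" if P: "P \<in> bounded_ops S S" for P
  proof (rule K.adj_eqI[OF top_bounded[OF S.adj_bounded[OF P]]])
    fix x y assume "x \<in> carrier ?K" "y \<in> carrier ?K"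
    then obtain x' y' where xy: "x = f x'" "y = f y'" "x' \<in> carrier S" "y' \<in> carrier S"
      unfolding t(1) by blast
    then show "ip ?K (?top (adj S P) x) y = ip ?K x (?top P y)"
      using bounded_ops_closed[OF P] bounded_ops_closed[OF S.adj_bounded[OF P]]
      by (simp add: t S.ip_adj_left[OF P])
  qed
  have linear: "linear_to_ops H A ?K (\<lambda>a. ?top (\<sigma> a))"
    using hom by (auto simp: star_hom_def linear_to_ops_def top_bounded add smult Pi_iff)
  have "star_hom H A ?K (\<lambda>a. ?top (\<sigma> a))"
    using hom linear \<sigma> by (simp add: star_hom_def mult adj)
  moreover have "completely_positive H A ?K (\<lambda>a. ?top (\<sigma> a))"
    unfolding completely_positive_def mat_positive_def
  proof (intro conjI linear allI impI)
    fix n and T :: "nat \<Rightarrow> nat \<Rightarrow> 'h \<Rightarrow> 'h" and \<xi> :: "nat \<Rightarrow> 'w"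
    assume T: "(\<forall>i<n. \<forall>j<n. T i j \<in> A) \<and>
        (\<forall>\<xi>. (\<forall>i<n. \<xi> i \<in> carrier H) \<longrightarrow> (\<Sum>i<n. \<Sum>j<n. ip H (\<xi> i) (T i j (\<xi> j))) \<in> \<real>\<^sub>\<ge>\<^sub>0)"
      and \<xi>: "\<forall>i<n. \<xi> i \<in> carrier ?K"
    have "\<forall>i. \<exists>y. i < n \<longrightarrow> y \<in> carrier S \<and> \<xi> i = f y" using \<xi> unfolding t(1) by blast
    then obtain y where y: "\<And>i. i < n \<Longrightarrow> y i \<in> carrier S" "\<And>i. i < n \<Longrightarrow> \<xi> i = f (y i)" by metis
    have "(\<Sum>i<n. \<Sum>j<n. ip S (y i) (\<sigma> (T i j) (y j))) \<in> \<real>\<^sub>\<ge>\<^sub>0"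
      using cp T y(1) unfolding completely_positive_def mat_positive_def by blast
    also have "(\<Sum>i<n. \<Sum>j<n. ip S (y i) (\<sigma> (T i j) (y j)))
        = (\<Sum>i<n. \<Sum>j<n. ip ?K (\<xi> i) (?top (\<sigma> (T i j)) (\<xi> j)))"
    proof (intro sum.cong refl)
      fix i j assume "i \<in> {..<n}" "j \<in> {..<n}"
      then have ij: "i < n" "j < n" by auto
      then have "T i j \<in> A" using T by blast
      from bounded_ops_closed[OF \<sigma>[OF this] y(1)[OF ij(2)]]
      show "ip S (y i) (\<sigma> (T i j) (y j)) = ip ?K (\<xi> i) (?top (\<sigma> (T i j)) (\<xi> j))"
        by (simp only: y(2)[OF ij(1)] y(2)[OF ij(2)] t(7)[OF y(1)[OF ij(2)]] t(5)[OF y(1)[OF ij(1)]])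
    qed
    finally show "(\<Sum>i<n. \<Sum>j<n. ip ?K (\<xi> i) (?top (\<sigma> (T i j)) (\<xi> j))) \<in> \<real>\<^sub>\<ge>\<^sub>0" .
  qed
  moreover have "vnorm ?K (?top (\<sigma> a) x) \<le> C * vnorm ?K x"
    if a: "a \<in> A" and C: "0 \<le> C" "\<And>x. x \<in> carrier H \<Longrightarrow> vnorm H (a x) \<le> C * vnorm H x"
      and x: "x \<in> carrier ?K" for a C x
  proof -
    obtain x' where "x = f x'" "x' \<in> carrier S" using x unfolding t(1) by blast
    then show ?thesis using bnd[OF a C, of x'] bounded_ops_closed[OF \<sigma>[OF a]] by (simp add: t)
  qed
  moreover have "?top (\<sigma> (op_one H)) = op_one ?K" using assms(1) one by (simp add: stage_def)
  ultimately show ?thesis using K.hilbert_space_axioms by (simp add: stage_def)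
qed

lemma completely_positive_comp:
  assumes \<Phi>: "\<Phi> \<in> A \<rightarrow> A" "completely_positive H A H \<Phi>" and \<sigma>: "completely_positive H A K \<sigma>"
  shows "completely_positive H A K (\<sigma> \<circ> \<Phi>)"
  unfolding completely_positive_def
proof (intro conjI allI impI)
  show "linear_to_ops H A K (\<sigma> \<circ> \<Phi>)"
    using assms by (auto simp: completely_positive_def linear_to_ops_def Pi_iff)
  fix n and T :: "nat \<Rightarrow> nat \<Rightarrow> 'h \<Rightarrow> 'h"
  assume T: "(\<forall>i<n. \<forall>j<n. T i j \<in> A) \<and> mat_positive H n T"
  then have "mat_positive H n (\<lambda>i j. \<Phi> (T i j))" using \<Phi> by (simp add: completely_positive_def)
  moreover have "\<forall>i<n. \<forall>j<n. \<Phi> (T i j) \<in> A" using T \<Phi>(1) by auto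
  ultimately show "mat_positive K n (\<lambda>i j. (\<sigma> \<circ> \<Phi>) (T i j))"
    using \<sigma> by (simp add: completely_positive_def)
qed

end

lemma (in semi_inner_product) completion_member_eq:
  assumes "X \<in> carrier completion" "s \<in> X"
  shows "X = cls s"
proof -
  obtain t where "X = cls t" using assms(1) by (metis completion_cases)
  then show ?thesis using assms(2) null_relD by auto
qed

text \<open>A class is determined by any one of its members, so a chosen member can stand for it.\<close>

lemma (in semi_inner_product) inj_representative: "inj_on (\<lambda>X. SOME s. s \<in> X) (carrier completion)"
proof (rule inj_onI)
  fix X Y assume XY: "X \<in> carrier completion" "Y \<in> carrier completion"
    and eq: "(SOME s. s \<in> X) = (SOME s. s \<in> Y)"
  have mem: "(SOME s. s \<in> Z) \<in> Z" if Z: "Z \<in> carrier completion" for Z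
  proof -
    obtain s where "Z = cls s" "s \<in> cauchy" using Z by (metis completion_cases)
    then have "s \<in> Z" using equiv_class_self[OF equiv_null_rel] by blast
    then show ?thesis by (rule someI[of "\<lambda>s. s \<in> Z"])
  qed
  show "X = Y"
    using completion_member_eq[OF XY(1) mem[OF XY(1)]] completion_member_eq[OF XY(2) mem[OF XY(2)]] eq
    by simp
qed

lemma inj_on_class_code: "inj_on (\<lambda>X. SOME s. s \<in> X) M \<Longrightarrow> inj_on class_code M"
  by (simp add: inj_on_def class_code_def)

lemma (in unital_cp) stage_stinespring:
  "H.stage (stinespring_space H A K \<Psi>) (stinespring_rep H A K \<Psi>)"
proof (rule H.stage_cong)
  show "H.stage (stinespring_space H A K \<Psi>) rep"
    unfolding H.stage_def stinespring_space_eq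
    using S.hilbert_space_axioms rep_star_hom rep_unital rep_completely_positive rep_norm by blast
qed (simp add: stinespring_rep_eq)

locale cp_iteration = concrete_cstar H A for H :: "'h ip_space" and A +
  fixes \<Phi> :: "('h \<Rightarrow> 'h) \<Rightarrow> 'h \<Rightarrow> 'h"
  assumes \<Phi>_closed: "\<Phi> \<in> A \<rightarrow> A" and \<Phi>_cp: "completely_positive H A H \<Phi>"
    and \<Phi>_one: "\<Phi> (op_one H) = op_one H"
begin

abbreviation "Hn \<equiv> dil_space H A \<Phi>"
abbreviation "\<sigma> \<equiv> dil_rep H A \<Phi>"
abbreviation "V \<equiv> dil_isometry H A \<Phi>"

lemma \<Phi>_mem [simp]: "a \<in> A \<Longrightarrow> \<Phi> a \<in> A"
  using \<Phi>_closed by auto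

lemma dilation_0: "Hn 0 = transport_space Base H" "\<sigma> 0 = transport_op Base H"
  by (simp_all add: dil_space_def dil_rep_def)

lemma dilation_Suc:
  "Hn (Suc n) = transport_space class_code (stinespring_space H A (Hn n) (\<sigma> n \<circ> \<Phi>))"
  "\<sigma> (Suc n) = (\<lambda>a. transport_op class_code (stinespring_space H A (Hn n) (\<sigma> n \<circ> \<Phi>))
     (stinespring_rep H A (Hn n) (\<sigma> n \<circ> \<Phi>) a))"
  by (simp_all add: dil_space_def dil_rep_def Let_def case_prod_unfold)

lemma unital_cp_stage: "stage (Hn n) (\<sigma> n) \<Longrightarrow> unital_cp H A (Hn n) (\<sigma> n \<circ> \<Phi>)"
  using concrete_cstar_axioms completely_positive_comp[OF \<Phi>_closed \<Phi>_cp, of "Hn n" "\<sigma> n"]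
  by (auto simp: unital_cp_def unital_cp_axioms_def stage_def \<Phi>_one)

lemma stage_dilation: "stage (Hn n) (\<sigma> n)"
proof (induction n)
  case 0
  have "inj_on Base (carrier H)" by (simp add: inj_on_def)
  from stage_transport[OF stage_id this] show ?case by (simp add: dilation_0)
next
  case (Suc n)
  interpret n: unital_cp H A "Hn n" "\<sigma> n \<circ> \<Phi>" using Suc by (rule unital_cp_stage)
  show ?case
    unfolding dilation_Suc
    by (rule stage_transport[OF n.stage_stinespring])
      (simp only: n.stinespring_space_eq inj_on_class_code n.T.inj_representative)
qed

sublocale stg: unital_cp H A "Hn n" "\<sigma> n \<circ> \<Phi>" for n
  by (rule unital_cp_stage[OF stage_dilation])

lemma dil_isometry_apply:
  assumes "\<xi> \<in> carrier (Hn n)"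
  shows "V n \<xi> = class_code (stg.elem n (op_one H) \<xi>)"
  using assms
  by (simp add: dil_isometry_def stinespring_isometry_def stg.stinespring_tensor_eq)

lemma dil_Suc_code:
  "carrier (Hn (Suc n)) = class_code ` carrier (stg.T.completion n)"
  "X \<in> carrier (stg.T.completion n) \<Longrightarrow> Y \<in> carrier (stg.T.completion n)
    \<Longrightarrow> class_code X \<oplus>\<^bsub>Hn (Suc n)\<^esub> class_code Y = class_code (X \<oplus>\<^bsub>stg.T.completion n\<^esub> Y)"
  "X \<in> carrier (stg.T.completion n)
    \<Longrightarrow> c \<odot>\<^bsub>Hn (Suc n)\<^esub> class_code X = class_code (c \<odot>\<^bsub>stg.T.completion n\<^esub> X)"
  "X \<in> carrier (stg.T.completion n) \<Longrightarrow> Y \<in> carrier (stg.T.completion n)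
    \<Longrightarrow> ip (Hn (Suc n)) (class_code X) (class_code Y) = ip (stg.T.completion n) X Y"
  "a \<in> A \<Longrightarrow> X \<in> carrier (stg.T.completion n)
    \<Longrightarrow> \<sigma> (Suc n) a (class_code X) = class_code (stg.rep n a X)"
  unfolding dilation_Suc stg.stinespring_space_eq
  using transport_space_simps[OF inj_on_class_code[OF stg.T.inj_representative[of n]]] by (simp_all add: stg.stinespring_rep_eq)

lemma dil_isometry_closed: "\<xi> \<in> carrier (Hn n) \<Longrightarrow> V n \<xi> \<in> carrier (Hn (Suc n))"
  by (simp add: dil_isometry_apply dil_Suc_code(1))

lemma dil_isometry_add:
  assumes "\<xi> \<in> carrier (Hn n)" "\<eta> \<in> carrier (Hn n)"
  shows "V n (\<xi> \<oplus>\<^bsub>Hn n\<^esub> \<eta>) = V n \<xi> \<oplus>\<^bsub>Hn (Suc n)\<^esub> V n \<eta>"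
  using assms by (simp add: dil_isometry_apply dil_Suc_code(2) stg.elem_add_right)

lemma dil_isometry_smult:
  assumes "\<xi> \<in> carrier (Hn n)"
  shows "V n (c \<odot>\<^bsub>Hn n\<^esub> \<xi>) = c \<odot>\<^bsub>Hn (Suc n)\<^esub> V n \<xi>"
  using assms by (simp add: dil_isometry_apply dil_Suc_code(3) stg.elem_smult_right)

text \<open>Both sides are \<open>\<langle>1 \<otimes> \<xi>, a \<otimes> \<eta>\<rangle>\<close>, for the form that is defined by \<open>\<sigma>\<^sub>n \<circ> \<Phi>\<close>.\<close>

lemma dil_isometry_dilates:
  assumes "a \<in> A" "\<xi> \<in> carrier (Hn n)" "\<eta> \<in> carrier (Hn n)"
  shows "ip (Hn (Suc n)) (V n \<xi>) (\<sigma> (Suc n) a (V n \<eta>)) = ip (Hn n) \<xi> (\<sigma> n (\<Phi> a) \<eta>)"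
  using assms
  by (simp add: dil_isometry_apply dil_Suc_code(4,5) stg.rep_elem stg.ip_elem)

end

section \<open>The dilation on the direct sum\<close>

context hilbert_sequence
begin

sublocale total: hilbert_space "direct_sum Hs"
  by (rule hilbert_space_direct_sum)

lemma vnorm_summable:
  "x \<in> carrier (direct_sum Hs) \<Longrightarrow> summable (\<lambda>n. (vnorm (Hs n) (x n))\<^sup>2)"
  using direct_sum_summable by (simp add: part.vnorm_eq_nrm)

lemma vnorm_memI:
  "(\<And>n. x n \<in> carrier (Hs n)) \<Longrightarrow> summable (\<lambda>n. (vnorm (Hs n) (x n))\<^sup>2)
    \<Longrightarrow> x \<in> carrier (direct_sum Hs)"
  by (rule direct_sum_memI) (simp_all add: part.vnorm_eq_nrm)

lemma vnorm_direct_sum_sq: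
  "x \<in> carrier (direct_sum Hs) \<Longrightarrow> (vnorm (direct_sum Hs) x)\<^sup>2 = (\<Sum>n. (vnorm (Hs n) (x n))\<^sup>2)"
  using direct_sum_nrm_sq by (simp add: part.vnorm_eq_nrm total.vnorm_eq_nrm)

definition diag :: "(nat \<Rightarrow> 'v \<Rightarrow> 'v) \<Rightarrow> (nat \<Rightarrow> 'v) \<Rightarrow> nat \<Rightarrow> 'v" where
  "diag T = (\<lambda>x\<in>carrier (direct_sum Hs). \<lambda>n. T n (x n))"

lemma diag_apply: "x \<in> carrier (direct_sum Hs) \<Longrightarrow> diag T x n = T n (x n)"
  by (simp add: diag_def)

lemma diag_bounded:
  assumes T: "\<And>n. T n \<in> bounded_ops (Hs n) (Hs n)" and C: "0 \<le> C"
    "\<And>n x. x \<in> carrier (Hs n) \<Longrightarrow> vnorm (Hs n) (T n x) \<le> C * vnorm (Hs n) x"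
  shows "diag T \<in> bounded_ops (direct_sum Hs) (direct_sum Hs)"
proof -
  have le: "(vnorm (Hs n) (T n (x n)))\<^sup>2 \<le> C\<^sup>2 * (vnorm (Hs n) (x n))\<^sup>2"
    if "x \<in> carrier (direct_sum Hs)" for x n
  proof -
    have xn: "x n \<in> carrier (Hs n)" using that by (rule direct_sum_closed)
    have "0 \<le> vnorm (Hs n) (T n (x n))"
      unfolding part.vnorm_eq_nrm by (rule part.form.nrm_nonneg[OF bounded_ops_closed[OF T xn]])
    then have "(vnorm (Hs n) (T n (x n)))\<^sup>2 \<le> (C * vnorm (Hs n) (x n))\<^sup>2"
      by (rule power_mono[OF C(2)[OF xn]])
    then show ?thesis by (simp only: power_mult_distrib)
  qed
  have closed: "diag T x \<in> carrier (direct_sum Hs)" if x: "x \<in> carrier (direct_sum Hs)" for x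
  proof (rule vnorm_memI)
    show "diag T x n \<in> carrier (Hs n)" for n
      unfolding diag_apply[OF x] by (rule bounded_ops_closed[OF T direct_sum_closed[OF x]])
    show "summable (\<lambda>n. (vnorm (Hs n) (diag T x n))\<^sup>2)"
      unfolding diag_apply[OF x]
      by (rule summable_comparison_test'[OF summable_mult[OF vnorm_summable[OF x]], where N = 0])
        (use le[OF x] in simp)
  qed
  show ?thesis
  proof (rule bounded_opsI[where C = C])
    show "diag T \<in> extensional (carrier (direct_sum Hs))" by (simp add: diag_def)
    fix x y assume x: "x \<in> carrier (direct_sum Hs)" and y: "y \<in> carrier (direct_sum Hs)"
    show "diag T (x \<oplus>\<^bsub>direct_sum Hs\<^esub> y) = diag T x \<oplus>\<^bsub>direct_sum Hs\<^esub> diag T y"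
      using x y by (intro ext) (simp add: diag_apply bounded_ops_add[OF T])
  next
    fix c x assume x: "x \<in> carrier (direct_sum Hs)"
    show "diag T x \<in> carrier (direct_sum Hs)" by (rule closed[OF x])
    show "diag T (c \<odot>\<^bsub>direct_sum Hs\<^esub> x) = c \<odot>\<^bsub>direct_sum Hs\<^esub> diag T x"
      using x by (intro ext) (simp add: diag_apply bounded_ops_smult[OF T])
    have "(vnorm (direct_sum Hs) (diag T x))\<^sup>2 \<le> (\<Sum>n. C\<^sup>2 * (vnorm (Hs n) (x n))\<^sup>2)"
      unfolding vnorm_direct_sum_sq[OF closed[OF x]]
      by (rule suminf_le[OF _ vnorm_summable[OF closed[OF x]] summable_mult[OF vnorm_summable[OF x]]])
        (simp add: diag_apply[OF x] le[OF x])
    also have "\<dots> = (C * vnorm (direct_sum Hs) x)\<^sup>2"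
      by (simp add: suminf_mult[OF vnorm_summable[OF x]] vnorm_direct_sum_sq[OF x] power_mult_distrib)
    finally show "vnorm (direct_sum Hs) (diag T x) \<le> C * vnorm (direct_sum Hs) x"
      by (rule power2_le_imp_le) (use C x in \<open>simp add: total.vnorm_eq_nrm\<close>)
  qed
qed

definition shift :: "(nat \<Rightarrow> 'v \<Rightarrow> 'v) \<Rightarrow> (nat \<Rightarrow> 'v) \<Rightarrow> nat \<Rightarrow> 'v" where
  "shift V = (\<lambda>x\<in>carrier (direct_sum Hs). \<lambda>n. case n of 0 \<Rightarrow> \<zero>\<^bsub>Hs 0\<^esub> | Suc m \<Rightarrow> V m (x m))"

lemma shift_apply:
  "x \<in> carrier (direct_sum Hs) \<Longrightarrow> shift V x 0 = \<zero>\<^bsub>Hs 0\<^esub>"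
  "x \<in> carrier (direct_sum Hs) \<Longrightarrow> shift V x (Suc m) = V m (x m)"
  by (simp_all add: shift_def)

lemma shift_isometry:
  assumes closed: "\<And>n x. x \<in> carrier (Hs n) \<Longrightarrow> V n x \<in> carrier (Hs (Suc n))"
    and add: "\<And>n x y. x \<in> carrier (Hs n) \<Longrightarrow> y \<in> carrier (Hs n)
        \<Longrightarrow> V n (x \<oplus>\<^bsub>Hs n\<^esub> y) = V n x \<oplus>\<^bsub>Hs (Suc n)\<^esub> V n y"
    and scale: "\<And>n x c. x \<in> carrier (Hs n) \<Longrightarrow> V n (c \<odot>\<^bsub>Hs n\<^esub> x) = c \<odot>\<^bsub>Hs (Suc n)\<^esub> V n x"
    and norm: "\<And>n x. x \<in> carrier (Hs n) \<Longrightarrow> vnorm (Hs (Suc n)) (V n x) = vnorm (Hs n) x"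
  shows "isometry (direct_sum Hs) (direct_sum Hs) (shift V)"
proof -
  have sq: "(vnorm (Hs (Suc n)) (shift V x (Suc n)))\<^sup>2 = (vnorm (Hs n) (x n))\<^sup>2"
    if x: "x \<in> carrier (direct_sum Hs)" for x n
    by (simp only: shift_apply(2)[OF x] norm[OF direct_sum_closed[OF x]])
  have vnorm0: "vnorm (Hs 0) \<zero>\<^bsub>Hs 0\<^esub> = 0" by (simp add: vnorm_def)
  have mem: "shift V x \<in> carrier (direct_sum Hs)" if x: "x \<in> carrier (direct_sum Hs)" for x
  proof (rule vnorm_memI)
    show "shift V x n \<in> carrier (Hs n)" for n
      by (cases n) (simp_all only: shift_apply[OF x] part.M.zero_closed closed[OF direct_sum_closed[OF x]])
    have "summable (\<lambda>n. (vnorm (Hs (Suc n)) (shift V x (Suc n)))\<^sup>2)"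
      unfolding sq[OF x] by (rule vnorm_summable[OF x])
    then show "summable (\<lambda>n. (vnorm (Hs n) (shift V x n))\<^sup>2)"
      by (subst (asm) summable_Suc_iff[where f = "\<lambda>n. (vnorm (Hs n) (shift V x n))\<^sup>2"])
  qed
  have isom: "vnorm (direct_sum Hs) (shift V x) = vnorm (direct_sum Hs) x"
    if x: "x \<in> carrier (direct_sum Hs)" for x
  proof (rule power2_eq_imp_eq)
    show "(vnorm (direct_sum Hs) (shift V x))\<^sup>2 = (vnorm (direct_sum Hs) x)\<^sup>2"
      using suminf_split_head[OF vnorm_summable[OF mem[OF x]]]
      by (simp add: vnorm_direct_sum_sq[OF mem[OF x]] vnorm_direct_sum_sq[OF x] sq[OF x]
          shift_apply(1)[OF x] vnorm0)
  qed (use x mem in \<open>simp_all add: total.vnorm_eq_nrm\<close>)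
  have "shift V \<in> bounded_ops (direct_sum Hs) (direct_sum Hs)"
  proof (rule bounded_opsI[where C = 1])
    show "shift V \<in> extensional (carrier (direct_sum Hs))" by (simp add: shift_def)
    fix x y assume x: "x \<in> carrier (direct_sum Hs)" and y: "y \<in> carrier (direct_sum Hs)"
    have xy: "x \<oplus>\<^bsub>direct_sum Hs\<^esub> y \<in> carrier (direct_sum Hs)"
      using x y by (rule total.M.a_closed)
    have "shift V (x \<oplus>\<^bsub>direct_sum Hs\<^esub> y) n = (shift V x \<oplus>\<^bsub>direct_sum Hs\<^esub> shift V y) n" for n
      using x y by (cases n) (simp_all add: shift_apply[OF xy] shift_apply add)
    then show "shift V (x \<oplus>\<^bsub>direct_sum Hs\<^esub> y) = shift V x \<oplus>\<^bsub>direct_sum Hs\<^esub> shift V y"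
      by (rule ext)
  next
    fix c x assume x: "x \<in> carrier (direct_sum Hs)"
    have cx: "c \<odot>\<^bsub>direct_sum Hs\<^esub> x \<in> carrier (direct_sum Hs)"
      using x by (intro total.form.scale_closed)
    have "shift V (c \<odot>\<^bsub>direct_sum Hs\<^esub> x) n = (c \<odot>\<^bsub>direct_sum Hs\<^esub> shift V x) n" for n
      using x part.smult_r_null[of c 0]
      by (cases n) (simp_all add: shift_apply[OF cx] shift_apply scale)
    then show "shift V (c \<odot>\<^bsub>direct_sum Hs\<^esub> x) = c \<odot>\<^bsub>direct_sum Hs\<^esub> shift V x"
      by (rule ext)
  qed (simp_all add: mem isom)
  then show ?thesis by (simp add: isometry_def isom)
qed

end

context concrete_cstar
begin

text \<open>
  If \<open>\<Phi>\<close> is multiplicative, then \<open>\<pi> a V x\<close> and \<open>V (\<pi> (\<Phi> a)) x\<close> have the same norm, and its square is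
  also their inner product, so they are equal; taking adjoints, \<open>V V\<^sup>*\<close> commutes with \<open>\<pi> a\<close>.
  Conversely, if it commutes, then \<open>\<pi> b V = \<pi> b V V\<^sup>* V = V V\<^sup>* \<pi> b V = V (\<pi> (\<Phi> b))\<close>, and \<open>\<Phi>\<close> is
  multiplicative because \<open>\<pi>\<close> is injective.
\<close>

lemma dilation_multiplicative_iff:
  assumes D: "hilbert_space D" and \<pi>: "faithful_representation H A D \<pi>"
    and V: "V \<in> bounded_ops D D"
    and \<Phi>: "\<Phi> \<in> A \<rightarrow> A" "completely_positive H A H \<Phi>" "\<Phi> (op_one H) = op_one H"
    and dil: "\<And>a x y. a \<in> A \<Longrightarrow> x \<in> carrier D \<Longrightarrow> y \<in> carrier D
        \<Longrightarrow> ip D (V x) (\<pi> a (V y)) = ip D x (\<pi> (\<Phi> a) y)"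
  shows "\<forall>a\<in>A. op_mult D (adj D V) (op_mult D (\<pi> a) V) = \<pi> (\<Phi> a)"
    and "star_hom H A H \<Phi> \<longleftrightarrow> op_mult D V (adj D V) \<in> commutant D (\<pi> ` A)"
proof -
  interpret D: hilbert_space D by (rule D)
  interpret cp: unital_cp H A H \<Phi>
    using concrete_cstar_axioms hilbert_space_axioms \<Phi>
    by (auto simp: unital_cp_def unital_cp_axioms_def)
  have \<Phi>A [simp]: "\<Phi> a \<in> A" if "a \<in> A" for a using \<Phi>(1) that by auto
  have \<pi>_bounded: "\<pi> a \<in> bounded_ops D D" if "a \<in> A" for a
    using \<pi> that by (auto simp: faithful_representation_def star_hom_def linear_to_ops_def)
  note \<pi>_closed [simp] = bounded_ops_closed[OF \<pi>_bounded]
  have \<pi>_mult: "\<pi> (op_mult H a b) x = \<pi> a (\<pi> b x)"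
    if "a \<in> A" "b \<in> A" "x \<in> carrier D" for a b x
    using \<pi> that by (simp add: faithful_representation_def star_hom_def compose_eq)
  have \<pi>_adj: "ip D (\<pi> (adj H a) x) y = ip D x (\<pi> a y)"
    if "a \<in> A" "x \<in> carrier D" "y \<in> carrier D" for a x y
    using \<pi> that D.ip_adj_left[OF \<pi>_bounded[OF that(1)]]
    by (simp add: faithful_representation_def star_hom_def)
  have \<pi>_one: "\<pi> (op_one H) x = x" if "x \<in> carrier D" for x
    using \<pi> that by (simp add: faithful_representation_def)
  have \<pi>_inj: "a = b" if "a \<in> A" "b \<in> A" "\<And>x. x \<in> carrier D \<Longrightarrow> \<pi> a x = \<pi> b x" for a b
  proof -
    have "\<pi> a = \<pi> b" using that \<pi>_bounded by (intro bounded_ops_eqI[where H = D and K = D]) auto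
    then show ?thesis
      using \<pi> that by (auto simp: faithful_representation_def dest: inj_onD)
  qed
  define W where "W = adj D V"
  have W: "W \<in> bounded_ops D D" unfolding W_def by (rule D.adj_bounded[OF V])
  note V_closed [simp] = bounded_ops_closed[OF V] and W_closed [simp] = bounded_ops_closed[OF W]
  have W_right: "ip D x (W y) = ip D (V x) y" if "x \<in> carrier D" "y \<in> carrier D" for x y
    unfolding W_def by (rule D.ip_adj_right[OF V that])
  have compress: "W (\<pi> a (V x)) = \<pi> (\<Phi> a) x" if "a \<in> A" "x \<in> carrier D" for a x
    using that by (intro D.vec_eqI) (simp_all add: W_right dil)
  then show "\<forall>a\<in>A. op_mult D (adj D V) (op_mult D (\<pi> a) V) = \<pi> (\<Phi> a)"
    using W V \<pi>_bounded unfolding W_def[symmetric]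
    by (intro ballI bounded_ops_eqI[where H = D and K = D] D.op_mult_bounded) (simp_all add: compose_eq)
  have WV: "W (V x) = x" if "x \<in> carrier D" for x
    using compress[of "op_one H" x] that by (simp add: \<pi>_one \<Phi>(3))
  have \<Phi>_adj: "\<Phi> (adj H a) = adj H (\<Phi> a)" if a: "a \<in> A" for a
  proof (rule sym, rule adj_eqI)
    show "\<Phi> (adj H a) \<in> bounded_ops H H" using a by (intro A_bounded) simp
    fix x y assume xy: "x \<in> carrier H" "y \<in> carrier H"
    show "ip H (\<Phi> (adj H a) x) y = ip H x (\<Phi> a y)"
      using cp.map_adj[OF a xy] ip_cnj[of y "\<Phi> (adj H a) x"] ip_cnj[of "\<Phi> a y" x] xy a by simp
  qed
  show "star_hom H A H \<Phi> \<longleftrightarrow> op_mult D V (adj D V) \<in> commutant D (\<pi> ` A)"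
    unfolding W_def[symmetric]
  proof
    assume hom: "star_hom H A H \<Phi>"
    have mult: "\<Phi> (op_mult H a b) = op_mult H (\<Phi> a) (\<Phi> b)" if "a \<in> A" "b \<in> A" for a b
      using hom that by (simp add: star_hom_def)
    have intertwine: "\<pi> a (V x) = V (\<pi> (\<Phi> a) x)" if a: "a \<in> A" and x: "x \<in> carrier D" for a x
    proof (rule D.vec_eqI_dst)
      define q where "q = \<pi> (\<Phi> a) x"
      have q: "q \<in> carrier D" using a x by (simp add: q_def)
      have "ip D (\<pi> a (V x)) (\<pi> a (V x)) = ip D (V x) (\<pi> (op_mult H (adj H a) a) (V x))"
        using a x \<pi>_adj[of "adj H a" "V x" "\<pi> a (V x)"] by (simp add: \<pi>_mult)
      also have "\<dots> = ip D x (\<pi> (adj H (\<Phi> a)) (\<pi> (\<Phi> a) x))"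
        using a x dil[of "op_mult H (adj H a) a" x x] by (simp add: mult \<Phi>_adj \<pi>_mult)
      also have "\<dots> = ip D q q"
        using a x q \<pi>_adj[of "adj H (\<Phi> a)" x q] by (simp add: q_def)
      finally have "ip D (\<pi> a (V x)) (\<pi> a (V x)) = ip D q q" .
      moreover have "ip D (V q) (V q) = ip D q q"
        using dil[of "op_one H" q q] q by (simp add: \<pi>_one \<Phi>(3))
      moreover have "ip D (V q) (\<pi> a (V x)) = ip D q q"
        using a x q by (simp add: dil q_def[symmetric])
      ultimately have "(D.form.dst (\<pi> a (V x)) (V q))\<^sup>2 = 0"
        using a x q D.form.dst_sq[of "\<pi> a (V x)" "V q"]
          D.form.Re_form_commute[of "\<pi> a (V x)" "V q"] by simp
      then show "D.form.dst (\<pi> a (V x)) (V (\<pi> (\<Phi> a) x)) = 0" by (simp add: q_def)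
    qed (use a x in simp_all)
    have intertwine_adj: "W (\<pi> a y) = \<pi> (\<Phi> a) (W y)" if a: "a \<in> A" and y: "y \<in> carrier D" for a y
    proof (rule D.vec_eqI)
      fix x assume x: "x \<in> carrier D"
      have "ip D x (W (\<pi> a y)) = ip D (\<pi> (adj H a) (V x)) y"
        using a x y by (simp add: W_right \<pi>_adj)
      also have "\<dots> = ip D (\<pi> (adj H (\<Phi> a)) x) (W y)"
        using a x y by (simp add: intertwine \<Phi>_adj W_right)
      also have "\<dots> = ip D x (\<pi> (\<Phi> a) (W y))" using a x y by (simp add: \<pi>_adj)
      finally show "ip D x (W (\<pi> a y)) = ip D x (\<pi> (\<Phi> a) (W y))" .
    qed (use a y in simp_all)
    have "op_mult D (op_mult D V W) (\<pi> a) = op_mult D (\<pi> a) (op_mult D V W)" if a: "a \<in> A" for a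
      using a V W \<pi>_bounded
      by (intro bounded_ops_eqI[where H = D and K = D] D.op_mult_bounded)
        (simp_all add: compose_eq intertwine intertwine_adj)
    then show "op_mult D V W \<in> commutant D (\<pi> ` A)"
      using V W by (simp add: commutant_def D.op_mult_bounded)
  next
    assume comm: "op_mult D V W \<in> commutant D (\<pi> ` A)"
    have comm': "V (W (\<pi> a y)) = \<pi> a (V (W y))" if a: "a \<in> A" and y: "y \<in> carrier D" for a y
    proof -
      have "op_mult D (op_mult D V W) (\<pi> a) y = op_mult D (\<pi> a) (op_mult D V W) y"
        using comm a by (simp add: commutant_def)
      then show ?thesis using a y by (simp add: compose_eq)
    qed
    have intertwine: "\<pi> b (V x) = V (\<pi> (\<Phi> b) x)" if "b \<in> A" "x \<in> carrier D" for b x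
      using comm'[of b "V x"] that by (simp add: compress WV)
    have "\<Phi> (op_mult H a b) = op_mult H (\<Phi> a) (\<Phi> b)" if a: "a \<in> A" and b: "b \<in> A" for a b
    proof (rule \<pi>_inj)
      fix x assume x: "x \<in> carrier D"
      have "\<pi> (\<Phi> (op_mult H a b)) x = W (\<pi> a (\<pi> b (V x)))"
        using a b x compress[of "op_mult H a b" x] by (simp add: \<pi>_mult)
      also have "\<dots> = \<pi> (\<Phi> a) (\<pi> (\<Phi> b) x)"
        using a b x by (simp add: intertwine[OF b x] compress)
      finally show "\<pi> (\<Phi> (op_mult H a b)) x = \<pi> (op_mult H (\<Phi> a) (\<Phi> b)) x"
        using a b x by (simp add: \<pi>_mult)
    qed (use a b in simp_all)
    then show "star_hom H A H \<Phi>"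
      using \<Phi>(2) \<Phi>_adj by (simp add: star_hom_def completely_positive_def)
  qed
qed

end

context cp_iteration
begin

lemma stageD:
  "hilbert_space (Hn n)" "star_hom H A (Hn n) (\<sigma> n)" "\<sigma> n (op_one H) = op_one (Hn n)"
  using stage_dilation[of n] unfolding stage_def by blast+

lemma \<sigma>_one: "y \<in> carrier (Hn n) \<Longrightarrow> \<sigma> n (op_one H) y = y"
  by (simp only: stageD(3)) (simp add: op_one_def)

sublocale seq: hilbert_sequence Hn
  by (rule hilbert_sequence.intro) (rule stageD(1))

definition \<pi> :: "('h \<Rightarrow> 'h) \<Rightarrow> (nat \<Rightarrow> 'h dilation_vec) \<Rightarrow> nat \<Rightarrow> 'h dilation_vec" where
  "\<pi> a = seq.diag (\<lambda>n. \<sigma> n a)"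

lemma \<sigma>_bounded: "a \<in> A \<Longrightarrow> \<sigma> n a \<in> bounded_ops (Hn n) (Hn n)"
  using stageD(2)[of n] by (auto simp: star_hom_def linear_to_ops_def)

lemma \<pi>_bounded: "a \<in> A \<Longrightarrow> \<pi> a \<in> bounded_ops (direct_sum Hn) (direct_sum Hn)"
proof -
  assume a: "a \<in> A"
  obtain C where C: "0 \<le> C" "\<And>x. x \<in> carrier H \<Longrightarrow> vnorm H (a x) \<le> C * vnorm H x"
    using bounded_ops_bound[OF A_bounded[OF a]] by metis
  then have "vnorm (Hn n) (\<sigma> n a x) \<le> C * vnorm (Hn n) x" if "x \<in> carrier (Hn n)" for n x
    using stage_dilation[of n] a that unfolding stage_def by blast
  then show ?thesis unfolding \<pi>_def by (intro seq.diag_bounded[OF \<sigma>_bounded[OF a] C(1)])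
qed

lemma \<pi>_star_hom: "star_hom H A (direct_sum Hn) \<pi>"
proof -
  have ext: "P = Q" if "P \<in> extensional (carrier (direct_sum Hn))" "Q \<in> extensional (carrier (direct_sum Hn))"
    "\<And>x n. x \<in> carrier (direct_sum Hn) \<Longrightarrow> P x n = Q x n" for P Q :: "_ \<Rightarrow> nat \<Rightarrow> 'h dilation_vec"
    using that by (intro extensionalityI[of _ "carrier (direct_sum Hn)"]) auto
  have e: "\<pi> a \<in> extensional (carrier (direct_sum Hn))" for a by (simp add: \<pi>_def seq.diag_def)
  have ap: "\<pi> a x n = \<sigma> n a (x n)" if "x \<in> carrier (direct_sum Hn)" for a x n
    using that by (simp add: \<pi>_def seq.diag_apply)
  show ?thesis
    unfolding star_hom_def linear_to_ops_def
  proof (intro conjI ballI allI)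
    show "\<pi> \<in> A \<rightarrow> bounded_ops (direct_sum Hn) (direct_sum Hn)" by (simp add: \<pi>_bounded)
    fix a assume a: "a \<in> A"
    show "\<pi> (op_smult H c a) = op_smult (direct_sum Hn) c (\<pi> a)" for c
    proof (rule ext[OF e])
      fix x n assume x: "x \<in> carrier (direct_sum Hn)"
      have "\<sigma> n (op_smult H c a) = op_smult (Hn n) c (\<sigma> n a)"
        using stageD(2)[of n] a by (simp add: star_hom_def linear_to_ops_def)
      then show "\<pi> (op_smult H c a) x n = op_smult (direct_sum Hn) c (\<pi> a) x n"
        using x by (simp add: ap op_smult_def)
    qed (simp add: op_smult_def)
    show "\<pi> (op_add H a b) = op_add (direct_sum Hn) (\<pi> a) (\<pi> b)" if b: "b \<in> A" for b
    proof (rule ext[OF e])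
      fix x n assume x: "x \<in> carrier (direct_sum Hn)"
      have "\<sigma> n (op_add H a b) = op_add (Hn n) (\<sigma> n a) (\<sigma> n b)"
        using stageD(2)[of n] a b by (simp add: star_hom_def linear_to_ops_def)
      then show "\<pi> (op_add H a b) x n = op_add (direct_sum Hn) (\<pi> a) (\<pi> b) x n"
        using x by (simp add: ap op_add_def)
    qed (simp add: op_add_def)
    show "\<pi> (op_mult H a b) = op_mult (direct_sum Hn) (\<pi> a) (\<pi> b)" if b: "b \<in> A" for b
    proof (rule ext[OF e])
      fix x n assume x: "x \<in> carrier (direct_sum Hn)"
      have "\<sigma> n (op_mult H a b) = op_mult (Hn n) (\<sigma> n a) (\<sigma> n b)"
        using stageD(2)[of n] a b by (simp add: star_hom_def)
      then show "\<pi> (op_mult H a b) x n = op_mult (direct_sum Hn) (\<pi> a) (\<pi> b) x n"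
        using x by (simp add: ap compose_eq bounded_ops_closed[OF \<pi>_bounded[OF b]])
    qed (simp add: compose_def)
    show "\<pi> (adj H a) = adj (direct_sum Hn) (\<pi> a)"
    proof (rule sym, rule seq.total.adj_eqI)
      show "\<pi> (adj H a) \<in> bounded_ops (direct_sum Hn) (direct_sum Hn)" using a by (simp add: \<pi>_bounded)
      fix x y assume x: "x \<in> carrier (direct_sum Hn)" and y: "y \<in> carrier (direct_sum Hn)"
      have "ip (Hn n) (\<sigma> n (adj H a) (x n)) (y n) = ip (Hn n) (x n) (\<sigma> n a (y n))" for n
      proof -
        have "\<sigma> n (adj H a) = adj (Hn n) (\<sigma> n a)" using stageD(2)[of n] a by (simp add: star_hom_def)
        then show ?thesis
          using hilbert_space.ip_adj_left[OF seq.hilbert \<sigma>_bounded[OF a]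
              seq.direct_sum_closed[OF x] seq.direct_sum_closed[OF y]] by simp
      qed
      then show "ip (direct_sum Hn) (\<pi> (adj H a) x) y = ip (direct_sum Hn) x (\<pi> a y)"
        using x y by (simp add: direct_sum_ip ap)
    qed
  qed
qed

text \<open>Already the summand of the initial space, on which the algebra acts as given, separates points.\<close>

lemma \<pi>_faithful: "faithful_representation H A (direct_sum Hn) \<pi>"
  unfolding faithful_representation_def
proof (intro conjI \<pi>_star_hom)
  show "\<pi> (op_one H) = op_one (direct_sum Hn)"
  proof (rule extensionalityI[of _ "carrier (direct_sum Hn)"])
    fix x assume x: "x \<in> carrier (direct_sum Hn)"
    have "\<pi> (op_one H) x n = x n" for n
      unfolding \<pi>_def seq.diag_apply[OF x] by (rule \<sigma>_one[OF seq.direct_sum_closed[OF x]])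
    then show "\<pi> (op_one H) x = op_one (direct_sum Hn) x"
      using x by (simp add: fun_eq_iff op_one_def)
  qed (simp_all add: \<pi>_def seq.diag_def op_one_def)
  show "inj_on \<pi> A"
  proof (rule inj_onI)
    fix a b assume a: "a \<in> A" and b: "b \<in> A" and eq: "\<pi> a = \<pi> b"
    have inj: "inj_on Base (carrier H)" by (simp add: inj_on_def)
    show "a = b"
    proof (rule A_eqI[OF a b])
      fix x assume x: "x \<in> carrier H"
      then have "Base x \<in> carrier (Hn 0)" by (simp add: dilation_0 transport_space_simps[OF inj])
      then have s: "seq.single 0 (Base x) \<in> carrier (direct_sum Hn)" by (rule seq.single_closed)
      have "\<pi> c (seq.single 0 (Base x)) 0 = Base (c x)" for c
        using x by (simp add: \<pi>_def seq.diag_apply[OF s])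
          (simp add: seq.single_def dilation_0 transport_space_simps[OF inj])
      from this[of a] this[of b] show "a x = b x" by (simp add: eq)
    qed
  qed
qed

lemma dil_isometry_inf_eq: "dil_isometry_inf H A \<Phi> = seq.shift V"
  by (simp add: dil_isometry_inf_def dil_space_inf_def seq.shift_def)

lemma dil_isometry_norm:
  assumes x: "x \<in> carrier (Hn n)"
  shows "vnorm (Hn (Suc n)) (V n x) = vnorm (Hn n) x"
proof -
  have "ip (Hn (Suc n)) (V n x) (V n x) = ip (Hn n) x x"
    using dil_isometry_dilates[of "op_one H" x n x] x dil_isometry_closed[OF x]
    by (simp add: \<sigma>_one \<Phi>_one)
  then show ?thesis by (simp add: vnorm_def)
qed

lemma isometry_inf: "isometry (direct_sum Hn) (direct_sum Hn) (dil_isometry_inf H A \<Phi>)"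
  unfolding dil_isometry_inf_eq
  by (rule seq.shift_isometry)
    (rule dil_isometry_closed dil_isometry_add dil_isometry_smult dil_isometry_norm; assumption)+

text \<open>
  The coordinate \<open>0\<close> of a shifted vector vanishes, and the coordinate \<open>n + 1\<close> contributes what the
  dilation of stage \<open>n\<close> gives.
\<close>

lemma dilation_inf:
  assumes a: "a \<in> A" and x: "x \<in> carrier (direct_sum Hn)" and y: "y \<in> carrier (direct_sum Hn)"
  shows "ip (direct_sum Hn) (dil_isometry_inf H A \<Phi> x) (\<pi> a (dil_isometry_inf H A \<Phi> y))
    = ip (direct_sum Hn) x (\<pi> (\<Phi> a) y)"
proof -
  let ?S = "seq.shift V"
  have "?S \<in> bounded_ops (direct_sum Hn) (direct_sum Hn)"
    using isometry_inf unfolding dil_isometry_inf_eq isometry_def by (rule conjunct1)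
  then have S: "?S z \<in> carrier (direct_sum Hn)" if "z \<in> carrier (direct_sum Hn)" for z
    using that by (rule bounded_ops_closed)
  have \<pi>S: "\<pi> a (?S y) \<in> carrier (direct_sum Hn)" by (rule bounded_ops_closed[OF \<pi>_bounded[OF a] S[OF y]])
  define f where "f n = ip (Hn n) (?S x n) (\<pi> a (?S y) n)" for n
  have "summable f" unfolding f_def by (rule seq.direct_sum_ip_summable[OF S[OF x] \<pi>S])
  then have "(\<Sum>n. f n) = f 0 + (\<Sum>n. f (Suc n))" using suminf_split_head[of f] by simp
  also have "f 0 = 0"
    unfolding f_def seq.shift_apply(1)[OF x]
    by (rule stg.K.form.form_zr_left[OF seq.direct_sum_closed[OF \<pi>S]])
  also have "(\<lambda>n. f (Suc n)) = (\<lambda>n. ip (Hn n) (x n) (\<pi> (\<Phi> a) y n))"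
  proof (rule ext)
    fix n
    show "f (Suc n) = ip (Hn n) (x n) (\<pi> (\<Phi> a) y n)"
      unfolding f_def \<pi>_def seq.diag_apply[OF S[OF y]] seq.diag_apply[OF y]
        seq.shift_apply(2)[OF x] seq.shift_apply(2)[OF y]
      by (rule dil_isometry_dilates[OF a seq.direct_sum_closed[OF x] seq.direct_sum_closed[OF y]])
  qed
  finally show ?thesis by (simp add: dil_isometry_inf_eq direct_sum_ip f_def)
qed

end

theorem proposition7:
  fixes H :: "'h ip_space"
    and A :: "('h \<Rightarrow> 'h) set"
    and \<Phi> :: "('h \<Rightarrow> 'h) \<Rightarrow> 'h \<Rightarrow> 'h"
  assumes "hilbert_space H"
    and "concrete_cstar_algebra H A"
    and "\<Phi> \<in> A \<rightarrow> A"
    and "completely_positive H A H \<Phi>"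
    and "\<Phi> (op_one H) = op_one H"
  shows "let K = dil_space_inf H A \<Phi>; V = dil_isometry_inf H A \<Phi> in
    isometry K K V \<and>
    (\<exists>\<pi>. faithful_representation H A K \<pi> \<and>
         (\<forall>a\<in>A. op_mult K (adj K V) (op_mult K (\<pi> a) V) = \<pi> (\<Phi> a)) \<and>
         (star_hom H A H \<Phi> \<longleftrightarrow> op_mult K V (adj K V) \<in> commutant K (\<pi> ` A)))"
proof -
  interpret cp_iteration H A \<Phi>
    using assms
    by (simp add: cp_iteration_def cp_iteration_axioms_def concrete_cstar_def concrete_cstar_axioms_def)
  have K: "dil_space_inf H A \<Phi> = direct_sum Hn" by (simp add: dil_space_inf_def)
  have V: "dil_isometry_inf H A \<Phi> \<in> bounded_ops (direct_sum Hn) (direct_sum Hn)"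
    using isometry_inf by (simp add: isometry_def)
  note iff = dilation_multiplicative_iff[where D = "direct_sum Hn" and \<pi> = \<pi> and \<Phi> = \<Phi>
    and V = "dil_isometry_inf H A \<Phi>",
    OF seq.hilbert_space_direct_sum \<pi>_faithful V assms(3) assms(4) assms(5) dilation_inf]
  show ?thesis
    unfolding Let_def K using isometry_inf \<pi>_faithful iff by blast
qed

end
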